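(* Let $K$ be an unconstrained Sierpinski carpet and $(\mathcal{E},\mathcal{F})$ a self-similar $D_4$-symmetric resistance form on $K$ with renormalization factor $r$, whose resistance metric $R$ is jointly continuous on $K\times K$ and satisfies $R(L_2,L_4)=1$. Let $n\ge0$. Then $\{f|_{\partial_nK}:f\in\mathcal{F}\}=\Lambda^{\sigma(r)}_{2,2}(\partial_nK)$. Moreover, there are $C_1,C_2>0$ depending only on $k$ such that $C_1[[h|_{\partial_nK}]]^2_{\Lambda^{\sigma(r)}_{2,2}(\partial_nK)}\le\mathcal{E}(h)\le C_2[[h|_{\partial_nK}]]^2_{\Lambda^{\sigma(r)}_{2,2}(\partial_nK)}$ for every $h\in\mathcal{H}_n$, where $\mathcal{H}_n=\{h\in\mathcal{F}:\mathcal{E}(h)=\inf\{\mathcal{E}(f):f\in\mathcal{F},f|_{\partial_nK}=h|_{\partial_nK}\}\}$.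
   Context: USC: $\square=[0,1]^2$, $q_1=(0,0),q_2=(1,0),q_3=(1,1),q_4=(0,1)$; integers $k\ge3$, $4(k-1)\le N\le k^2-1$; maps $\Psi_i(x)=x/k+c_i$ ($1\le i\le N$) with pairwise intersections of the squares $\Psi_i(\square)$ a segment, point or empty, $\bigcup_i\Psi_i(\square)$ connected and invariant under the group $\mathscr G$ of 8 isometries of $\square$, and $\overline{q_1,q_2}\subset\bigcup_i\Psi_i(\square)\subset\square$; $K$ is the compact set with $K=\bigcup_i\Psi_iK$. Sides $L_1=\overline{q_1,q_2},L_2=\overline{q_2,q_3},L_3=\overline{q_3,q_4},L_4=\overline{q_4,q_1}$, $\partial_0K=\bigcup_{i=1}^4L_i$. Words: $W_n=\{1,\dots,N\}^n$ ($W_0=\{\emptyset\}$), $\Psi_w=\Psi_{w_1}\circ\cdots\circ\Psi_{w_n}$, $\partial_nK=\bigcup_{w\in W_n}\Psi_w\partial_0K$. Resistance form, effective resistance $R(A,B)=\sup\{\mathcal{E}(f)^{-1}:f|_A=0,f|_B=1\}$, resistance metric; self-similar with factor $r$: $\mathcal{F}=\{f:f\circ\Psi_i\in\mathcal{F}\ \forall i\}$ and $\mathcal{E}(f)=\sum_ir^{-1}\mathcal{E}(f\circ\Psi_i)$; $D_4$-symmetric: $f\circ\Gamma\in\mathcal{F}$, $\mathcal{E}(f\circ\Gamma)=\mathcal{E}(f)$ for $\Gamma\in\mathscr G$; jointly continuous: $R$ continuous on $K\times K$ in the Euclidean topology. Besov norms: $\sigma(r)=-\frac{\log r}{2\log k}+\frac12$.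 For $u\in C[0,1]$, $[[u]]^2_{\Lambda^{\sigma}_{2,2}[0,1]}=\sum_{m\ge0}k^{(2\sigma-1)m}\sum_{l=0}^{k^m-1}(u(l/k^m)-u((l+1)/k^m))^2$ (so for $\sigma=\sigma(r)$ the weight is $r^{-m}$). For a segment $\overline{x,y}$ with $\gamma(t)=(1-t)x+ty$ and $u\in C(\overline{x,y})$, $[[u]]_{\Lambda^\sigma_{2,2}(\overline{x,y})}=|\overline{x,y}|^{1/2-\sigma}[[u\circ\gamma]]_{\Lambda^\sigma_{2,2}[0,1]}$. For $u\in C(\partial_nK)$, $[[u]]^2_{\Lambda^{\sigma(r)}_{2,2}(\partial_nK)}=\sum_{w\in W_n}\sum_{i=1}^4[[u|_{\Psi_wL_i}]]^2_{\Lambda^{\sigma(r)}_{2,2}(\Psi_wL_i)}$ and $\Lambda^{\sigma(r)}_{2,2}(\partial_nK)=\{u\in C(\partial_nK):[[u]]_{\Lambda^{\sigma(r)}_{2,2}(\partial_nK)}<\infty\}$. *)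

theory Defs
  imports "HOL-Analysis.Analysis"
begin

type_synonym pt = "real \<times> real"

definition usq :: "pt set" where "usq = {0..1} \<times> {0..1}"

definition qq1 :: pt where "qq1 = (0,0)"
definition qq2 :: pt where "qq2 = (1,0)"
definition qq3 :: pt where "qq3 = (1,1)"
definition qq4 :: pt where "qq4 = (0,1)"

definition side :: "nat \<Rightarrow> pt set" where
  "side i = (if i = 1 then closed_segment qq1 qq2
             else if i = 2 then closed_segment qq2 qq3
             else if i = 3 then closed_segment qq3 qq4
             else closed_segment qq4 qq1)"

definition side_start :: "nat \<Rightarrow> pt" where
  "side_start i = (if i = 1 then qq1 else if i = 2 then qq2 else if i = 3 then qq3 else qq4)"
definition side_end :: "nat \<Rightarrow> pt" where
  "side_end i = (if i = 1 then qq2 else if i = 2 then qq3 else if i = 3 then qq4 else qq1)"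

definition bdry0 :: "pt set" where "bdry0 = (\<Union>i\<in>{1..4}. side i)"

definition D4 :: "(pt \<Rightarrow> pt) set" where
  "D4 = {(\<lambda>(x,y). (x,y)), (\<lambda>(x,y). (1-x,y)), (\<lambda>(x,y). (x,1-y)), (\<lambda>(x,y). (1-x,1-y)),
         (\<lambda>(x,y). (y,x)), (\<lambda>(x,y). (1-y,x)), (\<lambda>(x,y). (y,1-x)), (\<lambda>(x,y). (1-y,1-x))}"

definition Psi :: "nat \<Rightarrow> (nat \<Rightarrow> pt) \<Rightarrow> nat \<Rightarrow> pt \<Rightarrow> pt" where
  "Psi k c i x = (1 / real k) *\<^sub>R x + c i"

definition USC :: "nat \<Rightarrow> nat \<Rightarrow> (nat \<Rightarrow> pt) \<Rightarrow> bool" where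
  "USC k N c \<longleftrightarrow>
     k \<ge> 3 \<and> 4 * (k - 1) \<le> N \<and> N \<le> k^2 - 1 \<and>
     (\<forall>i\<in>{1..N}. \<forall>j\<in>{1..N}. i \<noteq> j \<longrightarrow>
        (let S = Psi k c i ` usq \<inter> Psi k c j ` usq in S = {} \<or> (\<exists>a b. S = closed_segment a b))) \<and>
     connected (\<Union>i\<in>{1..N}. Psi k c i ` usq) \<and>
     (\<forall>\<Gamma>\<in>D4. \<Gamma> ` (\<Union>i\<in>{1..N}. Psi k c i ` usq) = (\<Union>i\<in>{1..N}. Psi k c i ` usq)) \<and>
     closed_segment qq1 qq2 \<subseteq> (\<Union>i\<in>{1..N}. Psi k c i ` usq) \<and>
     (\<Union>i\<in>{1..N}. Psi k c i ` usq) \<subseteq> usq"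

definition is_attractor :: "nat \<Rightarrow> nat \<Rightarrow> (nat \<Rightarrow> pt) \<Rightarrow> pt set \<Rightarrow> bool" where
  "is_attractor k N c K \<longleftrightarrow> compact K \<and> K \<noteq> {} \<and> K = (\<Union>i\<in>{1..N}. Psi k c i ` K)"

definition words :: "nat \<Rightarrow> nat \<Rightarrow> nat list set" where
  "words N n = {w. length w = n \<and> set w \<subseteq> {1..N}}"

definition Psiw :: "nat \<Rightarrow> (nat \<Rightarrow> pt) \<Rightarrow> nat list \<Rightarrow> pt \<Rightarrow> pt" where
  "Psiw k c w = foldr (\<lambda>i g. Psi k c i \<circ> g) w id"

definition bdryn :: "nat \<Rightarrow> nat \<Rightarrow> (nat \<Rightarrow> pt) \<Rightarrow> nat \<Rightarrow> pt set" where
  "bdryn k N c n = (\<Union>w\<in>words N n. Psiw k c w ` bdry0)"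

text \<open>Functions on a set X are represented as functions vanishing outside X;
  rst X f is the restriction of f to X.\<close>
definition rst :: "'a set \<Rightarrow> ('a \<Rightarrow> real) \<Rightarrow> 'a \<Rightarrow> real" where
  "rst X f = (\<lambda>x. if x \<in> X then f x else 0)"

definition funs_on :: "'a set \<Rightarrow> ('a \<Rightarrow> real) set" where
  "funs_on X = {f. \<forall>x. x \<notin> X \<longrightarrow> f x = 0}"

text \<open>Kigami's resistance form (RF1)--(RF5) on X.\<close>
definition resistance_form :: "'a set \<Rightarrow> (('a \<Rightarrow> real) \<Rightarrow> real) \<Rightarrow> ('a \<Rightarrow> real) set \<Rightarrow> bool" where
  "resistance_form X E F \<longleftrightarrow>
     \<comment> \<open>RF1\<close>
     F \<subseteq> funs_on X \<and>
     (\<forall>a. rst X (\<lambda>_. a) \<in> F) \<and>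
     (\<forall>u\<in>F. \<forall>v\<in>F. (\<lambda>x. u x + v x) \<in> F) \<and> (\<forall>a. \<forall>u\<in>F. (\<lambda>x. a * u x) \<in> F) \<and>
     (\<exists>B. (\<forall>u\<in>F. E u = B u u) \<and> (\<forall>u\<in>F. \<forall>v\<in>F. B u v = B v u) \<and>
          (\<forall>u\<in>F. \<forall>v\<in>F. \<forall>w\<in>F. \<forall>a b. B (\<lambda>x. a * u x + b * v x) w = a * B u w + b * B v w)) \<and>
     (\<forall>u\<in>F. E u \<ge> 0) \<and>
     (\<forall>u\<in>F. E u = 0 \<longleftrightarrow> (\<exists>a. \<forall>x\<in>X. u x = a)) \<and>
     \<comment> \<open>RF2: (F / constants, E) is a Hilbert space, i.e. complete\<close>
     (\<forall>u. (\<forall>n. u n \<in> F) \<longrightarrow>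
        (\<forall>e>0. \<exists>M. \<forall>m\<ge>M. \<forall>n\<ge>M. E (\<lambda>x. u m x - u n x) < e) \<longrightarrow>
        (\<exists>v\<in>F. (\<lambda>n. E (\<lambda>x. u n x - v x)) \<longlonglongrightarrow> 0)) \<and>
     \<comment> \<open>RF3\<close>
     (\<forall>V v. finite V \<and> V \<subseteq> X \<longrightarrow> (\<exists>u\<in>F. \<forall>x\<in>V. u x = v x)) \<and>
     \<comment> \<open>RF4\<close>
     (\<forall>x\<in>X. \<forall>y\<in>X. bdd_above {(u x - u y)^2 / E u | u. u \<in> F \<and> E u > 0}) \<and>
     \<comment> \<open>RF5 (Markov property)\<close>
     (\<forall>u\<in>F. rst X (\<lambda>x. min 1 (max 0 (u x))) \<in> F \<and>
             E (rst X (\<lambda>x. min 1 (max 0 (u x)))) \<le> E u)"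

definition res_metric :: "(('a \<Rightarrow> real) \<Rightarrow> real) \<Rightarrow> ('a \<Rightarrow> real) set \<Rightarrow> 'a \<Rightarrow> 'a \<Rightarrow> real" where
  "res_metric E F x y = Sup {(u x - u y)^2 / E u | u. u \<in> F \<and> E u > 0}"

definition eff_res :: "(('a \<Rightarrow> real) \<Rightarrow> real) \<Rightarrow> ('a \<Rightarrow> real) set \<Rightarrow> 'a set \<Rightarrow> 'a set \<Rightarrow> real" where
  "eff_res E F A B = Sup {inverse (E f) | f. f \<in> F \<and> (\<forall>x\<in>A. f x = 0) \<and> (\<forall>x\<in>B. f x = 1)}"

definition self_similar_form ::
  "nat \<Rightarrow> nat \<Rightarrow> (nat \<Rightarrow> pt) \<Rightarrow> pt set \<Rightarrow> ((pt \<Rightarrow> real) \<Rightarrow> real) \<Rightarrow> (pt \<Rightarrow> real) set \<Rightarrow> real \<Rightarrow> bool" where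
  "self_similar_form k N c K E F r \<longleftrightarrow>
     F = {f \<in> funs_on K. \<forall>i\<in>{1..N}. rst K (f \<circ> Psi k c i) \<in> F} \<and>
     (\<forall>f\<in>F. E f = (\<Sum>i\<in>{1..N}. inverse r * E (rst K (f \<circ> Psi k c i))))"

definition D4_symmetric :: "pt set \<Rightarrow> ((pt \<Rightarrow> real) \<Rightarrow> real) \<Rightarrow> (pt \<Rightarrow> real) set \<Rightarrow> bool" where
  "D4_symmetric K E F \<longleftrightarrow>
     (\<forall>\<Gamma>\<in>D4. \<forall>f\<in>F. rst K (f \<circ> \<Gamma>) \<in> F \<and> E (rst K (f \<circ> \<Gamma>)) = E f)"

definition jointly_continuous :: "pt set \<Rightarrow> ((pt \<Rightarrow> real) \<Rightarrow> real) \<Rightarrow> (pt \<Rightarrow> real) set \<Rightarrow> bool" where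
  "jointly_continuous K E F \<longleftrightarrow>
     continuous_on (K \<times> K) (\<lambda>p. res_metric E F (fst p) (snd p))"

definition sigma_r :: "nat \<Rightarrow> real \<Rightarrow> real" where
  "sigma_r k r = - ln r / (2 * ln (real k)) + 1 / 2"

definition besov01_sq :: "nat \<Rightarrow> real \<Rightarrow> (real \<Rightarrow> real) \<Rightarrow> ennreal" where
  "besov01_sq k \<sigma> u =
     (\<Sum>m. ennreal (real k powr ((2 * \<sigma> - 1) * real m) *
        (\<Sum>l\<in>{0..<k^m}. (u (real l / real k ^ m) - u (real (l + 1) / real k ^ m))^2)))"

definition besov_seg_sq :: "nat \<Rightarrow> real \<Rightarrow> pt \<Rightarrow> pt \<Rightarrow> (pt \<Rightarrow> real) \<Rightarrow> ennreal" where
  "besov_seg_sq k \<sigma> x y u =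
     ennreal ((dist x y powr (1/2 - \<sigma>))^2) *
       besov01_sq k \<sigma> (u \<circ> (\<lambda>t. (1 - t) *\<^sub>R x + t *\<^sub>R y))"

definition besov_bdry_sq :: "nat \<Rightarrow> nat \<Rightarrow> (nat \<Rightarrow> pt) \<Rightarrow> real \<Rightarrow> nat \<Rightarrow> (pt \<Rightarrow> real) \<Rightarrow> ennreal" where
  "besov_bdry_sq k N c \<sigma> n u =
     (\<Sum>w\<in>words N n. \<Sum>i\<in>{1..4}.
        besov_seg_sq k \<sigma> (Psiw k c w (side_start i)) (Psiw k c w (side_end i)) u)"

definition besov_space :: "nat \<Rightarrow> nat \<Rightarrow> (nat \<Rightarrow> pt) \<Rightarrow> real \<Rightarrow> nat \<Rightarrow> (pt \<Rightarrow> real) set" where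
  "besov_space k N c \<sigma> n =
     {u \<in> funs_on (bdryn k N c n). continuous_on (bdryn k N c n) u \<and> besov_bdry_sq k N c \<sigma> n u < \<infinity>}"

definition harmonic_n :: "((pt \<Rightarrow> real) \<Rightarrow> real) \<Rightarrow> (pt \<Rightarrow> real) set \<Rightarrow> pt set \<Rightarrow> (pt \<Rightarrow> real) set" where
  "harmonic_n E F D = {h \<in> F. E h = Inf {E f | f. f \<in> F \<and> (\<forall>x\<in>D. f x = h x)}}"

end

theory Submission
  imports Defs
begin

text \<open>
  Both assertions are local to cells: a function on the boundary of the level-n cells extends to
  \<open>F\<close> if its pullback by each cell map does, and energies and Besov norms scale by the same
  factor. So everything reduces to \<open>n = 0\<close> with constants depending only on \<open>k\<close>.

  Extension. A function that is 0 on the left and 1 on the right side with energy about 1 generates,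
  through reflections, lattice operations and gluing, a cutoff that is 1 on the bottom row of cells
  and 0 on the top side. With it, boundary data on the bottom side are extended scale by scale; the
  correction at scale m is constant on every cell of the bottom row two levels below, so only
  neighbouring scales interact and the energies add up.

  Bounds on \<open>r\<close>. Resistances of cells in a row add up, which gives \<open>r * k \<ge> 2\<close>. Then the
  extension applies to the coordinate function on the boundary, whose extension can be glued on all
  scales, and comparing with \<open>R(L\<^sub>2, L\<^sub>4) = 1\<close> gives \<open>r \<le> N / k\<^sup>2 < 1\<close>.

  Trace. Since \<open>r\<close> is bounded away from 1, oscillations over a side are controlled by the
  resistance \<open>\<rho>\<close> of two adjacent corners. Comparing with a crossing of a row of small cells gives
  \<open>sqrt \<rho> \<le> sqrt \<rho> / 2 + C(k)\<close>, hence a bound on \<open>\<rho>\<close>. The Besov norm is then bounded by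
  induction on the number of scales.
\<close>

section \<open>Geometry of the cells\<close>

text \<open>The difficulty is uniformity: carpet, form and \<open>r\<close> are arbitrary, but the
  constants may involve \<open>k\<close> alone. All quantitative input comes from
  \<open>R(L\<^sub>2, L\<^sub>4) = 1\<close>, as the lower bound 1 for the energy of every crossing
  and as one crossing of energy at most 2. The order of the steps is forced: the extension needs
  only 1 / r <= k / 2, the bound on \<open>r\<close> needs the extension, and the trace estimate
  needs the gap r <= 1 - 1 / k^2, which exists since N <= k^2 - 1. Interior cells need not lie on a
  grid and may meet along parts of sides. Only the cells along the sides of the square have known
  positions, so explicit constructions stay in these rows; elsewhere little more is used than that
  cells meet in points whose preimages lie on \<open>bdry0\<close>. Pieces of an extension must
  agree on lateral sides, where the data prescribe nothing. Keeping all lateral traces multiples of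
  one profile \<open>cap\<close> reduces this to matching numbers. In the trace estimate an
  increment over the bottom side is paid for along the detour through the other three sides, with
  energy off the bottom row; the energy on that row is kept for finer scales.\<close>

lemma usq_iff: "(x, y) \<in> usq \<longleftrightarrow> 0 \<le> x \<and> x \<le> 1 \<and> 0 \<le> y \<and> y \<le> 1"
  by (auto simp: usq_def)

lemma Psi_pair: "Psi k c i (x, y) = (x / real k + fst (c i), y / real k + snd (c i))"
  by (simp add: Psi_def prod_eq_iff)

lemma horizontal_segment:
  "closed_segment (0, b) (1, b) = {(x::real, y). 0 \<le> x \<and> x \<le> 1 \<and> y = (b::real)}"
  by (auto simp: closed_segment_def algebra_simps)

lemma vertical_segment:
  "closed_segment (a, 0) (a, 1) = {(x, y::real). 0 \<le> y \<and> y \<le> 1 \<and> x = (a::real)}"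
  by (auto simp: closed_segment_def algebra_simps)

lemma side_1: "side 1 = {(x, y). 0 \<le> x \<and> x \<le> 1 \<and> y = 0}"
  by (simp add: side_def qq1_def qq2_def horizontal_segment)

lemma side_2: "side 2 = {(x, y). 0 \<le> y \<and> y \<le> 1 \<and> x = 1}"
  by (simp add: side_def qq3_def qq2_def vertical_segment)

lemma side_3: "side 3 = {(x, y). 0 \<le> x \<and> x \<le> 1 \<and> y = 1}"
  using horizontal_segment[of 1] by (simp add: side_def qq3_def qq4_def closed_segment_commute)

lemma side_4: "side 4 = {(x, y). 0 \<le> y \<and> y \<le> 1 \<and> x = 0}"
  using vertical_segment[of 0] by (simp add: side_def qq1_def qq4_def closed_segment_commute)

lemma bdry0_iff: "(x, y) \<in> bdry0 \<longleftrightarrow> (x, y) \<in> usq \<and> (x = 0 \<or> x = 1 \<or> y = 0 \<or> y = 1)"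
proof -
  have "{1..4::nat} = {1, 2, 3, 4}" by auto
  then have eq: "bdry0 = side 1 \<union> side 2 \<union> side 3 \<union> side 4"
    by (simp only: bdry0_def) auto
  show ?thesis unfolding eq side_1 side_2 side_3 side_4 usq_iff by (simp; safe; simp)
qed

lemma bdry0_subset_usq: "bdry0 \<subseteq> usq"
  using bdry0_iff by auto

lemma mem_cbox_pair:
  fixes a b :: "real \<times> real"
  shows "(x, y) \<in> cbox a b \<longleftrightarrow> fst a \<le> x \<and> x \<le> fst b \<and> snd a \<le> y \<and> y \<le> snd b"
  by (cases a; cases b) (auto simp: mem_box Basis_prod_def)

text \<open>Segments in the plane have empty interior. This turns the intersection clause of
  \<open>USC\<close> into a statement about the positions of the cells.\<close>

lemma rectangle_not_segment:
  fixes a b :: "real \<times> real"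
  assumes "fst a < fst b" "snd a < snd b"
  shows "cbox a b \<noteq> closed_segment p q"
proof
  assume eq: "cbox a b = closed_segment p q"
  have "interior (closed_segment p q) = {}"
    by (rule interior_closed_segment_ge2) simp
  then have "box a b = {}" using eq by (metis interior_cbox)
  moreover have "((fst a + fst b) / 2, (snd a + snd b) / 2) \<in> box a b"
    using assms by (cases a; cases b) (auto simp: box_def Basis_prod_def)
  ultimately show False by blast
qed

text \<open>Intervals of length 1/k that cover without overlapping leave no freedom: each must start
  where the previous one ends, otherwise there is a gap right after that end.\<close>

lemma unit_interval_tiling:
  fixes A :: "real set"
  assumes fin: "finite A" and nonneg: "\<And>a. a \<in> A \<Longrightarrow> 0 \<le> a"
    and cover: "\<And>x. 0 \<le> x \<Longrightarrow> x \<le> 1 \<Longrightarrow> \<exists>a\<in>A. a \<le> x \<and> x \<le> a + 1 / real k"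
    and sep: "\<And>a b. a \<in> A \<Longrightarrow> b \<in> A \<Longrightarrow> a \<noteq> b \<Longrightarrow> 1 / real k \<le> \<bar>a - b\<bar>"
    and "j < k"
  shows "real j / real k \<in> A"
  using \<open>j < k\<close>
proof (induction j)
  case 0
  then show ?case using cover[of 0] nonneg by fastforce
next
  case (Suc j)
  then have j: "real j / real k \<in> A" and k: "real (Suc j) < real k" by auto
  have kpos: "real k > 0" using k by linarith
  let ?a = "real j / real k" and ?b = "real (Suc j) / real k"
  have ab: "?b = ?a + 1 / real k" by (simp add: add_divide_distrib)
  have b1: "?b < 1" using k kpos by simp
  show ?case
  proof (rule ccontr)
    assume no: "?b \<notin> A"
    \<comment> \<open>\<open>M\<close> is the next left endpoint after j/k, or 1 if there is none;
      the midpoint of (j + 1)/k and \<open>M\<close> is then uncovered.\<close>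
    define M where "M = Min (insert 1 {x \<in> A. ?a < x})"
    have gt: "?b < x" if "x \<in> A" "?a < x" for x
      using sep[OF that(1) j] that no ab by (cases "x = ?b") auto
    have fin': "finite (insert 1 {x \<in> A. ?a < x})" using fin by simp
    have M: "?b < M" unfolding M_def using fin' gt b1 by (subst Min_gr_iff) auto
    have M1: "M \<le> 1" unfolding M_def using fin' by (intro Min_le) auto
    define x where "x = (?b + M) / 2"
    have x: "?b < x" "x < M" using M by (simp_all only: x_def, argo+)
    have "0 \<le> ?b" by simp
    then obtain y where y: "y \<in> A" "y \<le> x" "x \<le> y + 1 / real k"
      using cover[of x] x M1 by (meson less_imp_le order_trans)
    have "\<not> ?a < y"
    proof
      assume "?a < y"
      then have "M \<le> y" unfolding M_def using fin' y by (intro Min_le) auto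
      then show False using x y by linarith
    qed
    then show False using y x ab by linarith
  qed
qed

locale carpet =
  fixes k N :: nat and c :: "nat \<Rightarrow> pt" and K :: "pt set"
  assumes usc: "USC k N c" and attractor: "is_attractor k N c K"
begin

abbreviation \<Psi> :: "nat \<Rightarrow> pt \<Rightarrow> pt" where "\<Psi> \<equiv> Psi k c"

lemma uscD:
  "\<forall>i\<in>{1..N}. \<forall>j\<in>{1..N}. i \<noteq> j \<longrightarrow>
    \<Psi> i ` usq \<inter> \<Psi> j ` usq = {} \<or> (\<exists>a b. \<Psi> i ` usq \<inter> \<Psi> j ` usq = closed_segment a b)"
  "\<forall>\<Gamma>\<in>D4. \<Gamma> ` (\<Union>i\<in>{1..N}. \<Psi> i ` usq) = (\<Union>i\<in>{1..N}. \<Psi> i ` usq)"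
  "closed_segment qq1 qq2 \<subseteq> (\<Union>i\<in>{1..N}. \<Psi> i ` usq)"
  "(\<Union>i\<in>{1..N}. \<Psi> i ` usq) \<subseteq> usq"
  using usc unfolding USC_def Let_def by - (elim conjE, assumption)+

lemma k3: "k \<ge> 3" and kpos [simp]: "real k > 0" and k0 [simp]: "k > 0" and k_neq0 [simp]: "k \<noteq> 0"
  using usc by (auto simp: USC_def)

lemma N_less: "real N \<le> (real k)\<^sup>2 - 1"
proof -
  have "N \<le> k\<^sup>2 - 1" using usc by (simp add: USC_def)
  moreover have "0 < k\<^sup>2" using k3 by simp
  ultimately have "N + 1 \<le> k\<^sup>2" by linarith
  then have "real (N + 1) \<le> real (k\<^sup>2)" by linarith
  then show ?thesis by simp
qed

lemma inj_Psi: "\<Psi> i p = \<Psi> i q \<longleftrightarrow> p = q"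
  using k3 by (auto simp: Psi_def)

lemma cells_subset: "i \<in> {1..N} \<Longrightarrow> p \<in> usq \<Longrightarrow> \<Psi> i p \<in> usq"
  using uscD(4) by blast

lemma c_bounds:
  assumes "i \<in> {1..N}"
  shows "0 \<le> fst (c i)" "fst (c i) + 1 / k \<le> 1" "0 \<le> snd (c i)" "snd (c i) + 1 / k \<le> 1"
proof -
  have "\<Psi> i (0, 0) \<in> usq" "\<Psi> i (1, 1) \<in> usq"
    using cells_subset[OF assms] by (auto simp: usq_iff)
  then show "0 \<le> fst (c i)" "fst (c i) + 1 / k \<le> 1" "0 \<le> snd (c i)" "snd (c i) + 1 / k \<le> 1"
    by (cases "c i"; auto simp: Psi_pair usq_iff)+
qed

lemma cell_iff:
  "(x, y) \<in> \<Psi> i ` usq \<longleftrightarrow>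
    fst (c i) \<le> x \<and> x \<le> fst (c i) + 1 / k \<and> snd (c i) \<le> y \<and> y \<le> snd (c i) + 1 / k"
    (is "_ \<longleftrightarrow> ?R")
proof
  show "(x, y) \<in> \<Psi> i ` usq \<Longrightarrow> ?R"
    by (auto simp: usq_def Psi_pair divide_right_mono)
  assume ?R
  then have "((x - fst (c i)) * k, (y - snd (c i)) * k) \<in> usq"
    by (simp add: usq_iff field_simps)
  moreover have "(x, y) = \<Psi> i ((x - fst (c i)) * k, (y - snd (c i)) * k)"
    by (simp add: Psi_pair)
  ultimately show "(x, y) \<in> \<Psi> i ` usq" by blast
qed

text \<open>If both coordinates of the offsets differed by less than 1/k, the two cells would share
  a nondegenerate rectangle, which is not a segment.\<close>

lemma cells_separated:
  assumes "i \<in> {1..N}" "j \<in> {1..N}" "i \<noteq> j" "\<bar>fst (c i) - fst (c j)\<bar> < 1 / k"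
  shows "1 / k \<le> \<bar>snd (c i) - snd (c j)\<bar>"
proof (rule ccontr)
  assume a: "\<not> 1 / k \<le> \<bar>snd (c i) - snd (c j)\<bar>"
  define p where "p = (max (fst (c i)) (fst (c j)), max (snd (c i)) (snd (c j)))"
  define q where "q = (min (fst (c i)) (fst (c j)) + 1 / k, min (snd (c i)) (snd (c j)) + 1 / k)"
  have lt: "fst p < fst q" "snd p < snd q" using a assms(4) by (auto simp: p_def q_def)
  have eq: "\<Psi> i ` usq \<inter> \<Psi> j ` usq = cbox p q"
    by (rule set_eqI) (simp add: cell_iff mem_cbox_pair p_def q_def split_paired_all min_add_distrib_left conj_ac)
  have "\<Psi> i ` usq \<inter> \<Psi> j ` usq = {} \<or> (\<exists>a b. \<Psi> i ` usq \<inter> \<Psi> j ` usq = closed_segment a b)"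
    using uscD(1) assms(1-3) by blast
  moreover have "p \<in> cbox p q" using lt mem_cbox_pair[of "fst p" "snd p" p q] by simp
  ultimately show False using rectangle_not_segment[OF lt] unfolding eq by blast
qed

text \<open>Without a grid, the two preimages of a contact point need not be related by a
  reflection. Separation by a full side length in one coordinate still puts them on opposite sides
  in that coordinate.\<close>

lemma cells_contact:
  assumes "i \<in> {1..N}" "j \<in> {1..N}" "i \<noteq> j" "(x, y) \<in> usq" "(x', y') \<in> usq"
    "\<Psi> i (x, y) = \<Psi> j (x', y')"
  shows "x = 1 \<and> x' = 0 \<or> x = 0 \<and> x' = 1 \<or> y = 1 \<and> y' = 0 \<or> y = 0 \<and> y' = 1"
proof -
  have e: "(x - x') / k = fst (c j) - fst (c i)" "(y - y') / k = snd (c j) - snd (c i)"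
    using assms(6) by (auto simp: Psi_pair diff_divide_distrib)
  have "1 / k \<le> \<bar>fst (c i) - fst (c j)\<bar> \<or> 1 / k \<le> \<bar>snd (c i) - snd (c j)\<bar>"
    using cells_separated[OF assms(1-3)] by linarith
  then have "1 / k \<le> \<bar>(x - x') / k\<bar> \<or> 1 / k \<le> \<bar>(y - y') / k\<bar>"
    unfolding e by (simp add: abs_minus_commute)
  then have "1 \<le> \<bar>x - x'\<bar> \<or> 1 \<le> \<bar>y - y'\<bar>"
    by (simp add: divide_le_cancel)
  then show ?thesis using assms(4,5) by (auto simp: usq_iff)
qed

text \<open>Hence functions prescribed on cells need only be compared on \<open>bdry0\<close> before
  they are glued.\<close>

corollary cells_contact_bdry0:
  assumes "i \<in> {1..N}" "j \<in> {1..N}" "i \<noteq> j" "p \<in> usq" "q \<in> usq" "\<Psi> i p = \<Psi> j q"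
  shows "p \<in> bdry0" "q \<in> bdry0"
proof -
  obtain x y x' y' where pq: "p = (x, y)" "q = (x', y')" by (cases p; cases q) blast
  from cells_contact[OF assms(1-3), of x y x' y'] assms(4-6)
  show "p \<in> bdry0" "q \<in> bdry0" unfolding pq bdry0_iff by blast+
qed

lemma union_symmetric:
  assumes "\<Gamma> \<in> D4" "p \<in> (\<Union>i\<in>{1..N}. \<Psi> i ` usq)"
  shows "\<Gamma> p \<in> (\<Union>i\<in>{1..N}. \<Psi> i ` usq)"
  using uscD(2)[rule_format, OF assms(1)] assms(2) by blast

lemma side_1_covered: "0 \<le> x \<Longrightarrow> x \<le> 1 \<Longrightarrow> (x, 0) \<in> (\<Union>i\<in>{1..N}. \<Psi> i ` usq)"
proof -
  assume "0 \<le> x" "x \<le> 1"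
  then have "(x, 0) \<in> closed_segment qq1 qq2"
    using horizontal_segment[of 0] by (simp add: qq1_def qq2_def)
  then show ?thesis using uscD(3) by blast
qed

lemma bdry0_covered: "p \<in> bdry0 \<Longrightarrow> p \<in> (\<Union>i\<in>{1..N}. \<Psi> i ` usq)"
proof -
  assume p: "p \<in> bdry0"
  obtain x y where xy: "p = (x, y)" by (cases p)
  have D: "(\<lambda>(x, y). (x, 1 - y)) \<in> D4" "(\<lambda>(x, y). (y, x)) \<in> D4" "(\<lambda>(x, y). (1 - y, x)) \<in> D4"
    unfolding D4_def by simp_all
  note S = union_symmetric[OF D(1) side_1_covered[of x]] union_symmetric[OF D(2) side_1_covered[of y]]
    union_symmetric[OF D(3) side_1_covered[of y]] side_1_covered[of x]
  from p consider "y = 0" | "y = 1" | "x = 0" | "x = 1" by (auto simp: xy bdry0_iff)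
  then show ?thesis using S p by cases (auto simp: xy bdry0_iff usq_iff simp del: UN_iff)
qed

text \<open>Cells touching a side of the square are pushed against it by the inclusion in
  \<open>usq\<close>, and along that side they tile an interval, so this frame lies on the grid even
  if the interior cells do not.\<close>

lemma bottom_cells: "j < k \<Longrightarrow> \<exists>i\<in>{1..N}. c i = (j / k, 0)"
  and top_cells: "j < k \<Longrightarrow> \<exists>i\<in>{1..N}. c i = (j / k, 1 - 1 / k)"
  and left_cells: "j < k \<Longrightarrow> \<exists>i\<in>{1..N}. c i = (0, j / k)"
  and right_cells: "j < k \<Longrightarrow> \<exists>i\<in>{1..N}. c i = (1 - 1 / k, j / k)"
proof -
  \<comment> \<open>\<open>f\<close> is the coordinate along the side and \<open>g\<close> the
    transversal one, so that horizontal and vertical sides share one argument.\<close>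
  have line: "\<exists>i\<in>{1..N}. f (c i) = j / k \<and> g (c i) = b"
    if j: "j < k" and nonneg: "\<And>i. i \<in> {1..N} \<Longrightarrow> 0 \<le> f (c i)"
      and sep: "\<And>i i'. i \<in> {1..N} \<Longrightarrow> i' \<in> {1..N} \<Longrightarrow> i \<noteq> i' \<Longrightarrow> g (c i) = g (c i') \<Longrightarrow> 1 / k \<le> \<bar>f (c i) - f (c i')\<bar>"
      and cov: "\<And>x. 0 \<le> x \<Longrightarrow> x \<le> 1 \<Longrightarrow> \<exists>i\<in>{1..N}. g (c i) = b \<and> f (c i) \<le> x \<and> x \<le> f (c i) + 1 / k"
    for f g :: "pt \<Rightarrow> real" and j b
  proof -
    have "real j / k \<in> {f (c i) | i. i \<in> {1..N} \<and> g (c i) = b}"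
    proof (rule unit_interval_tiling[OF _ _ _ _ j])
      fix x :: real assume "0 \<le> x" "x \<le> 1"
      from cov[OF this] show "\<exists>a\<in>{f (c i) | i. i \<in> {1..N} \<and> g (c i) = b}. a \<le> x \<and> x \<le> a + 1 / k" by blast
    next
      fix a a' assume "a \<in> {f (c i) | i. i \<in> {1..N} \<and> g (c i) = b}"
        "a' \<in> {f (c i) | i. i \<in> {1..N} \<and> g (c i) = b}" "a \<noteq> a'"
      then show "1 / k \<le> \<bar>a - a'\<bar>" using sep by fastforce
    qed (use nonneg in \<open>auto simp: Setcompr_eq_image\<close>)
    then show ?thesis by (smt (verit, best) mem_Collect_eq)
  qed
  have hor: "\<exists>i\<in>{1..N}. c i = (j / k, b)" if "j < k" and
    "\<And>x. 0 \<le> x \<Longrightarrow> x \<le> 1 \<Longrightarrow> \<exists>i\<in>{1..N}. snd (c i) = b \<and> fst (c i) \<le> x \<and> x \<le> fst (c i) + 1 / k" for j b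
    using line[of j fst snd b] that c_bounds cells_separated by (fastforce simp: prod_eq_iff)
  have ver: "\<exists>i\<in>{1..N}. c i = (b, j / k)" if "j < k" and
    "\<And>x. 0 \<le> x \<Longrightarrow> x \<le> 1 \<Longrightarrow> \<exists>i\<in>{1..N}. fst (c i) = b \<and> snd (c i) \<le> x \<and> x \<le> snd (c i) + 1 / k" for j b
    using line[of j snd fst b] that c_bounds cells_separated by (fastforce simp: prod_eq_iff)
  have cell: "\<exists>i\<in>{1..N}. 0 \<le> fst (c i) \<and> fst (c i) + 1 / k \<le> 1 \<and> 0 \<le> snd (c i) \<and> snd (c i) + 1 / k \<le> 1 \<and>
    fst (c i) \<le> x \<and> x \<le> fst (c i) + 1 / k \<and> snd (c i) \<le> y \<and> y \<le> snd (c i) + 1 / k"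
    if xy: "(x, y) \<in> bdry0" for x y
  proof -
    obtain i q where i: "i \<in> {1..N}" "q \<in> usq" "(x, y) = \<Psi> i q" using bdry0_covered[OF xy] by auto
    then have "(x, y) \<in> \<Psi> i ` usq" by simp
    then show ?thesis using c_bounds[OF i(1)] i(1) unfolding cell_iff by blast
  qed
  show "j < k \<Longrightarrow> \<exists>i\<in>{1..N}. c i = (j / k, 0)"
  proof (rule hor)
    fix x :: real assume "0 \<le> x" "x \<le> 1"
    then show "\<exists>i\<in>{1..N}. snd (c i) = 0 \<and> fst (c i) \<le> x \<and> x \<le> fst (c i) + 1 / k"
      using cell[of x 0] by (simp add: bdry0_iff usq_iff) (smt (verit))
  qed
  show "j < k \<Longrightarrow> \<exists>i\<in>{1..N}. c i = (j / k, 1 - 1 / k)"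
  proof (rule hor)
    fix x :: real assume "0 \<le> x" "x \<le> 1"
    then show "\<exists>i\<in>{1..N}. snd (c i) = 1 - 1 / k \<and> fst (c i) \<le> x \<and> x \<le> fst (c i) + 1 / k"
      using cell[of x 1] by (simp add: bdry0_iff usq_iff) (smt (verit))
  qed
  show "j < k \<Longrightarrow> \<exists>i\<in>{1..N}. c i = (0, j / k)"
  proof (rule ver)
    fix x :: real assume "0 \<le> x" "x \<le> 1"
    then show "\<exists>i\<in>{1..N}. fst (c i) = 0 \<and> snd (c i) \<le> x \<and> x \<le> snd (c i) + 1 / k"
      using cell[of 0 x] by (simp add: bdry0_iff usq_iff) (smt (verit))
  qed
  show "j < k \<Longrightarrow> \<exists>i\<in>{1..N}. c i = (1 - 1 / k, j / k)"
  proof (rule ver)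
    fix x :: real assume "0 \<le> x" "x \<le> 1"
    then show "\<exists>i\<in>{1..N}. fst (c i) = 1 - 1 / k \<and> snd (c i) \<le> x \<and> x \<le> snd (c i) + 1 / k"
      using cell[of 1 x] by (simp add: bdry0_iff usq_iff) (smt (verit))
  qed
qed

section \<open>The attractor and the boundary of the square\<close>

lemma compact_K: "compact K" and K_nonempty: "K \<noteq> {}" and K_eq: "K = (\<Union>i\<in>{1..N}. \<Psi> i ` K)"
  using attractor by (auto simp: is_attractor_def)

lemma Psi_in_K: "i \<in> {1..N} \<Longrightarrow> p \<in> K \<Longrightarrow> \<Psi> i p \<in> K"
  using K_eq by blast

lemma K_cellE:
  assumes "p \<in> K" obtains i q where "i \<in> {1..N}" "q \<in> K" "p = \<Psi> i q"
  using K_eq assms by blast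

text \<open>Maximum principle: at a point where \<open>g\<close> attains its maximum M over
  \<open>K\<close>, self-similarity gives M <= M / k + 1 - 1 / k, so M <= 1. Applied to the two
  coordinates and their reflections it confines \<open>K\<close> to the square.\<close>

lemma affine_bound:
  assumes "\<And>i q. i \<in> {1..N} \<Longrightarrow> g (\<Psi> i q) = g q / k + b i"
    and "\<And>i. i \<in> {1..N} \<Longrightarrow> b i + 1 / k \<le> (1::real)" and cont: "continuous_on K g" and "p \<in> K"
  shows "g p \<le> 1"
proof -
  obtain m where m: "m \<in> K" "\<And>q. q \<in> K \<Longrightarrow> g q \<le> g m"
    using continuous_attains_sup[OF compact_K K_nonempty cont] by auto
  obtain i q where iq: "i \<in> {1..N}" "q \<in> K" "m = \<Psi> i q" using K_cellE[OF m(1)] .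
  have "g m \<le> g m / k + (1 - 1 / k)"
    using assms(1)[OF iq(1), of q] assms(2)[OF iq(1)] m(2)[OF iq(2)] divide_right_mono[of "g q" "g m" "real k"] iq(3)
    by auto
  then have "(g m - 1) * (real k - 1) \<le> 0" by (simp add: field_simps)
  moreover have "real k - 1 > 0" using k3 by simp
  ultimately have "g m \<le> 1" by (smt (verit) mult_pos_pos)
  then show ?thesis using m(2)[OF assms(4)] by linarith
qed

lemma K_subset_usq: "K \<subseteq> usq"
proof
  fix p assume p: "p \<in> K"
  have "fst p \<le> 1"
    by (rule affine_bound[OF _ _ _ p, of fst "\<lambda>i. fst (c i)"]) (use c_bounds in \<open>auto simp: Psi_def intro!: continuous_intros\<close>)
  moreover have "snd p \<le> 1"
    by (rule affine_bound[OF _ _ _ p, of snd "\<lambda>i. snd (c i)"]) (use c_bounds in \<open>auto simp: Psi_def intro!: continuous_intros\<close>)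
  moreover have "1 - fst p \<le> 1"
    by (rule affine_bound[OF _ _ _ p, of "\<lambda>p. 1 - fst p" "\<lambda>i. 1 - fst (c i) - 1 / k"])
      (use c_bounds in \<open>auto simp: Psi_def field_simps intro!: continuous_intros\<close>)
  moreover have "1 - snd p \<le> 1"
    by (rule affine_bound[OF _ _ _ p, of "\<lambda>p. 1 - snd p" "\<lambda>i. 1 - snd (c i) - 1 / k"])
      (use c_bounds in \<open>auto simp: Psi_def field_simps intro!: continuous_intros\<close>)
  ultimately show "p \<in> usq" using usq_iff[of "fst p" "snd p"] by simp
qed

text \<open>A cell inside the square can meet a side of the square only in a side of its own. So
  \<open>bdry0\<close> satisfies one half of the fixed point equation of \<open>K\<close>, which
  suffices to put it inside \<open>K\<close>.\<close>

lemma bdry0_self_cover: "p \<in> bdry0 \<Longrightarrow> \<exists>i\<in>{1..N}. \<exists>q\<in>bdry0. p = \<Psi> i q"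
proof -
  assume p: "p \<in> bdry0"
  then obtain i q where iq: "i \<in> {1..N}" "q \<in> usq" "p = \<Psi> i q" using bdry0_covered by blast
  obtain x y where q: "q = (x, y)" by (cases q)
  have "x / k + fst (c i) \<in> {0, 1} \<or> y / k + snd (c i) \<in> {0, 1}"
    using p unfolding iq(3) q Psi_pair bdry0_iff by auto
  moreover have "0 \<le> x" "x \<le> 1" "0 \<le> y" "y \<le> 1" using iq(2) q usq_iff by auto
  moreover from this have "0 \<le> x / k" "x / k \<le> 1 / k" "0 \<le> y / k" "y / k \<le> 1 / k"
    by (auto simp: divide_right_mono)
  ultimately have "x / k = 0 \<or> x / k = 1 / k \<or> y / k = 0 \<or> y / k = 1 / k"
    using c_bounds[OF iq(1)] by (smt (verit) insert_iff empty_iff)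
  then have "q \<in> bdry0" using iq(2) q by (auto simp: bdry0_iff)
  then show ?thesis using iq by blast
qed

lemma bdry0_subset_K: "bdry0 \<subseteq> K"
proof
  fix p assume p: "p \<in> bdry0"
  obtain z where z: "z \<in> K" using K_nonempty by blast
  \<comment> \<open>Following addresses inside \<open>bdry0\<close> contracts the distance to
    \<open>K\<close> by 1/k at each level; 2 bounds the diameter of the square.\<close>
  have *: "\<forall>p\<in>bdry0. \<exists>q\<in>K. dist p q \<le> 2 * (1 / k) ^ n" for n
  proof (induction n)
    case 0
    have "dist p z \<le> 2" if "p \<in> bdry0" for p
    proof -
      have "p \<in> usq" "z \<in> usq" using that z bdry0_subset_usq K_subset_usq by auto
      then have "\<bar>fst p - fst z\<bar> \<le> 1" "\<bar>snd p - snd z\<bar> \<le> 1"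
        by (cases p; cases z; auto simp: usq_iff)+
      then show ?thesis
        using sqrt_sum_squares_le_sum_abs[of "fst p - fst z" "snd p - snd z"]
        by (simp add: dist_prod_def dist_real_def)
    qed
    then show ?case using z by auto
  next
    case (Suc n)
    show ?case
    proof
      fix p assume "p \<in> bdry0"
      then obtain i q where iq: "i \<in> {1..N}" "q \<in> bdry0" "p = \<Psi> i q" using bdry0_self_cover by blast
      then obtain q' where q': "q' \<in> K" "dist q q' \<le> 2 * (1 / k) ^ n" using Suc by blast
      have "dist p (\<Psi> i q') = dist q q' / k"
        unfolding iq(3) Psi_def by (simp add: dist_norm flip: scaleR_diff_right)
      also have "\<dots> \<le> 2 * (1 / k) ^ n / k" using q' by (simp add: divide_right_mono)
      finally show "\<exists>q\<in>K. dist p q \<le> 2 * (1 / k) ^ Suc n" using Psi_in_K[OF iq(1) q'(1)] by auto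
    qed
  qed
  have "p \<in> closure K"
    unfolding closure_approachable
  proof (intro allI impI)
    fix e :: real assume "e > 0"
    have "(\<lambda>n. 2 * (1 / k) ^ n) \<longlonglongrightarrow> 2 * 0"
      by (intro tendsto_intros LIMSEQ_realpow_zero) (use k3 in auto)
    then have "eventually (\<lambda>n. 2 * (1 / k) ^ n < e) sequentially"
      using \<open>e > 0\<close> by (metis order_tendstoD(2) mult_zero_right)
    then obtain n where "2 * (1 / k) ^ n < e" by (auto simp: eventually_sequentially)
    moreover obtain q where "q \<in> K" "dist p q \<le> 2 * (1 / k) ^ n" using *[of n] p by blast
    ultimately show "\<exists>y\<in>K. dist y p < e" by (metis dist_commute le_less_trans)
  qed
  then show "p \<in> K" using compact_K by (simp add: compact_imp_closed)
qed

lemma edge_in_K [simp]: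
  "0 \<le> t \<Longrightarrow> t \<le> 1 \<Longrightarrow> (t, 0) \<in> K" "0 \<le> t \<Longrightarrow> t \<le> 1 \<Longrightarrow> (t, 1) \<in> K"
  "0 \<le> t \<Longrightarrow> t \<le> 1 \<Longrightarrow> (0, t) \<in> K" "0 \<le> t \<Longrightarrow> t \<le> 1 \<Longrightarrow> (1, t) \<in> K"
  using bdry0_subset_K by (auto simp: bdry0_iff usq_iff intro!: subsetD[OF bdry0_subset_K])

end

section \<open>Resistance forms\<close>

locale resistance =
  fixes X :: "'a set" and E :: "('a \<Rightarrow> real) \<Rightarrow> real" and F :: "('a \<Rightarrow> real) set"
  assumes resistance_form: "resistance_form X E F"
begin

lemma F_outside: "f \<in> F \<Longrightarrow> x \<notin> X \<Longrightarrow> f x = 0"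
  and F_const: "rst X (\<lambda>_. a) \<in> F"
  and F_add: "f \<in> F \<Longrightarrow> g \<in> F \<Longrightarrow> (\<lambda>x. f x + g x) \<in> F"
  and F_scale: "f \<in> F \<Longrightarrow> (\<lambda>x. a * f x) \<in> F"
  and E_nonneg: "f \<in> F \<Longrightarrow> 0 \<le> E f"
  and E_zero_iff: "f \<in> F \<Longrightarrow> E f = 0 \<longleftrightarrow> (\<exists>a. \<forall>x\<in>X. f x = a)"
  and F_interpolate: "finite V \<Longrightarrow> V \<subseteq> X \<Longrightarrow> \<exists>u\<in>F. \<forall>x\<in>V. u x = v x"
  using resistance_form by (auto simp: resistance_form_def funs_on_def)

lemma complete:
  assumes "\<And>n. u n \<in> F"
    and "\<And>e. e > 0 \<Longrightarrow> \<exists>M. \<forall>m\<ge>M. \<forall>n\<ge>M. E (\<lambda>x. u m x - u n x) < e"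
  shows "\<exists>v\<in>F. (\<lambda>n. E (\<lambda>x. u n x - v x)) \<longlonglongrightarrow> 0"
  using resistance_form assms by (auto simp: resistance_form_def)

lemma clamp_raw:
  assumes "f \<in> F"
  shows "rst X (\<lambda>x. min 1 (max 0 (f x))) \<in> F" "E (rst X (\<lambda>x. min 1 (max 0 (f x)))) \<le> E f"
  using resistance_form assms by (auto simp: resistance_form_def)

lemma bdd_above_ratio:
  "x \<in> X \<Longrightarrow> y \<in> X \<Longrightarrow> bdd_above {(u x - u y)\<^sup>2 / E u | u. u \<in> F \<and> E u > 0}"
  using resistance_form by (auto simp: resistance_form_def)

text \<open>The bilinear form is hidden behind an existential in RF1; later arguments only compare
  values of this polynomial in s and t, with b as the mixed energy.\<close>

lemma quadratic:
  assumes "f \<in> F" "g \<in> F"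
  obtains b where "\<And>s t. E (\<lambda>x. s * f x + t * g x) = s\<^sup>2 * E f + 2 * s * t * b + t\<^sup>2 * E g"
proof -
  obtain B where B: "\<forall>u\<in>F. E u = B u u" "\<forall>u\<in>F. \<forall>v\<in>F. B u v = B v u"
    "\<forall>u\<in>F. \<forall>v\<in>F. \<forall>w\<in>F. \<forall>a b. B (\<lambda>x. a * u x + b * v x) w = a * B u w + b * B v w"
    using resistance_form unfolding resistance_form_def by (elim conjE exE) blast
  have "E (\<lambda>x. s * f x + t * g x) = s\<^sup>2 * E f + 2 * s * t * B f g + t\<^sup>2 * E g" for s t
  proof -
    let ?h = "\<lambda>x. s * f x + t * g x"
    have h: "?h \<in> F" using F_add F_scale assms by blast
    have "E ?h = s * B f ?h + t * B g ?h"
      using B(1) B(3)[rule_format, OF assms h, of s t] h by simp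
    also have "B f ?h = s * B f f + t * B g f"
      using B(2) B(3)[rule_format, OF assms assms(1), of s t] h assms by simp
    also have "B g ?h = s * B f g + t * B g g"
      using B(2) B(3)[rule_format, OF assms assms(2), of s t] h assms by simp
    also have "B g f = B f g" using B(2) assms by blast
    finally show ?thesis using B(1) assms by (simp add: power2_eq_square algebra_simps)
  qed
  then show thesis by (rule that)
qed

lemma E_scale: "f \<in> F \<Longrightarrow> E (\<lambda>x. a * f x) = a\<^sup>2 * E f"
proof -
  assume f: "f \<in> F"
  obtain b where "\<And>s t. E (\<lambda>x. s * f x + t * f x) = s\<^sup>2 * E f + 2 * s * t * b + t\<^sup>2 * E f"
    using quadratic[OF f f] by blast
  from this[of a 0] show ?thesis by simp
qed

lemma F_uminus: "f \<in> F \<Longrightarrow> (\<lambda>x. - f x) \<in> F"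
  using F_scale[of f "-1"] by simp

lemma E_uminus: "f \<in> F \<Longrightarrow> E (\<lambda>x. - f x) = E f"
  using E_scale[of f "-1"] by simp

lemma F_diff: "f \<in> F \<Longrightarrow> g \<in> F \<Longrightarrow> (\<lambda>x. f x - g x) \<in> F"
  using F_add[OF _ F_uminus] by simp

lemma F_divide: "f \<in> F \<Longrightarrow> (\<lambda>x. f x / a) \<in> F"
  using F_scale[of f "1 / a"] by simp

lemma E_divide: "f \<in> F \<Longrightarrow> E (\<lambda>x. f x / a) = E f / a\<^sup>2"
  using E_scale[of f "1 / a"] by (simp add: power_divide)

lemma F_zero: "(\<lambda>_. 0) \<in> F"
  using F_const[of 0] by (simp add: rst_def)

lemma F_sum: "finite I \<Longrightarrow> (\<And>i. i \<in> I \<Longrightarrow> g i \<in> F) \<Longrightarrow> (\<lambda>x. \<Sum>i\<in>I. g i x) \<in> F"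
  by (induction I rule: finite_induct) (auto simp: F_zero F_add)

lemma E_const: "E (rst X (\<lambda>_. a)) = 0"
  using E_zero_iff[OF F_const] by (auto simp: rst_def)

lemma E_zero: "E (\<lambda>_. 0) = 0"
  using E_const[of 0] by (simp add: rst_def)

text \<open>Dividing 0 <= E(t f - g) by t bounds twice the mixed energy. The free weight allows a
  nearly sharp constant on one summand.\<close>

lemma E_add_weighted:
  assumes "f \<in> F" "g \<in> F" "t > 0"
  shows "E (\<lambda>x. f x + g x) \<le> (1 + t) * E f + (1 + 1 / t) * E g"
proof -
  obtain b where b: "\<And>s t. E (\<lambda>x. s * f x + t * g x) = s\<^sup>2 * E f + 2 * s * t * b + t\<^sup>2 * E g"
    using quadratic[OF assms(1,2)] by blast
  have "0 \<le> E (\<lambda>x. t * f x + (-1) * g x)"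
    using E_nonneg F_add F_scale assms by blast
  then have "0 \<le> (t\<^sup>2 * E f - 2 * t * b + E g) / t" using b[of t "-1"] assms by simp
  also have "\<dots> = t * E f - 2 * b + E g / t"
    using assms(3) by (simp add: field_simps power2_eq_square)
  finally show ?thesis using b[of 1 1] by (simp add: algebra_simps)
qed

lemma E_add_le: "f \<in> F \<Longrightarrow> g \<in> F \<Longrightarrow> E (\<lambda>x. f x + g x) \<le> 2 * E f + 2 * E g"
  using E_add_weighted[of f g 1] by simp

lemma E_add_bound: "f \<in> F \<Longrightarrow> g \<in> F \<Longrightarrow> E f \<le> a \<Longrightarrow> E g \<le> b \<Longrightarrow> E (\<lambda>x. f x + g x) \<le> 2 * a + 2 * b"
  by (rule order_trans[OF E_add_le add_mono]) auto

lemma E_diff_le: "f \<in> F \<Longrightarrow> g \<in> F \<Longrightarrow> E (\<lambda>x. f x - g x) \<le> 2 * E f + 2 * E g"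
  using E_add_le[OF _ F_uminus, of f g] E_uminus[of g] by simp

lemma E_sum_le:
  assumes "\<And>i. i < M \<Longrightarrow> g i \<in> F"
  shows "E (\<lambda>x. \<Sum>i<M. g i x) \<le> real M * (\<Sum>i<M. E (g i))"
  using assms
proof (induction M)
  case 0
  then show ?case by (simp add: E_zero)
next
  case (Suc M)
  show ?case
  proof (cases "M = 0")
    case True
    then show ?thesis by simp
  next
    case False
    let ?S = "\<lambda>x. \<Sum>i<M. g i x"
    \<comment> \<open>With the weight 1/M both coefficients become M + 1 once the induction
      hypothesis is inserted.\<close>
    have "E (\<lambda>x. ?S x + g M x) \<le> (1 + 1 / M) * E ?S + (1 + 1 / (1 / M)) * E (g M)"
      using Suc.prems False by (intro E_add_weighted F_sum) auto
    also have "\<dots> \<le> (1 + 1 / M) * (M * (\<Sum>i<M. E (g i))) + (1 + M) * E (g M)"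
      using Suc by (intro add_mono mult_left_mono) auto
    also have "\<dots> = (real (Suc M)) * (\<Sum>i<Suc M. E (g i))"
      using False by (simp add: field_simps)
    finally show ?thesis by simp
  qed
qed

lemma E_add_const:
  assumes "f \<in> F" shows "E (\<lambda>x. f x + rst X (\<lambda>_. a) x) = E f"
proof -
  \<comment> \<open>Constants have energy 0, so letting t tend to 0 loses nothing; the converse
    inequality adds \<open>- a\<close> back.\<close>
  have le: "E (\<lambda>x. g x + rst X (\<lambda>_. a) x) \<le> E g" if g: "g \<in> F" for g a
  proof (rule field_le_epsilon)
    fix e :: real assume "e > 0"
    define t where "t = e / (E g + 1)"
    have t: "t > 0" "t * E g \<le> e"
      using \<open>e > 0\<close> E_nonneg[OF g] by (auto simp: t_def field_simps)
    show "E (\<lambda>x. g x + rst X (\<lambda>_. a) x) \<le> E g + e"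
      using E_add_weighted[OF g F_const t(1), of a] t E_const[of a] by (simp add: algebra_simps)
  qed
  have "f = (\<lambda>x. (f x + rst X (\<lambda>_. a) x) + rst X (\<lambda>_. - a) x)"
    by (simp add: rst_def fun_eq_iff)
  then have "E f \<le> E (\<lambda>x. f x + rst X (\<lambda>_. a) x)"
    using le[OF F_add[OF assms F_const[of a]], of "- a"] by metis
  then show ?thesis using le[OF assms] by (simp add: antisym)
qed

lemma E_cong_diff_const:
  assumes "f \<in> F" "g \<in> F" "\<And>x. x \<in> X \<Longrightarrow> f x = g x + a"
  shows "E f = E g"
proof -
  have "f = (\<lambda>x. g x + rst X (\<lambda>_. a) x)"
    using assms(3) F_outside[OF assms(1)] F_outside[OF assms(2)] by (auto simp: rst_def fun_eq_iff)
  then show ?thesis using E_add_const[OF assms(2)] by simp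
qed

lemma F_eqI: "f \<in> F \<Longrightarrow> g \<in> F \<Longrightarrow> (\<And>x. x \<in> X \<Longrightarrow> f x = g x) \<Longrightarrow> f = g"
  using F_outside by (intro ext) (metis (full_types))

lemma F_affine: "f \<in> F \<Longrightarrow> rst X (\<lambda>x. a + b * f x) \<in> F"
proof -
  assume f: "f \<in> F"
  have "rst X (\<lambda>x. a + b * f x) = (\<lambda>x. rst X (\<lambda>_. a) x + b * f x)"
    using F_outside[OF f] by (auto simp: rst_def)
  then show ?thesis using F_add[OF F_const F_scale[OF f]] by metis
qed

lemma E_affine: "f \<in> F \<Longrightarrow> E (rst X (\<lambda>x. a + b * f x)) = b\<^sup>2 * E f"
  using E_cong_diff_const[OF F_affine[of f a b] F_scale, of f b a] E_scale[of f b]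
  by (simp add: rst_def)

lemma clamp:
  assumes "f \<in> F" "d > 0"
  shows "rst X (\<lambda>x. min 1 (max 0 ((f x - a) / d))) \<in> F"
    "E (rst X (\<lambda>x. min 1 (max 0 ((f x - a) / d)))) \<le> E f / d\<^sup>2"
proof -
  let ?g = "rst X (\<lambda>x. - a / d + (1 / d) * f x)"
  have eq: "rst X (\<lambda>x. min 1 (max 0 (?g x))) = rst X (\<lambda>x. min 1 (max 0 ((f x - a) / d)))"
    using assms(2) by (auto simp: rst_def fun_eq_iff diff_divide_distrib)
  have g: "?g \<in> F" "E ?g = E f / d\<^sup>2"
    using F_affine[OF assms(1)] E_affine[OF assms(1), of "- a / d" "1 / d"] by (simp_all only: power_divide power_one) simp
  from clamp_raw[OF g(1)] show "rst X (\<lambda>x. min 1 (max 0 ((f x - a) / d))) \<in> F"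
    "E (rst X (\<lambda>x. min 1 (max 0 ((f x - a) / d)))) \<le> E f / d\<^sup>2"
    unfolding eq g(2) by auto
qed

lemma point_estimate:
  assumes "f \<in> F" "x \<in> X" "y \<in> X"
  shows "(f x - f y)\<^sup>2 \<le> res_metric E F x y * E f"
proof (cases "E f = 0")
  case True
  then have "f x = f y" using E_zero_iff[OF assms(1)] assms(2,3) by metis
  then show ?thesis using True by simp
next
  case False
  then have pos: "E f > 0" using E_nonneg[OF assms(1)] by simp
  then have "(f x - f y)\<^sup>2 / E f \<le> res_metric E F x y"
    unfolding res_metric_def using bdd_above_ratio[OF assms(2,3)] assms(1)
    by (intro cSup_upper) auto
  then show ?thesis using pos by (simp add: field_simps)
qed

end

locale bounded_resistance = resistance +
  assumes bounded: "f \<in> F \<Longrightarrow> \<exists>M. \<forall>x\<in>X. \<bar>f x\<bar> \<le> M"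
begin

text \<open>RF5 only truncates to the unit interval. After division by a bound of \<open>f\<close>
  the upper truncation is harmless, which is why boundedness is assumed.\<close>

lemma positive_part:
  assumes "f \<in> F"
  shows "(\<lambda>x. max 0 (f x)) \<in> F" "E (\<lambda>x. max 0 (f x)) \<le> E f"
proof -
  obtain M0 where M0: "\<And>x. x \<in> X \<Longrightarrow> \<bar>f x\<bar> \<le> M0" using bounded[OF assms] by blast
  define M where "M = max 1 M0"
  have M: "M > 0" "\<And>x. x \<in> X \<Longrightarrow> \<bar>f x\<bar> \<le> M" using M0 by (force simp: M_def)+
  let ?c = "rst X (\<lambda>x. min 1 (max 0 ((f x - 0) / M)))"
  have eq: "(\<lambda>x. max 0 (f x)) = (\<lambda>x. M * ?c x)"
  proof
    fix x
    show "max 0 (f x) = M * ?c x"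
      using M F_outside[OF assms, of x] by (cases "x \<in> X") (auto simp: rst_def max_def min_def field_simps abs_le_iff intro: antisym)
  qed
  note c = clamp[OF assms M(1), of 0]
  show "(\<lambda>x. max 0 (f x)) \<in> F" unfolding eq by (rule F_scale[OF c(1)])
  have "E (\<lambda>x. M * ?c x) = M\<^sup>2 * E ?c" by (rule E_scale[OF c(1)])
  also have "\<dots> \<le> M\<^sup>2 * (E f / M\<^sup>2)" using c(2) by (intro mult_left_mono) auto
  finally show "E (\<lambda>x. max 0 (f x)) \<le> E f" unfolding eq using M(1) by simp
qed

text \<open>The positive part of \<open>p - t * n\<close> is \<open>p\<close> again, where \<open>p\<close> and \<open>n\<close> are the positive and
  negative parts of \<open>f\<close>; letting \<open>t\<close> tend to 0 gives a mixed energy \<open>b \<le> 0\<close> of \<open>p\<close> and \<open>n\<close>.\<close>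

lemma abs_part:
  assumes "f \<in> F"
  shows "(\<lambda>x. \<bar>f x\<bar>) \<in> F" "E (\<lambda>x. \<bar>f x\<bar>) \<le> E f"
proof -
  let ?p = "\<lambda>x. max 0 (f x)" and ?n = "\<lambda>x. max 0 (- f x)"
  have p: "?p \<in> F" and n: "?n \<in> F"
    using positive_part[OF assms] positive_part[OF F_uminus[OF assms]] by auto
  obtain b where b: "\<And>s t. E (\<lambda>x. s * ?p x + t * ?n x) = s\<^sup>2 * E ?p + 2 * s * t * b + t\<^sup>2 * E ?n"
    using quadratic[OF p n] by blast
  have "2 * b \<le> t * E ?n" if t: "t > 0" for t
  proof -
    have "(\<lambda>x. max 0 (1 * ?p x + (- t) * ?n x)) = ?p"
      using t by (auto simp: fun_eq_iff max_def mult_le_0_iff zero_le_mult_iff)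
    then have "E ?p \<le> E (\<lambda>x. 1 * ?p x + (- t) * ?n x)"
      using positive_part(2)[OF F_add[OF F_scale[OF p] F_scale[OF n]], of 1 "- t"] by simp
    then have "2 * t * b \<le> t * (t * E ?n)" using b[of 1 "- t"] by (simp add: power2_eq_square)
    then show ?thesis using t by simp
  qed
  note tb = this
  have b0: "b \<le> 0"
  proof (rule ccontr)
    assume "\<not> b \<le> 0"
    then have "2 * b \<le> b / (E ?n + 1) * E ?n" using E_nonneg[OF n] by (intro tb) auto
    also have "\<dots> \<le> b" using \<open>\<not> b \<le> 0\<close> E_nonneg[OF n] by (simp add: field_simps)
    finally show False using \<open>\<not> b \<le> 0\<close> by simp
  qed
  have eq: "(\<lambda>x. \<bar>f x\<bar>) = (\<lambda>x. 1 * ?p x + 1 * ?n x)" "f = (\<lambda>x. 1 * ?p x + (-1) * ?n x)"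
    by (auto simp: fun_eq_iff)
  show "(\<lambda>x. \<bar>f x\<bar>) \<in> F" unfolding eq(1) by (intro F_add F_scale p n)
  show "E (\<lambda>x. \<bar>f x\<bar>) \<le> E f"
    using b[of 1 1] b[of 1 "-1"] b0 unfolding eq(1) by (subst (2) eq(2)) simp
qed

text \<open>Maximum and minimum are (s + d) / 2 and (s - d) / 2 with s = f + g and d = |f - g|. The
  parallelogram law, for s, d and again for f, g, reduces the claim to E(|f - g|) <= E(f -
  g).\<close>

lemma max_in_F: "f \<in> F \<Longrightarrow> g \<in> F \<Longrightarrow> (\<lambda>x. max (f x) (g x)) \<in> F"
  and min_in_F: "f \<in> F \<Longrightarrow> g \<in> F \<Longrightarrow> (\<lambda>x. min (f x) (g x)) \<in> F"
  and E_max_min: "f \<in> F \<Longrightarrow> g \<in> F \<Longrightarrow> E (\<lambda>x. max (f x) (g x)) + E (\<lambda>x. min (f x) (g x)) \<le> E f + E g"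
proof -
  assume f: "f \<in> F" and g: "g \<in> F"
  let ?s = "\<lambda>x. f x + g x" and ?d = "\<lambda>x. \<bar>f x - g x\<bar>"
  have s: "?s \<in> F" and d: "?d \<in> F" "E ?d \<le> E (\<lambda>x. f x - g x)"
    using F_add[OF f g] abs_part[OF F_diff[OF f g]] by auto
  have eq: "(\<lambda>x. max (f x) (g x)) = (\<lambda>x. (1 / 2) * ?s x + (1 / 2) * ?d x)"
    "(\<lambda>x. min (f x) (g x)) = (\<lambda>x. (1 / 2) * ?s x + (- 1 / 2) * ?d x)"
    by (auto simp: fun_eq_iff max_def min_def field_simps)
  show "(\<lambda>x. max (f x) (g x)) \<in> F" "(\<lambda>x. min (f x) (g x)) \<in> F"
    unfolding eq by (intro F_add F_scale s d)+
  obtain b where b: "\<And>s t. E (\<lambda>x. s * ?s x + t * ?d x) = s\<^sup>2 * E ?s + 2 * s * t * b + t\<^sup>2 * E ?d"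
    using quadratic[OF s d(1)] by blast
  obtain b' where b': "\<And>s t. E (\<lambda>x. s * f x + t * g x) = s\<^sup>2 * E f + 2 * s * t * b' + t\<^sup>2 * E g"
    using quadratic[OF f g] by blast
  show "E (\<lambda>x. max (f x) (g x)) + E (\<lambda>x. min (f x) (g x)) \<le> E f + E g"
    unfolding eq using b[of "1/2" "1/2"] b[of "1/2" "-1/2"] d(2) b'[of 1 1] b'[of 1 "-1"]
    by (simp add: power2_eq_square field_simps)
qed

lemma E_max: "f \<in> F \<Longrightarrow> g \<in> F \<Longrightarrow> E (\<lambda>x. max (f x) (g x)) \<le> E f + E g"
  and E_min: "f \<in> F \<Longrightarrow> g \<in> F \<Longrightarrow> E (\<lambda>x. min (f x) (g x)) \<le> E f + E g"
  using E_max_min[of f g] E_nonneg[OF max_in_F[of f g]] E_nonneg[OF min_in_F[of f g]] by auto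

end

section \<open>Gluing and crossing functions\<close>

lemma compact_local_to_global:
  assumes "compact B" and empty: "P {}"
    and union: "\<And>S T. P S \<Longrightarrow> P T \<Longrightarrow> P (S \<union> T)"
    and mono: "\<And>S T. P S \<Longrightarrow> T \<subseteq> S \<Longrightarrow> P T"
    and local: "\<And>x. x \<in> B \<Longrightarrow> \<exists>U. open U \<and> x \<in> U \<and> P (B \<inter> U)"
  shows "P B"
proof -
  obtain U where U: "\<And>x. x \<in> B \<Longrightarrow> open (U x) \<and> x \<in> U x \<and> P (B \<inter> U x)"
    using local by metis
  obtain D where D: "D \<subseteq> B" "finite D" "B \<subseteq> (\<Union>x\<in>D. U x)"
    using compactE_image[OF assms(1), of B U] U by blast
  have "P (\<Union>x\<in>D. B \<inter> U x)"
    using D(2,1) by (induction D rule: finite_induct) (use empty union U in auto)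
  then show "P B" by (rule mono) (use D(3) in blast)
qed

abbreviation (input) flipx :: "pt \<Rightarrow> pt" where "flipx \<equiv> (\<lambda>(x, y). (1 - x, y))"
abbreviation (input) flipy :: "pt \<Rightarrow> pt" where "flipy \<equiv> (\<lambda>(x, y). (x, 1 - y))"

lemma D4_members [simp]:
  "(\<lambda>(x, y). (1 - x, y)) \<in> D4" "(\<lambda>(x, y). (x, 1 - y)) \<in> D4" "(\<lambda>(x, y). (1 - x, 1 - y)) \<in> D4"
  "(\<lambda>(x, y). (y, x)) \<in> D4" "(\<lambda>(x, y). (1 - y, x)) \<in> D4" "(\<lambda>(x, y). (y, 1 - x)) \<in> D4"
  unfolding D4_def by simp_all

context carpet
begin

text \<open>A corner cell has two names: \<open>bt 0\<close> and \<open>lf 0\<close> have the same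
  offset. The columns \<open>lf\<close> and \<open>rt\<close> therefore avoid the bottom row only
  from index 1 on.\<close>

definition bt where "bt j = (SOME i. i \<in> {1..N} \<and> c i = (j / k, 0))" for j :: nat
definition tp where "tp j = (SOME i. i \<in> {1..N} \<and> c i = (j / k, 1 - 1 / k))" for j :: nat
definition lf where "lf j = (SOME i. i \<in> {1..N} \<and> c i = (0, j / k))" for j :: nat
definition rt where "rt j = (SOME i. i \<in> {1..N} \<and> c i = (1 - 1 / k, j / k))" for j :: nat

lemma bt: "j < k \<Longrightarrow> bt j \<in> {1..N} \<and> c (bt j) = (j / k, 0)"
  unfolding bt_def by (rule someI_ex) (use bottom_cells in blast)
lemma tp: "j < k \<Longrightarrow> tp j \<in> {1..N} \<and> c (tp j) = (j / k, 1 - 1 / k)"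
  unfolding tp_def by (rule someI_ex) (use top_cells in blast)
lemma lf: "j < k \<Longrightarrow> lf j \<in> {1..N} \<and> c (lf j) = (0, j / k)"
  unfolding lf_def by (rule someI_ex) (use left_cells in blast)
lemma rt: "j < k \<Longrightarrow> rt j \<in> {1..N} \<and> c (rt j) = (1 - 1 / k, j / k)"
  unfolding rt_def by (rule someI_ex) (use right_cells in blast)

lemma frame_index [simp]: "j < k \<Longrightarrow> bt j \<in> {1..N}" "j < k \<Longrightarrow> tp j \<in> {1..N}"
  "j < k \<Longrightarrow> lf j \<in> {1..N}" "j < k \<Longrightarrow> rt j \<in> {1..N}"
  using bt tp lf rt by blast+

lemma frame_index_bounds [simp]: "j < k \<Longrightarrow> Suc 0 \<le> bt j" "j < k \<Longrightarrow> bt j \<le> N"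
  "j < k \<Longrightarrow> Suc 0 \<le> tp j" "j < k \<Longrightarrow> tp j \<le> N" "j < k \<Longrightarrow> Suc 0 \<le> lf j" "j < k \<Longrightarrow> lf j \<le> N"
  "j < k \<Longrightarrow> Suc 0 \<le> rt j" "j < k \<Longrightarrow> rt j \<le> N"
  using frame_index by auto

lemma Psi_frame:
  "j < k \<Longrightarrow> \<Psi> (bt j) (x, y) = ((j + x) / k, y / k)"
  "j < k \<Longrightarrow> \<Psi> (tp j) (x, y) = ((j + x) / k, 1 - (1 - y) / k)"
  "j < k \<Longrightarrow> \<Psi> (lf j) (x, y) = (x / k, (j + y) / k)"
  "j < k \<Longrightarrow> \<Psi> (rt j) (x, y) = (1 - (1 - x) / k, (j + y) / k)"
  using bt[of j] tp[of j] lf[of j] rt[of j] by (simp_all add: Psi_pair add_divide_distrib diff_divide_distrib)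

lemma inj_bt: "inj_on bt {..<k}"
  by (rule inj_on_imageI2[of c]) (auto simp: inj_on_def bt)

lemma inj_tp: "inj_on tp {..<k}"
  by (rule inj_on_imageI2[of c]) (auto simp: inj_on_def tp)

lemma inj_lf: "inj_on lf {..<k}"
  by (rule inj_on_imageI2[of c]) (auto simp: inj_on_def lf)

lemma inj_rt: "inj_on rt {..<k}"
  by (rule inj_on_imageI2[of c]) (auto simp: inj_on_def rt)

definition bottom :: "nat set" where "bottom = bt ` {..<k}"

lemma bottom_subset: "bottom \<subseteq> {1..N}" and finite_bottom: "finite bottom"
  and bt_bottom [simp]: "j < k \<Longrightarrow> bt j \<in> bottom"
  using bt by (auto simp: bottom_def)

lemma bottomE: "i \<in> bottom \<Longrightarrow> (\<And>j. j < k \<Longrightarrow> i = bt j \<Longrightarrow> thesis) \<Longrightarrow> thesis"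
  by (auto simp: bottom_def)

lemma sum_bottom: "(\<Sum>i\<in>bottom. f i) = (\<Sum>j<k. f (bt j))"
  unfolding bottom_def by (simp add: sum.reindex inj_bt)

lemma snd_c_bottom: "i \<in> bottom \<Longrightarrow> snd (c i) = 0"
  using bt by (auto simp: bottom_def)

lemma tp_not_bottom: "j < k \<Longrightarrow> tp j \<notin> bottom"
  using snd_c_bottom[of "tp j"] tp[of j] k3 by (auto simp: field_simps)
lemma lf_not_bottom: "0 < j \<Longrightarrow> j < k \<Longrightarrow> lf j \<notin> bottom"
  using snd_c_bottom[of "lf j"] lf[of j] by auto
lemma rt_not_bottom: "0 < j \<Longrightarrow> j < k \<Longrightarrow> rt j \<notin> bottom"
  using snd_c_bottom[of "rt j"] rt[of j] by auto

text \<open>Some bottom cell overlaps the given cell in horizontal projection, so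
  \<open>cells_separated\<close> forces the two apart vertically.\<close>

lemma snd_c_not_bottom:
  assumes "i \<in> {1..N}" "i \<notin> bottom"
  shows "1 / k \<le> snd (c i)"
proof -
  define j where "j = nat \<lfloor>fst (c i) * k\<rfloor>"
  have b: "0 \<le> fst (c i)" "fst (c i) + 1 / k \<le> 1" "0 \<le> snd (c i)" using c_bounds[OF assms(1)] by auto
  have j1: "real j \<le> fst (c i) * k" "fst (c i) * k < real j + 1"
    using b(1) unfolding j_def by (auto simp: of_nat_nat)
  have "fst (c i) * k \<le> real k - 1" using b(2) by (simp add: field_simps)
  then have "j < k" using j1 by linarith
  moreover have "\<bar>fst (c i) - fst (c (bt j))\<bar> < 1 / k"
  proof -
    have "j / k \<le> fst (c i)" "fst (c i) < (j + 1) / k"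
      using j1 by (simp_all add: pos_divide_le_eq pos_less_divide_eq)
    then show ?thesis using bt[OF \<open>j < k\<close>] by (simp add: add_divide_distrib)
  qed
  ultimately have "1 / k \<le> \<bar>snd (c i) - snd (c (bt j))\<bar>"
    using assms by (intro cells_separated) auto
  then show ?thesis using bt[OF \<open>j < k\<close>] b(3) by simp
qed

end

section \<open>Self-similar forms: continuity, gluing and symmetry\<close>

locale carpet_form = carpet +
  fixes E :: "(pt \<Rightarrow> real) \<Rightarrow> real" and F :: "(pt \<Rightarrow> real) set" and r :: real
  assumes form: "resistance_form K E F" and rpos: "r > 0"
    and self_similar: "self_similar_form k N c K E F r"
    and symmetric: "D4_symmetric K E F" and continuous_R: "jointly_continuous K E F"
    and normalized: "eff_res E F (side 2) (side 4) = 1"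

sublocale carpet_form \<subseteq> resistance K E F
  by unfold_locales (rule form)

context carpet_form
begin

lemma F_continuous:
  assumes "f \<in> F" shows "continuous_on K f"
proof (cases "E f = 0")
  case True
  then obtain a where "\<forall>x\<in>K. f x = a" using E_zero_iff[OF assms] by blast
  then show ?thesis by (simp cong: continuous_on_cong)
next
  case False
  then have pos: "E f > 0" using E_nonneg[OF assms] by simp
  \<comment> \<open>A function of positive energy makes this set \<open>{0}\<close>; without one it
    would be empty and its \<open>Sup\<close> unspecified.\<close>
  have "{(f x - f x)\<^sup>2 / E f | f. f \<in> F \<and> E f > 0} = {0}" for x using assms pos by auto
  then have R0: "res_metric E F x x = 0" for x unfolding res_metric_def by simp
  show ?thesis unfolding continuous_on_def
  proof
    fix x assume x: "x \<in> K"
    have "continuous_on K (\<lambda>y. res_metric E F (fst (y, x)) (snd (y, x)))"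
      using continuous_R unfolding jointly_continuous_def
      by (rule continuous_on_compose2) (use x in \<open>auto intro!: continuous_intros\<close>)
    then have "((\<lambda>y. res_metric E F y x) \<longlongrightarrow> 0) (at x within K)"
      using x R0[of x] unfolding continuous_on_def by fastforce
    then have "((\<lambda>y. sqrt (res_metric E F y x * E f)) \<longlongrightarrow> sqrt (0 * E f)) (at x within K)"
      by (intro tendsto_intros)
    then have *: "((\<lambda>y. sqrt (res_metric E F y x * E f)) \<longlongrightarrow> 0) (at x within K)" by simp
    have "((\<lambda>y. f y - f x) \<longlongrightarrow> 0) (at x within K)"
    proof (rule Lim_null_comparison[OF _ *])
      show "\<forall>\<^sub>F y in at x within K. norm (f y - f x) \<le> sqrt (res_metric E F y x * E f)"
        unfolding eventually_at_topological using point_estimate[OF assms _ x] by (auto intro!: exI[of _ UNIV] real_le_rsqrt)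
    qed
    then show "(f \<longlongrightarrow> f x) (at x within K)" by (rule LIM_zero_cancel)
  qed
qed

end

sublocale carpet_form \<subseteq> bounded_resistance K E F
proof
  fix f assume "f \<in> F"
  then have "compact (f ` K)" using F_continuous compact_K by (blast intro: compact_continuous_image)
  then obtain M where "\<forall>y\<in>f ` K. norm y \<le> M" using compact_imp_bounded bounded_iff by metis
  then show "\<exists>M. \<forall>x\<in>K. \<bar>f x\<bar> \<le> M" by auto
qed

context carpet_form
begin

definition sub :: "nat \<Rightarrow> (pt \<Rightarrow> real) \<Rightarrow> pt \<Rightarrow> real" where "sub i f = rst K (f \<circ> \<Psi> i)"

lemma sub_apply [simp]: "p \<in> K \<Longrightarrow> sub i f p = f (\<Psi> i p)"
  by (simp add: sub_def rst_def)

lemma F_iff: "f \<in> F \<longleftrightarrow> (\<forall>p. p \<notin> K \<longrightarrow> f p = 0) \<and> (\<forall>i\<in>{1..N}. sub i f \<in> F)"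
proof -
  have "F = {f \<in> funs_on K. \<forall>i\<in>{1..N}. rst K (f \<circ> \<Psi> i) \<in> F}"
    using self_similar by (auto simp: self_similar_form_def)
  then show ?thesis unfolding funs_on_def sub_def by blast
qed

lemma sub_F: "f \<in> F \<Longrightarrow> i \<in> {1..N} \<Longrightarrow> sub i f \<in> F"
  using F_iff by blast

lemma sub_frame_F [simp]:
  "f \<in> F \<Longrightarrow> j < k \<Longrightarrow> sub (bt j) f \<in> F" "f \<in> F \<Longrightarrow> j < k \<Longrightarrow> sub (tp j) f \<in> F"
  "f \<in> F \<Longrightarrow> j < k \<Longrightarrow> sub (lf j) f \<in> F" "f \<in> F \<Longrightarrow> j < k \<Longrightarrow> sub (rt j) f \<in> F"
  by (simp_all only: sub_F frame_index)

lemma E_split: "f \<in> F \<Longrightarrow> E f = (\<Sum>i\<in>{1..N}. E (sub i f)) / r"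
  using self_similar unfolding self_similar_form_def sub_def
  by (simp add: sum_distrib_left[symmetric] divide_inverse mult.commute)

lemma E_sub_sum: "f \<in> F \<Longrightarrow> A \<subseteq> {1..N} \<Longrightarrow> (\<Sum>i\<in>A. E (sub i f)) \<le> r * E f"
  using E_split[of f] rpos sum_mono2[of "{1..N}" A "\<lambda>i. E (sub i f)"] E_nonneg[OF sub_F[of f]]
  by auto

lemma E_sub_le: "f \<in> F \<Longrightarrow> i \<in> {1..N} \<Longrightarrow> E (sub i f) \<le> r * E f"
  using E_sub_sum[of f "{i}"] by simp

definition compatible :: "(nat \<Rightarrow> pt \<Rightarrow> real) \<Rightarrow> bool" where
  "compatible g \<longleftrightarrow> (\<forall>i\<in>{1..N}. \<forall>j\<in>{1..N}. i \<noteq> j \<longrightarrow> (\<forall>p\<in>K. \<forall>q\<in>K. \<Psi> i p = \<Psi> j q \<longrightarrow> g i p = g j q))"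

text \<open>A point shared by several cells has several preimages; an arbitrary one is chosen, and
  \<open>compatible\<close> makes the choice irrelevant.\<close>

definition glue :: "(nat \<Rightarrow> pt \<Rightarrow> real) \<Rightarrow> pt \<Rightarrow> real" where
  "glue g p = (if p \<in> K then (case SOME (i, q). i \<in> {1..N} \<and> q \<in> K \<and> p = \<Psi> i q of (i, q) \<Rightarrow> g i q) else 0)"

lemma glue_apply:
  assumes "compatible g" "i \<in> {1..N}" "q \<in> K"
  shows "glue g (\<Psi> i q) = g i q"
proof -
  let ?P = "\<lambda>(j, q'). j \<in> {1..N} \<and> q' \<in> K \<and> \<Psi> i q = \<Psi> j q'"
  have "?P (SOME z. ?P z)" by (rule someI[of ?P "(i, q)"]) (use assms in auto)
  then obtain j q' where s: "(SOME z. ?P z) = (j, q')" "j \<in> {1..N}" "q' \<in> K" "\<Psi> i q = \<Psi> j q'"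
    by (cases "SOME z. ?P z") auto
  have "g j q' = g i q"
  proof (cases "i = j")
    case True
    then show ?thesis using s(4) inj_Psi by simp
  next
    case False
    then show ?thesis using assms s unfolding compatible_def by metis
  qed
  then show ?thesis using Psi_in_K[OF assms(2,3)] s(1) by (simp add: glue_def)
qed

lemma glue_outside: "p \<notin> K \<Longrightarrow> glue g p = 0"
  by (simp add: glue_def)

lemma sub_glue:
  assumes "compatible g" "i \<in> {1..N}" "g i \<in> F"
  shows "sub i (glue g) = g i"
proof
  fix p
  show "sub i (glue g) p = g i p"
    using glue_apply[OF assms(1,2)] F_outside[OF assms(3)] by (cases "p \<in> K") (auto simp: sub_def rst_def)
qed

lemma glue_F: "compatible g \<Longrightarrow> (\<And>i. i \<in> {1..N} \<Longrightarrow> g i \<in> F) \<Longrightarrow> glue g \<in> F"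
  unfolding F_iff[of "glue g"] using sub_glue glue_outside by metis

lemma E_glue: "compatible g \<Longrightarrow> (\<And>i. i \<in> {1..N} \<Longrightarrow> g i \<in> F) \<Longrightarrow> E (glue g) = (\<Sum>i\<in>{1..N}. E (g i)) / r"
  using E_split[OF glue_F, of g] by (simp add: sub_glue cong: sum.cong_simp)

definition sym :: "(pt \<Rightarrow> pt) \<Rightarrow> (pt \<Rightarrow> real) \<Rightarrow> pt \<Rightarrow> real" where "sym \<Gamma> f = rst K (f \<circ> \<Gamma>)"

lemma sym_apply [simp]: "p \<in> K \<Longrightarrow> sym \<Gamma> f p = f (\<Gamma> p)"
  by (simp add: sym_def rst_def)

lemma sym_F: "\<Gamma> \<in> D4 \<Longrightarrow> f \<in> F \<Longrightarrow> sym \<Gamma> f \<in> F"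
  and E_sym: "\<Gamma> \<in> D4 \<Longrightarrow> f \<in> F \<Longrightarrow> E (sym \<Gamma> f) = E f"
  using symmetric by (auto simp: D4_symmetric_def sym_def)

lemma open_trace:
  assumes "f \<in> F" "open S" "x \<in> K" "f x \<in> S"
  shows "\<exists>U. open U \<and> x \<in> U \<and> (\<forall>y\<in>K \<inter> U. f y \<in> S)"
proof -
  obtain U where "open U" "U \<inter> K = f -` S \<inter> K"
    using F_continuous[OF assms(1)] assms(2) unfolding continuous_on_open_invariant by blast
  then show ?thesis using assms(3,4) by blast
qed

text \<open>The usual two-step compactness argument for sublattices that separate points.\<close>

lemma separating_function:
  assumes A: "compact A" "A \<subseteq> K" and B: "compact B" "B \<subseteq> K" and disj: "A \<inter> B = {}"
  shows "\<exists>f\<in>F. (\<forall>p\<in>A. f p = 0) \<and> (\<forall>p\<in>B. f p = 1)"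
proof -
  have one: "\<exists>g\<in>F. g a < 0 \<and> (\<forall>b\<in>B. g b > 1)" if a: "a \<in> A" for a
  proof (rule compact_local_to_global[OF B(1), of "\<lambda>S. \<exists>g\<in>F. g a < 0 \<and> (\<forall>b\<in>S. g b > 1)"])
    have aK: "a \<in> K" using a A by blast
    show "\<exists>g\<in>F. g a < 0 \<and> (\<forall>b\<in>{}. g b > 1)"
      using aK by (intro bexI[OF _ F_const[of "-1"]]) (simp add: rst_def)
    fix S T assume "\<exists>g\<in>F. g a < 0 \<and> (\<forall>b\<in>S. g b > 1)" "\<exists>g\<in>F. g a < 0 \<and> (\<forall>b\<in>T. g b > 1)"
    then obtain g g' where "g \<in> F" "g a < 0" "\<forall>b\<in>S. g b > 1" "g' \<in> F" "g' a < 0" "\<forall>b\<in>T. g' b > 1" by blast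
    then show "\<exists>g\<in>F. g a < 0 \<and> (\<forall>b\<in>S \<union> T. g b > 1)"
      by (intro bexI[OF _ max_in_F[of g g']]) auto
  next
    fix b assume b: "b \<in> B"
    have "a \<noteq> b" "a \<in> K" "b \<in> K" using a b A B disj by auto
    then obtain u where u: "u \<in> F" "u a = -1" "u b = 2"
      using F_interpolate[of "{a, b}" "\<lambda>x. if x = a then -1 else 2"] by auto
    then obtain U where "open U" "b \<in> U" "\<forall>y\<in>K \<inter> U. u y \<in> {1<..}"
      using open_trace[OF u(1), of "{1<..}" b] \<open>b \<in> K\<close> by auto
    then show "\<exists>U. open U \<and> b \<in> U \<and> (\<exists>g\<in>F. g a < 0 \<and> (\<forall>b\<in>B \<inter> U. g b > 1))"
      using u B by (intro exI[of _ U]) (auto intro!: bexI[OF _ u(1)])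
  qed blast
  have "\<exists>g\<in>F. (\<forall>a\<in>A. g a < 0) \<and> (\<forall>b\<in>B. g b > 1)"
  proof (rule compact_local_to_global[OF A(1), of "\<lambda>S. \<exists>g\<in>F. (\<forall>a\<in>S. g a < 0) \<and> (\<forall>b\<in>B. g b > 1)"])
    show "\<exists>g\<in>F. (\<forall>a\<in>{}. g a < 0) \<and> (\<forall>b\<in>B. g b > 1)"
      using B by (intro bexI[OF _ F_const[of 2]]) (auto simp: rst_def)
    fix S T assume "\<exists>g\<in>F. (\<forall>a\<in>S. g a < 0) \<and> (\<forall>b\<in>B. g b > 1)" "\<exists>g\<in>F. (\<forall>a\<in>T. g a < 0) \<and> (\<forall>b\<in>B. g b > 1)"
    then obtain g g' where "g \<in> F" "\<forall>a\<in>S. g a < 0" "\<forall>b\<in>B. g b > 1"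
      "g' \<in> F" "\<forall>a\<in>T. g' a < 0" "\<forall>b\<in>B. g' b > 1" by blast
    then show "\<exists>g\<in>F. (\<forall>a\<in>S \<union> T. g a < 0) \<and> (\<forall>b\<in>B. g b > 1)"
      by (intro bexI[OF _ min_in_F[of g g']]) auto
  next
    fix a assume a: "a \<in> A"
    then obtain u where u: "u \<in> F" "u a < 0" "\<forall>b\<in>B. u b > 1" using one by blast
    then obtain U where "open U" "a \<in> U" "\<forall>y\<in>K \<inter> U. u y \<in> {..<0}"
      using open_trace[OF u(1), of "{..<0}" a] a A by auto
    then show "\<exists>U. open U \<and> a \<in> U \<and> (\<exists>g\<in>F. (\<forall>a\<in>A \<inter> U. g a < 0) \<and> (\<forall>b\<in>B. g b > 1))"
      using u A by (intro exI[of _ U]) (auto intro!: bexI[OF _ u(1)])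
  qed blast
  then obtain g where g: "g \<in> F" "\<forall>a\<in>A. g a < 0" "\<forall>b\<in>B. g b > 1" by blast
  show ?thesis
    by (rule bexI[OF _ clamp(1)[OF g(1) zero_less_one, of 0]]) (use g A B in \<open>force simp: rst_def\<close>)
qed

section \<open>Crossings between the vertical sides\<close>

definition crossings :: "(pt \<Rightarrow> real) set" where
  "crossings = {f \<in> F. (\<forall>y. 0 \<le> y \<longrightarrow> y \<le> 1 \<longrightarrow> f (0, y) = 0 \<and> f (1, y) = 1)}"

text \<open>\<open>eff_res\<close> asks for 0 on the right side and 1 on the left;
  \<open>flipx\<close> reverses this at equal energy.\<close>

lemma eff_res_crossings: "Sup ((\<lambda>f. inverse (E f)) ` crossings) = 1"
proof -
  have "{inverse (E f) | f. f \<in> F \<and> (\<forall>x\<in>side 2. f x = 0) \<and> (\<forall>x\<in>side 4. f x = 1)} =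
    (\<lambda>f. inverse (E f)) ` crossings" (is "?L = ?R")
  proof (intro subset_antisym subsetI)
    fix z assume "z \<in> ?L"
    then obtain f where f: "f \<in> F" "z = inverse (E f)" "\<forall>x\<in>side 2. f x = 0" "\<forall>x\<in>side 4. f x = 1" by blast
    then have "sym flipx f \<in> crossings" by (auto simp: crossings_def side_2 side_4 sym_F)
    then show "z \<in> ?R" using f E_sym[of flipx f] by (auto intro!: image_eqI[of _ _ "sym flipx f"])
  next
    fix z assume "z \<in> ?R"
    then obtain f where f: "f \<in> crossings" "z = inverse (E f)" by blast
    then have fF: "f \<in> F" by (simp add: crossings_def)
    then show "z \<in> ?L"
      by (intro CollectI exI[of _ "sym flipx f"] conjI) (use f in \<open>auto simp: crossings_def side_2 side_4 sym_F E_sym\<close>)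
  qed
  then show ?thesis using normalized by (simp add: eff_res_def)
qed

lemma E_crossing_pos: "f \<in> crossings \<Longrightarrow> 0 < E f"
proof -
  assume f: "f \<in> crossings"
  then have fF: "f \<in> F" and "f (0, 0) = 0" "f (1, 0) = 1" by (auto simp: crossings_def)
  then have "E f \<noteq> 0" using E_zero_iff[OF fF] edge_in_K(1)[of 0] edge_in_K(1)[of 1]
    by (metis zero_neq_one order_refl zero_le_one)
  then show ?thesis using E_nonneg[OF fF] by simp
qed

text \<open>A crossing takes the values 0 and 1 at two corners, so RF4 bounds its energy from below.
  Without this the real \<open>Sup\<close> would say nothing about single crossings.\<close>

lemma bdd_above_crossings: "bdd_above ((\<lambda>f. inverse (E f)) ` crossings)"
proof (rule bdd_aboveI2)
  fix f assume f: "f \<in> crossings"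
  then have "1 \<le> res_metric E F (1, 0) (0, 0) * E f"
    using point_estimate[of f "(1, 0)" "(0, 0)"] by (auto simp: crossings_def)
  then show "inverse (E f) \<le> res_metric E F (1, 0) (0, 0)"
    using E_crossing_pos[OF f] by (simp add: field_simps)
qed

lemma E_crossing_ge: "f \<in> crossings \<Longrightarrow> 1 \<le> E f"
  using cSup_upper[OF imageI bdd_above_crossings, of f] E_crossing_pos[of f] eff_res_crossings
  by (simp add: field_simps)

lemma near_optimal_crossing:
  assumes "q < 1"
  obtains h where "h \<in> crossings" "q * E h < 1" "\<And>p. p \<in> K \<Longrightarrow> 0 \<le> h p \<and> h p \<le> 1"
proof -
  have "side 4 \<union> side 2 \<subseteq> bdry0" by (auto simp: side_2 side_4 bdry0_iff usq_iff)
  then have "\<exists>f\<in>F. (\<forall>p\<in>side 4. f p = 0) \<and> (\<forall>p\<in>side 2. f p = 1)"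
  proof (intro separating_function)
    show "compact (side 4)" "compact (side 2)" by (simp_all add: side_def)
    show "side 4 \<inter> side 2 = {}" by (auto simp: side_2 side_4)
  qed (use \<open>side 4 \<union> side 2 \<subseteq> bdry0\<close> bdry0_subset_K in auto)
  then have "crossings \<noteq> {}" by (auto simp: crossings_def side_2 side_4)
  then obtain f where f: "f \<in> crossings" "q < inverse (E f)"
    using assms eff_res_crossings less_cSup_iff[OF _ bdd_above_crossings, of q] by auto
  then have fF: "f \<in> F" and pos: "0 < E f" using E_crossing_pos by (auto simp: crossings_def)
  let ?h = "rst K (\<lambda>x. min 1 (max 0 (f x)))"
  have h: "?h \<in> crossings" "E ?h \<le> E f" "\<And>p. p \<in> K \<Longrightarrow> 0 \<le> ?h p \<and> ?h p \<le> 1"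
    using f clamp_raw[OF fF] by (auto simp: crossings_def rst_def)
  have "q * E ?h < 1"
  proof (cases "q \<le> 0")
    case True
    then show ?thesis using E_crossing_pos[OF h(1)] by (smt (verit) mult_nonneg_nonneg mult_minus_left)
  next
    case False
    then have "q * E ?h \<le> q * E f" using h(2) by simp
    also have "\<dots> < 1" using f(2) pos by (simp add: field_simps)
    finally show ?thesis .
  qed
  with h show thesis using that by blast
qed

text \<open>Resistances of a row of cells add up: reflecting every other cell, the alternating sum
  of the pieces telescopes on both vertical sides to a function with crossing boundary values.\<close>

lemma row_energy:
  assumes M: "M > 0" and F: "\<And>j. j < M \<Longrightarrow> g j \<in> F"
    and match: "\<And>j y. Suc j < M \<Longrightarrow> 0 \<le> y \<Longrightarrow> y \<le> 1 \<Longrightarrow> g j (1, y) = g (Suc j) (0, y)"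
    and left: "\<And>y. 0 \<le> y \<Longrightarrow> y \<le> 1 \<Longrightarrow> g 0 (0, y) = 0"
    and right: "\<And>y. 0 \<le> y \<Longrightarrow> y \<le> 1 \<Longrightarrow> g (M - 1) (1, y) = 1"
  shows "1 \<le> real M * (\<Sum>j<M. E (g j))"
proof -
  define t where "t j = (if even j then g j else (\<lambda>p. - sym flipx (g j) p))" for j
  have tF: "t j \<in> F" and tE: "E (t j) = E (g j)" if "j < M" for j
    using F[OF that] by (auto simp: t_def F_uminus E_uminus sym_F E_sym)
  define G where "G p = (\<Sum>j<M. t j p)" for p
  have GF: "G \<in> F" unfolding G_def by (rule F_sum) (use tF in auto)
  have GE: "E G \<le> real M * (\<Sum>j<M. E (g j))"
    using E_sum_le[of M t] tF tE unfolding G_def by simp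
  have G: "G (0, y) = (if even M then -1 else 0)" "G (1, y) = (if even M then 0 else 1)"
    if y: "0 \<le> y" "y \<le> 1" for y
  proof -
    \<comment> \<open>\<open>n j\<close> is the trace at height y on the left side of cell j, with
      the default 1 standing for the right end of the row.\<close>
    define n where "n j = (if j < M then g j (0, y) else 1)" for j
    have n0: "n 0 = 0" and nM: "n M = 1" using M left y by (auto simp: n_def)
    have n1: "g j (1, y) = n (Suc j)" if "j < M" for j
    proof (cases "Suc j < M")
      case True
      then show ?thesis using match y by (simp add: n_def)
    next
      case False
      then have "j = M - 1" using that by simp
      then show ?thesis using right[OF y] M by (simp add: n_def)
    qed
    have "(\<Sum>j<m. t j (0, y)) = (if even m then n 0 - n m else n 0) \<and>
      (\<Sum>j<m. t j (1, y)) = (if even m then 0 else n m)" if "m \<le> M" for m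
      using that
    proof (induction m)
      case (Suc m)
      then have "t m (0, y) = (if even m then n m else - n (Suc m))"
        "t m (1, y) = (if even m then n (Suc m) else - n m)"
        using y n1[of m] by (auto simp: t_def n_def)
      then show ?case using Suc by auto
    qed simp
    from this[of M] show "G (0, y) = (if even M then -1 else 0)" "G (1, y) = (if even M then 0 else 1)"
      unfolding G_def n0 nM by auto
  qed
  have "1 \<le> E G"
  proof (cases "even M")
    case True
    let ?H = "\<lambda>p. G p + rst K (\<lambda>_. 1) p"
    have "?H \<in> crossings" unfolding crossings_def using F_add[OF GF F_const] G True by (auto simp: rst_def)
    then show ?thesis using E_crossing_ge E_add_const[OF GF] by metis
  next
    case False
    then show ?thesis using G GF by (intro E_crossing_ge) (auto simp: crossings_def)
  qed
  then show ?thesis using GE by linarith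
qed

text \<open>The bottom and the top row are disjoint, and a crossing restricted to either of them
  crosses k cells, whose energies sum to at least 1/k. So 2 / k <= r E(h) for every crossing, and
  E(h) can be taken close to 1.\<close>

lemma rk_ge_2: "r * k \<ge> 2"
proof -
  have "2 * q \<le> r * k" if q: "q < 1" for q
  proof -
    obtain h where h: "h \<in> crossings" "q * E h < 1" using near_optimal_crossing[OF q] by metis
    then have hF: "h \<in> F" and h0: "\<And>y. 0 \<le> y \<Longrightarrow> y \<le> 1 \<Longrightarrow> h (0, y) = 0"
      and h1: "\<And>y. 0 \<le> y \<Longrightarrow> y \<le> 1 \<Longrightarrow> h (1, y) = 1" by (auto simp: crossings_def)
    have y': "0 \<le> y / k" "y / k \<le> 1" "0 \<le> 1 - (1 - y) / k" "1 - (1 - y) / k \<le> 1"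
      if "0 \<le> y" "y \<le> 1" for y using that k3 by (auto simp: field_simps)
    have last: "(real (k - Suc 0) + 1) / k = 1" using k3 by (simp add: of_nat_diff)
    have b: "1 \<le> k * (\<Sum>j<k. E (sub (bt j) h))"
    proof (rule row_energy)
      show "sub (bt (k - 1)) h (1, y) = 1" if "0 \<le> y" "y \<le> 1" for y
        using that y'[OF that] h1[of "y / k"] last by (simp add: Psi_frame)
    qed (use y' h0 in \<open>auto simp: hF Psi_frame add_ac\<close>)
    have t: "1 \<le> k * (\<Sum>j<k. E (sub (tp j) h))"
    proof (rule row_energy)
      show "sub (tp (k - 1)) h (1, y) = 1" if "0 \<le> y" "y \<le> 1" for y
        using that y'[OF that] h1[of "1 - (1 - y) / k"] last by (simp add: Psi_frame)
    qed (use y' h0 in \<open>auto simp: hF Psi_frame add_ac\<close>)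
    have "bottom \<inter> tp ` {..<k} = {}" using tp_not_bottom by auto
    then have "(\<Sum>j<k. E (sub (bt j) h)) + (\<Sum>j<k. E (sub (tp j) h)) = (\<Sum>i\<in>bottom \<union> tp ` {..<k}. E (sub i h))"
      by (subst sum.union_disjoint) (auto simp: finite_bottom sum_bottom sum.reindex inj_tp)
    also have "\<dots> \<le> r * E h"
      using tp bottom_subset by (intro E_sub_sum hF) blast
    finally have "k * ((\<Sum>j<k. E (sub (bt j) h)) + (\<Sum>j<k. E (sub (tp j) h))) \<le> k * (r * E h)"
      by (intro mult_left_mono) auto
    then have rE: "2 \<le> r * k * E h" using b t by (simp add: algebra_simps)
    show ?thesis
    proof (cases "q \<le> 0")
      case True
      then show ?thesis using rpos by (smt (verit) kpos mult_pos_pos)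
    next
      case False
      then have "2 * q \<le> r * k * E h * q" using rE by simp
      also have "\<dots> = r * k * (q * E h)" by simp
      also have "\<dots> \<le> r * k" using h(2) rpos mult_left_mono[of "q * E h" 1 "r * k"] by simp
      finally show ?thesis .
    qed
  qed
  then show ?thesis by (intro field_le_mult_one_interval[of 2]) (auto simp: mult.commute)
qed

end

section \<open>Extension from one side\<close>

lemma continuous_le_on_nodes:
  fixes f g :: "real \<Rightarrow> real"
  assumes k: "k \<ge> (2::nat)" and f: "continuous_on {0..1} f" and g: "continuous_on {0..1} g"
    and le: "\<And>m l :: nat. l \<le> k ^ m \<Longrightarrow> f (l / real k ^ m) \<le> g (l / real k ^ m)"
    and x: "0 \<le> x" "x \<le> 1"
  shows "f x \<le> g x"
proof -
  define l where "l m = nat \<lfloor>x * real k ^ m\<rfloor>" for m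
  define y where "y m = l m / real k ^ m" for m
  have kp: "real k ^ m > 0" for m using k by simp
  have l: "real (l m) \<le> x * real k ^ m" "x * real k ^ m < real (l m) + 1" for m
    using x(1) kp[of m] unfolding l_def by (auto simp: of_nat_nat)
  have lk: "l m \<le> k ^ m" for m
  proof -
    have "real (l m) \<le> 1 * real k ^ m" using l(1)[of m] x(2) kp[of m] mult_right_mono[of x 1 "real k ^ m"] by linarith
    then show ?thesis by (simp flip: of_nat_power)
  qed
  have y: "y m \<le> x" "x \<le> y m + (1 / real k) ^ m" for m
    using l[of m] kp[of m] unfolding y_def by (auto simp: field_simps)
  have y01: "y m \<in> {0..1}" for m using y[of m] x by (auto simp: y_def)
  have "norm (1 / real k) < 1" using k by (simp add: field_simps)
  then have "(\<lambda>m. (1 / real k) ^ m) \<longlonglongrightarrow> 0" by (rule LIMSEQ_power_zero)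
  then have "(\<lambda>m. x - (1 / real k) ^ m) \<longlonglongrightarrow> x - 0" by (intro tendsto_diff tendsto_const)
  then have "(\<lambda>m. x - (1 / real k) ^ m) \<longlonglongrightarrow> x" by simp
  then have lim: "y \<longlonglongrightarrow> x"
    by (rule tendsto_sandwich[rotated 2]) (use y in \<open>auto intro!: always_eventually simp: diff_le_eq\<close>)
  have "(\<lambda>m. f (y m)) \<longlonglongrightarrow> f x" "(\<lambda>m. g (y m)) \<longlonglongrightarrow> g x"
    using f g lim y01 x unfolding continuous_on_sequentially comp_def by auto
  moreover have "f (y m) \<le> g (y m)" for m unfolding y_def using le lk by blast
  ultimately show ?thesis by (intro LIMSEQ_le) auto
qed

lemma sum_blocks: "(\<Sum>l<k * n. \<phi> l) = (\<Sum>j<k. \<Sum>l<n. \<phi> (j * n + l :: nat))"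
proof -
  have "sum \<phi> {..<k * n} = (\<Sum>j<k. sum \<phi> {j * n..<j * n + n})" by (rule sum.nat_group[symmetric])
  also have "\<dots> = (\<Sum>j<k. \<Sum>l<n. \<phi> (j * n + l))"
    by (rule sum.cong[OF refl], subst sum.atLeastLessThan_shift_0) (simp add: lessThan_atLeast0)
  finally show ?thesis .
qed

context carpet
begin

lemma edge_coordE:
  assumes "0 \<le> x" "x \<le> (1::real)"
  obtains j t where "j < k" "0 \<le> t" "t \<le> 1" "x = (real j + t) / real k"
proof (cases "x = 1")
  case True
  \<comment> \<open>The right end belongs to the last cell at t = 1, as there is no cell with index
    k.\<close>
  then show ?thesis using that[of "k - 1" 1] k3 by (simp add: of_nat_diff)
next
  case False
  define j where "j = nat \<lfloor>x * k\<rfloor>"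
  have j: "real j \<le> x * k" "x * k < real j + 1" using assms(1) unfolding j_def by auto
  have "x * k < 1 * real k" using False assms(2) by (intro mult_strict_right_mono) auto
  then have "j < k" using j by linarith
  moreover have "x = (real j + (x * k - real j)) / k" by simp
  ultimately show ?thesis using that[of j "x * k - real j"] j by auto
qed

lemma node_split:
  assumes "l \<le> k ^ Suc n"
  obtains j l' where "j < k" "l' \<le> k ^ n" "l = j * k ^ n + l'"
proof (cases "l = k ^ Suc n")
  case True
  have "k ^ Suc n = (k - 1) * k ^ n + k ^ n" by (cases k) auto
  then show ?thesis using that[of "k - 1" "k ^ n"] True k3 by simp
next
  case False
  then have "l < k * k ^ n" using assms by simp
  then have "l div k ^ n < k" by (simp add: less_mult_imp_div_less)
  moreover have "l mod k ^ n \<le> k ^ n" by (simp add: less_imp_le)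
  ultimately show ?thesis by (rule that) (rule div_mult_mod_eq[symmetric])
qed

definition V :: "nat \<Rightarrow> (real \<Rightarrow> real) \<Rightarrow> real" where
  "V m u = (\<Sum>l<k ^ m. (u (real l / real k ^ m) - u (real (l + 1) / real k ^ m))\<^sup>2)"

lemma V_nonneg: "0 \<le> V m u"
  by (simp add: V_def sum_nonneg)

lemma V_0: "V 0 u = (u 0 - u 1)\<^sup>2"
  by (simp add: V_def)

text \<open>Increments ignore constants, so each block may be shifted by its own \<open>a j\<close>.
  Later this lets every block be normalised to start at 0.\<close>

lemma V_Suc: "V (Suc m) u = (\<Sum>j<k. V m (\<lambda>t. u ((j + t) / k) - a j))"
proof -
  let ?f = "\<lambda>l. (u (real l / real k ^ Suc m) - u (real (l + 1) / real k ^ Suc m))\<^sup>2"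
  have arg: "real (j * k ^ m + l) / real k ^ Suc m = (j + l / real k ^ m) / k" for j l :: nat
    by (simp add: field_simps)
  have "V (Suc m) u = sum ?f {..<k * k ^ m}" by (simp add: V_def)
  also have "\<dots> = (\<Sum>j<k. \<Sum>l<k ^ m. ?f (j * k ^ m + l))" by (rule sum_blocks)
  also have "\<dots> = (\<Sum>j<k. V m (\<lambda>t. u ((j + t) / k) - a j))"
    unfolding V_def arg add.assoc by simp
  finally show ?thesis .
qed

lemma V_cmult: "V m (\<lambda>t. b * u t) = b\<^sup>2 * V m u"
  unfolding V_def by (simp add: sum_distrib_left power_mult_distrib flip: right_diff_distrib)

lemma V_diff_le: "V m (\<lambda>t. u t - v t) \<le> 2 * V m u + 2 * V m v"
proof -
  have "(a - b)\<^sup>2 \<le> 2 * a\<^sup>2 + 2 * b\<^sup>2" for a b :: real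
    using zero_le_power2[of "a + b"] by (simp add: power2_eq_square algebra_simps)
  from this[of "u p - u q" "v p - v q" for p q]
  have "((u p - v p) - (u q - v q))\<^sup>2 \<le> 2 * (u p - u q)\<^sup>2 + 2 * (v p - v q)\<^sup>2" for p q
    by (metis add_diff_eq diff_add_eq diff_diff_eq2 diff_diff_add add.commute)
  then show ?thesis
    unfolding V_def sum_distrib_left sum.distrib[symmetric] by (intro sum_mono) blast
qed

end

section \<open>Gluing along the bottom row\<close>

context carpet_form
begin

text \<open>These constraints suffice for gluing with 0 above the row: the bottom sides and the
  outer sides of the first and last cell lie on the boundary of the square and face no other
  cell.\<close>

definition row_admissible :: "(nat \<Rightarrow> pt \<Rightarrow> real) \<Rightarrow> bool" where
  "row_admissible v \<longleftrightarrow> (\<forall>j<k. v j \<in> F \<and> (\<forall>x. 0 \<le> x \<longrightarrow> x \<le> 1 \<longrightarrow> v j (x, 1) = 0)) \<and>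
    (\<forall>j y. Suc j < k \<longrightarrow> 0 \<le> y \<longrightarrow> y \<le> 1 \<longrightarrow> v j (1, y) = v (Suc j) (0, y))"

definition rowglue :: "(nat \<Rightarrow> pt \<Rightarrow> real) \<Rightarrow> pt \<Rightarrow> real" where
  "rowglue v = glue (\<lambda>i. if i \<in> bottom then v (inv_into {..<k} bt i) else (\<lambda>_. 0))"

text \<open>Distinct bottom cells touch only when consecutive, along their common vertical side; a
  cell outside the row touches one only at height 1 in the coordinates of the bottom cell.\<close>

lemma row_admissible_compatible:
  assumes v: "row_admissible v"
  shows "compatible (\<lambda>i. if i \<in> bottom then v (inv_into {..<k} bt i) else (\<lambda>_. 0))"
proof -
  let ?g = "\<lambda>i. if i \<in> bottom then v (inv_into {..<k} bt i) else (\<lambda>_. 0)"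
  have bb: "v j (x, y) = v j' (x', y')"
    if "j < j'" "j' < k" "(x, y) \<in> usq" "(x', y') \<in> usq" "\<Psi> (bt j) (x, y) = \<Psi> (bt j') (x', y')" for j j' x y x' y'
  proof -
    have "j + x = j' + x'" "y = y'" using that(1,2,5) by (auto simp: Psi_frame)
    moreover from this that have "j' = Suc j" "x = 1" "x' = 0" by (auto simp: usq_iff)
    ultimately show ?thesis using v that(2,3) unfolding row_admissible_def usq_iff by auto
  qed
  have bo: "v j (x, y) = 0" if "j < k" "i \<in> {1..N}" "i \<notin> bottom" "(x, y) \<in> usq" "(x', y') \<in> usq"
    "\<Psi> (bt j) (x, y) = \<Psi> i (x', y')" for j i x y x' y'
  proof -
    have "y / k = y' / k + snd (c i)" using that(1,6) by (simp add: Psi_frame Psi_pair[of k c i])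
    then have "1 / k \<le> y / k" using snd_c_not_bottom[OF that(2,3)] that(5) by (simp add: usq_iff add_increasing)
    then have "1 \<le> y" by (simp add: divide_le_cancel)
    then have "y = 1" using that(4) by (simp add: usq_iff)
    then show ?thesis using v that(1,4) by (simp add: row_admissible_def usq_iff)
  qed
  show ?thesis unfolding compatible_def
  proof (intro ballI impI)
    fix i i' p q assume h: "i \<in> {1..N}" "i' \<in> {1..N}" "i \<noteq> i'" "p \<in> K" "q \<in> K" "\<Psi> i p = \<Psi> i' q"
    obtain x y x' y' where pq: "p = (x, y)" "q = (x', y')" by (cases p; cases q) blast
    have u: "(x, y) \<in> usq" "(x', y') \<in> usq" using h(4,5) K_subset_usq pq by auto
    consider j j' where "j < k" "j' < k" "i = bt j" "i' = bt j'" | j where "j < k" "i = bt j" "i' \<notin> bottom"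
      | j where "j < k" "i' = bt j" "i \<notin> bottom" | "i \<notin> bottom" "i' \<notin> bottom"
      unfolding bottom_def by blast
    then show "?g i p = ?g i' q"
    proof cases
      case (1 j j')
      then have "j < j' \<or> j' < j" using h(3) by (metis linorder_neqE_nat)
      then have "v j p = v j' q" using bb[of j j' x y x' y'] bb[of j' j x' y' x y] u 1 h(6) pq by auto
      then show ?thesis using 1 by (simp add: inj_bt)
    next
      case (2 j)
      then show ?thesis using bo[OF 2(1) h(2) 2(3) u] h(6) pq by (simp add: inj_bt)
    next
      case (3 j)
      then show ?thesis using bo[OF 3(1) h(1) 3(3) u(2,1)] h(6) pq by (simp add: inj_bt)
    qed simp
  qed
qed

lemma rowglue_bt: "row_admissible v \<Longrightarrow> j < k \<Longrightarrow> p \<in> K \<Longrightarrow> rowglue v (\<Psi> (bt j) p) = v j p"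
  unfolding rowglue_def by (simp add: glue_apply[OF row_admissible_compatible] inj_bt)

lemma rowglue_other: "row_admissible v \<Longrightarrow> i \<in> {1..N} \<Longrightarrow> i \<notin> bottom \<Longrightarrow> p \<in> K \<Longrightarrow> rowglue v (\<Psi> i p) = 0"
  unfolding rowglue_def by (subst glue_apply[OF row_admissible_compatible]) auto

lemma rowglue_outside: "p \<notin> K \<Longrightarrow> rowglue v p = 0"
  unfolding rowglue_def by (rule glue_outside)

lemma rowglue_F: "row_admissible v \<Longrightarrow> rowglue v \<in> F"
  unfolding rowglue_def
  by (rule glue_F[OF row_admissible_compatible]) (auto simp: F_zero row_admissible_def inj_bt elim!: bottomE)

lemma sub_rowglue: "row_admissible v \<Longrightarrow> j < k \<Longrightarrow> sub (bt j) (rowglue v) = v j"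
  by (rule F_eqI) (auto simp: rowglue_F rowglue_bt row_admissible_def)

lemma sub_rowglue_other: "row_admissible v \<Longrightarrow> i \<in> {1..N} \<Longrightarrow> i \<notin> bottom \<Longrightarrow> sub i (rowglue v) = (\<lambda>_. 0)"
  by (rule F_eqI) (auto simp: sub_F rowglue_F F_zero rowglue_other)

lemma E_split_bottom:
  "f \<in> F \<Longrightarrow> E f = ((\<Sum>j<k. E (sub (bt j) f)) + (\<Sum>i\<in>{1..N} - bottom. E (sub i f))) / r"
  using sum.subset_diff[OF bottom_subset, of "\<lambda>i. E (sub i f)"] E_split[of f]
  by (simp add: sum_bottom add.commute)

lemma E_rowglue: "row_admissible v \<Longrightarrow> E (rowglue v) = (\<Sum>j<k. E (v j)) / r"
  using E_split_bottom[OF rowglue_F, of v] by (simp add: sub_rowglue sub_rowglue_other E_zero)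

lemma rowglue_above:
  fixes y :: real
  assumes "row_admissible v" "0 < k * y - 1"
  shows "rowglue v (x, y) = 0"
proof (cases "(x, y) \<in> K")
  case True
  then obtain i q where iq: "i \<in> {1..N}" "q \<in> K" "(x, y) = \<Psi> i q" by (rule K_cellE)
  have "i \<notin> bottom"
  proof
    assume "i \<in> bottom"
    obtain x' y' where q: "q = (x', y')" by (cases q)
    then have "y = y' / k" using snd_c_bottom[OF \<open>i \<in> bottom\<close>] iq(3) by (simp add: Psi_pair)
    moreover have "y' \<le> 1" using q iq(2) K_subset_usq by (auto simp: usq_iff)
    ultimately show False using assms(2) by simp
  qed
  then show ?thesis using rowglue_other[OF assms(1) iq(1) _ iq(2)] iq(3) by simp
qed (rule rowglue_outside)

lemma rowglue_left:
  fixes y :: real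
  assumes "row_admissible v" "0 \<le> y" "y \<le> 1"
  shows "rowglue v (0, y) = (if k * y \<le> 1 then v 0 (0, k * y) else 0)"
  using rowglue_above[OF assms(1), of y 0] rowglue_bt[OF assms(1), of 0 "(0, k * y)"] assms
  by (auto simp: Psi_frame)

lemma rowglue_right:
  fixes y :: real
  assumes "row_admissible v" "0 \<le> y" "y \<le> 1"
  shows "rowglue v (1, y) = (if k * y \<le> 1 then v (k - 1) (1, k * y) else 0)"
  using rowglue_above[OF assms(1), of y 1] rowglue_bt[OF assms(1), of "k - 1" "(1, k * y)"] assms k3
  by (auto simp: Psi_frame of_nat_diff)

lemma rowglue_top: "row_admissible v \<Longrightarrow> rowglue v (x, 1) = 0"
  using rowglue_above[of v 1 x] k3 by simp

lemma rowglue_bottom: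
  "row_admissible v \<Longrightarrow> j < k \<Longrightarrow> 0 \<le> t \<Longrightarrow> t \<le> 1 \<Longrightarrow> rowglue v ((j + t) / k, 0) = v j (t, 0)"
  using rowglue_bt[of v j "(t, 0)"] by (simp add: Psi_frame)

end

section \<open>Cutoffs and correctors with energy bounded in terms of \<open>k\<close>\<close>

locale carpet_crossing = carpet_form +
  fixes h :: "pt \<Rightarrow> real"
  assumes h_crossing: "h \<in> crossings" and E_h: "E h \<le> 2"
    and h_K: "p \<in> K \<Longrightarrow> 0 \<le> h p \<and> h p \<le> 1"
begin

lemma h_F: "h \<in> F" and h_left: "0 \<le> y \<Longrightarrow> y \<le> 1 \<Longrightarrow> h (0, y) = 0"
  and h_right: "0 \<le> y \<Longrightarrow> y \<le> 1 \<Longrightarrow> h (1, y) = 1"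
  using h_crossing by (auto simp: crossings_def)

lemma h_bounds: "0 \<le> h p" "h p \<le> 1"
  using h_K[of p] F_outside[OF h_F, of p] by (cases "p \<in> K"; simp)+

text \<open>After this rotation \<open>h\<close> is 1 on the bottom side and 0 on the top
  side.\<close>

definition ramp0 :: "pt \<Rightarrow> real" where "ramp0 = sym (\<lambda>(x, y). (1 - y, x)) h"
text \<open>Averaging with the mirror image equalises the two lateral traces, so that copies fit
  side by side in a row.\<close>

definition ramp :: "pt \<Rightarrow> real" where "ramp p = (ramp0 p + sym flipx ramp0 p) / 2"
text \<open>A row of ramps, turned upside down and subtracted from 1, confines the whole descent
  from 1 to 0 to the top row of cells.\<close>

definition cap :: "pt \<Rightarrow> real" where "cap = rst K (\<lambda>p. 1 + (-1) * sym flipy (rowglue (\<lambda>_. ramp)) p)"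
definition cap1 :: "pt \<Rightarrow> real" where "cap1 = rowglue (\<lambda>_. cap)"
text \<open>The minimum with \<open>h\<close> removes the left trace of \<open>cap - cap1\<close>
  and leaves the right one, since \<open>h\<close> is 1 there; on the horizontal sides the
  difference is 0 already.\<close>

definition D :: "pt \<Rightarrow> real" where "D p = min (cap p - cap1 p) (h p)"
definition e0 :: "pt \<Rightarrow> real" where "e0 p = min (cap p) (h p)"

lemma ramp0_F: "ramp0 \<in> F" and E_ramp0: "E ramp0 \<le> 2"
  unfolding ramp0_def using h_F E_h by (simp_all add: sym_F E_sym)

lemma ramp_F: "ramp \<in> F"
proof -
  have "ramp = (\<lambda>p. (ramp0 p + sym flipx ramp0 p) / 2)" by (simp add: ramp_def fun_eq_iff)
  then show ?thesis using F_divide[OF F_add[OF ramp0_F sym_F[OF _ ramp0_F]]] by simp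
qed

lemma E_ramp: "E ramp \<le> 2"
proof -
  have "ramp = (\<lambda>p. (ramp0 p + sym flipx ramp0 p) / 2)" by (simp add: ramp_def fun_eq_iff)
  then have "E ramp = E (\<lambda>p. ramp0 p + sym flipx ramp0 p) / 2\<^sup>2"
    using E_divide[OF F_add[OF ramp0_F sym_F[OF _ ramp0_F]], of flipx 2] by simp
  also have "\<dots> \<le> (2 * E ramp0 + 2 * E ramp0) / 2\<^sup>2"
    using E_add_le[OF ramp0_F sym_F[OF _ ramp0_F], of flipx] E_sym[OF _ ramp0_F, of flipx] by simp
  finally show ?thesis using E_ramp0 by simp
qed

lemma ramp_edges:
  "0 \<le> x \<Longrightarrow> x \<le> 1 \<Longrightarrow> ramp (x, 0) = 1" "0 \<le> x \<Longrightarrow> x \<le> 1 \<Longrightarrow> ramp (x, 1) = 0"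
  "0 \<le> y \<Longrightarrow> y \<le> 1 \<Longrightarrow> ramp (0, y) = ramp (1, y)"
  by (simp_all add: ramp_def ramp0_def h_left h_right)

lemma ramp_bounds: "0 \<le> ramp p" "ramp p \<le> 1"
proof -
  have d: "0 \<le> ramp0 p \<and> ramp0 p \<le> 1" for p
    using h_bounds by (auto simp: ramp0_def sym_def rst_def)
  then have "0 \<le> sym flipx ramp0 p \<and> sym flipx ramp0 p \<le> 1"
    by (auto simp: sym_def rst_def)
  then show "0 \<le> ramp p" "ramp p \<le> 1" using d[of p] by (auto simp: ramp_def)
qed

lemma ramp_admissible: "row_admissible (\<lambda>_. ramp)"
  unfolding row_admissible_def using ramp_F ramp_edges by auto

lemma rowglue_ramp_bounds: "0 \<le> rowglue (\<lambda>_. ramp) p \<and> rowglue (\<lambda>_. ramp) p \<le> 1"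
proof (cases "p \<in> K")
  case True
  then obtain i q where iq: "i \<in> {1..N}" "q \<in> K" "p = \<Psi> i q" by (rule K_cellE)
  show ?thesis
  proof (cases "i \<in> bottom")
    case True
    then show ?thesis using iq(2,3) ramp_bounds[of q] by (auto elim!: bottomE simp: rowglue_bt[OF ramp_admissible])
  next
    case False
    then show ?thesis using iq rowglue_other[OF ramp_admissible] by simp
  qed
qed (simp add: rowglue_outside)

lemma cap_F: "cap \<in> F"
  unfolding cap_def by (intro F_affine sym_F rowglue_F ramp_admissible) simp

text \<open>A row of k equal copies thus costs at most a factor k / r <= k^2 / 2, the origin of the
  powers of \<open>k\<close> in the energy bounds.\<close>

lemma inverse_r: "1 / r \<le> k / 2"
  using rk_ge_2 rpos by (simp add: field_simps)

lemma E_cap: "E cap \<le> (real k)\<^sup>2"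
proof -
  have "E cap = E (rowglue (\<lambda>_. ramp))"
    unfolding cap_def by (subst E_affine) (simp_all add: sym_F E_sym rowglue_F ramp_admissible)
  also have "\<dots> = k * E ramp * (1 / r)" by (simp add: E_rowglue[OF ramp_admissible])
  also have "\<dots> \<le> k * 2 * (k / 2)"
    using E_ramp inverse_r rpos E_nonneg[OF ramp_F] by (intro mult_mono) auto
  finally show ?thesis by (simp add: power2_eq_square)
qed

lemma cap_bounds: "p \<in> K \<Longrightarrow> 0 \<le> cap p" "cap p \<le> 1"
  using rowglue_ramp_bounds by (auto simp: cap_def rst_def)

lemma cap_bottom: "0 \<le> x \<Longrightarrow> x \<le> 1 \<Longrightarrow> cap (x, 0) = 1"
  by (simp add: cap_def rst_def rowglue_top[OF ramp_admissible])

lemma cap_top: "0 \<le> x \<Longrightarrow> x \<le> 1 \<Longrightarrow> cap (x, 1) = 0"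
proof -
  assume x: "0 \<le> x" "x \<le> 1"
  obtain j t where "j < k" "0 \<le> t" "t \<le> 1" "x = (j + t) / k" using edge_coordE[OF x] .
  then show ?thesis using x by (simp add: cap_def rst_def rowglue_bottom[OF ramp_admissible] ramp_edges)
qed

lemma cap_lateral: "0 \<le> y \<Longrightarrow> y \<le> 1 \<Longrightarrow> cap (0, y) = cap (1, y)"
  by (simp add: cap_def rst_def rowglue_left[OF ramp_admissible] rowglue_right[OF ramp_admissible] ramp_edges)

lemma cap_low: "(x, y) \<in> K \<Longrightarrow> y \<le> 1 / 2 \<Longrightarrow> cap (x, y) = 1"
proof -
  assume h: "(x, y) \<in> K" "y \<le> 1 / 2"
  have "real k * (1 / 2) \<le> real k * (1 - y)" using h(2) by (intro mult_left_mono) auto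
  moreover have "real k \<ge> 3" using k3 by simp
  ultimately have "0 < k * (1 - y) - 1" by linarith
  then show ?thesis using h by (simp add: cap_def rst_def rowglue_above[OF ramp_admissible])
qed

lemma cap_bt: "j < k \<Longrightarrow> p \<in> K \<Longrightarrow> cap (\<Psi> (bt j) p) = 1"
proof -
  assume h: "j < k" "p \<in> K"
  obtain x y where p: "p = (x, y)" by (cases p)
  have "y \<le> 1" using h(2) p K_subset_usq by (auto simp: usq_iff)
  then have "y / k \<le> 1 / 2" using k3 by (simp add: field_simps)
  then show ?thesis using cap_low Psi_in_K[OF _ h(2), of "bt j"] h(1) by (simp add: p Psi_frame)
qed

lemma cap_admissible: "row_admissible (\<lambda>_. cap)"
  unfolding row_admissible_def using cap_F cap_top cap_lateral by auto

lemma cap1_F: "cap1 \<in> F"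
  unfolding cap1_def by (rule rowglue_F[OF cap_admissible])

lemma E_cap1: "E cap1 \<le> (real k) ^ 4"
proof -
  have "E cap1 = k * E cap * (1 / r)" unfolding cap1_def by (simp add: E_rowglue[OF cap_admissible])
  also have "\<dots> \<le> k * (real k)\<^sup>2 * (k / 2)"
    using E_cap inverse_r rpos E_nonneg[OF cap_F] by (intro mult_mono) auto
  also have "\<dots> \<le> (real k) ^ 4" by (simp add: power2_eq_square power4_eq_xxxx)
  finally show ?thesis .
qed

text \<open>On the bottom row \<open>cap\<close> is 1, and off it \<open>cap1\<close> is 0. The sign
  makes the minimum in \<open>D\<close> vanish where \<open>h\<close> does.\<close>

lemma cap1_le_cap: "p \<in> K \<Longrightarrow> cap1 p \<le> cap p"
proof -
  assume "p \<in> K"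
  then obtain i q where iq: "i \<in> {1..N}" "q \<in> K" "p = \<Psi> i q" by (rule K_cellE)
  show ?thesis
  proof (cases "i \<in> bottom")
    case True
    then show ?thesis using iq(2,3) cap_bounds[of q] by (auto elim!: bottomE simp: cap1_def rowglue_bt[OF cap_admissible] cap_bt)
  next
    case False
    then show ?thesis using iq cap_bounds(1)[OF \<open>p \<in> K\<close>] rowglue_other[OF cap_admissible] by (simp add: cap1_def)
  qed
qed

lemma D_F: "D \<in> F"
  unfolding D_def[abs_def] by (intro min_in_F F_diff cap_F cap1_F h_F)

lemma k_powers: "(real k)\<^sup>2 \<le> real k ^ 4" "1 \<le> real k ^ 4"
  using k3 by (auto intro!: power_increasing)

lemma E_D: "E D \<le> 6 * real k ^ 4"
proof -
  have "E D \<le> E (\<lambda>p. cap p - cap1 p) + E h"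
    unfolding D_def[abs_def] by (intro E_min F_diff cap_F cap1_F h_F)
  also have "\<dots> \<le> 2 * E cap + 2 * E cap1 + E h" using E_diff_le[OF cap_F cap1_F] by simp
  finally show ?thesis using E_cap E_cap1 E_h k_powers by linarith
qed

lemma D_edges:
  "0 \<le> t \<Longrightarrow> t \<le> 1 \<Longrightarrow> D (t, 0) = 0" "0 \<le> t \<Longrightarrow> t \<le> 1 \<Longrightarrow> D (t, 1) = 0"
  "0 \<le> t \<Longrightarrow> t \<le> 1 \<Longrightarrow> D (0, t) = 0"
  "0 \<le> t \<Longrightarrow> t \<le> 1 \<Longrightarrow> D (1, t) = cap (1, t) - cap1 (1, t)"
proof -
  assume t: "0 \<le> t" "t \<le> 1"
  obtain j s where "j < k" "0 \<le> s" "s \<le> 1" "t = (j + s) / k" using edge_coordE[OF t] .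
  then have "cap1 (t, 0) = 1" by (simp add: cap1_def rowglue_bottom[OF cap_admissible] cap_bottom)
  then show "D (t, 0) = 0" using t h_bounds by (simp add: D_def cap_bottom)
  have "cap1 (t, 1) = 0" by (simp add: cap1_def rowglue_top[OF cap_admissible])
  then show "D (t, 1) = 0" using t h_bounds by (simp add: D_def cap_top)
  show "D (0, t) = 0" using cap1_le_cap[of "(0, t)"] t by (simp add: D_def h_left)
  have "0 \<le> cap1 (1, t)" using t cap_bounds by (simp add: cap1_def rowglue_right[OF cap_admissible])
  then show "D (1, t) = cap (1, t) - cap1 (1, t)" using cap_bounds(2)[of "(1, t)"] t by (simp add: D_def h_right)
qed

text \<open>On the bottom row of each bottom cell both \<open>cap\<close> and \<open>cap1\<close>
  are 1, and \<open>h\<close> is nonnegative.\<close>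

lemma D_deep: "j < k \<Longrightarrow> i < k \<Longrightarrow> p \<in> K \<Longrightarrow> D (\<Psi> (bt j) (\<Psi> (bt i) p)) = 0"
  using h_bounds by (simp add: D_def cap1_def rowglue_bt[OF cap_admissible] cap_bt Psi_in_K)

lemma e0_F: "e0 \<in> F"
  unfolding e0_def[abs_def] by (intro min_in_F cap_F h_F)

lemma E_e0: "E e0 \<le> 6 * real k ^ 4"
  using E_min[OF cap_F h_F] E_cap E_h k_powers unfolding e0_def[abs_def] by linarith

lemma e0_edges:
  "0 \<le> t \<Longrightarrow> t \<le> 1 \<Longrightarrow> e0 (t, 1) = 0" "0 \<le> t \<Longrightarrow> t \<le> 1 \<Longrightarrow> e0 (0, t) = 0"
  "0 \<le> t \<Longrightarrow> t \<le> 1 \<Longrightarrow> e0 (1, t) = cap (1, t)"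
  using cap_bounds h_bounds by (auto simp: e0_def cap_top h_left h_right)

section \<open>The multiscale extension operator\<close>

definition seg :: "(real \<Rightarrow> real) \<Rightarrow> nat \<Rightarrow> real \<Rightarrow> real" where
  "seg u j t = u ((j + t) / k) - u (j / k)"

lemma seg_0: "seg u j 0 = 0" by (simp add: seg_def)

text \<open>Every \<open>S n u\<close> has lateral traces 0 and \<open>u 1 * cap\<close>. The bottom row alone would give the
  trace \<open>u 1 * cap1\<close> on the right side; \<open>D\<close> supplies the difference.\<close>

primrec S :: "nat \<Rightarrow> (real \<Rightarrow> real) \<Rightarrow> pt \<Rightarrow> real" where
  "S 0 u = (\<lambda>p. u 1 * e0 p)"
| "S (Suc n) u = (\<lambda>p. rowglue (\<lambda>j p. u (j / k) * cap p + S n (seg u j) p) p + u 1 * D p)"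

lemma S_properties:
  assumes "u 0 = 0"
  shows "S n u \<in> F" and "0 \<le> t \<Longrightarrow> t \<le> 1 \<Longrightarrow> S n u (t, 1) = 0"
    and "0 \<le> t \<Longrightarrow> t \<le> 1 \<Longrightarrow> S n u (0, t) = 0"
    and "0 \<le> t \<Longrightarrow> t \<le> 1 \<Longrightarrow> S n u (1, t) = u 1 * cap (1, t)"
    and S_admissible: "row_admissible (\<lambda>j p. u (j / k) * cap p + S n (seg u j) p)"
proof -
  \<comment> \<open>At a common side the left cell carries (u(j/k) + (u((j+1)/k) - u(j/k))) cap and
    the right cell u((j+1)/k) cap; these agree because \<open>cap\<close> has equal lateral
    traces.\<close>
  have *: "row_admissible (\<lambda>j p. u (j / k) * cap p + S n (seg u j) p)"
    if "\<And>j. S n (seg u j) \<in> F \<and> (\<forall>t. 0 \<le> t \<longrightarrow> t \<le> 1 \<longrightarrow> S n (seg u j) (t, 1) = 0 \<and>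
      S n (seg u j) (0, t) = 0 \<and> S n (seg u j) (1, t) = seg u j 1 * cap (1, t))" for n u
    unfolding row_admissible_def using that cap_F
    by (auto simp: cap_top cap_lateral seg_def F_add F_scale algebra_simps add.commute)
  have "S n u \<in> F \<and> (\<forall>t. 0 \<le> t \<longrightarrow> t \<le> 1 \<longrightarrow> S n u (t, 1) = 0 \<and> S n u (0, t) = 0 \<and>
      S n u (1, t) = u 1 * cap (1, t))" if "u 0 = 0" for n u
    using that
  proof (induction n arbitrary: u)
    case 0
    then show ?case by (simp add: e0_F F_scale e0_edges)
  next
    case (Suc n)
    have adm: "row_admissible (\<lambda>j p. u (j / k) * cap p + S n (seg u j) p)"
      by (rule *, rule Suc.IH, rule seg_0)
    have last: "(real (k - 1) + 1) / k = 1" using k3 by (simp add: of_nat_diff)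
    show ?case
    proof (intro conjI allI impI)
      show "S (Suc n) u \<in> F" by (simp add: F_add F_scale D_F rowglue_F adm)
      fix t :: real assume t: "0 \<le> t" "t \<le> 1"
      show "S (Suc n) u (t, 1) = 0" using t by (simp add: rowglue_top[OF adm] D_edges)
      show "S (Suc n) u (0, t) = 0"
        using t Suc.IH[of "seg u 0", OF seg_0] Suc.prems by (simp add: rowglue_left[OF adm] D_edges)
      have right_edge: "S n (seg u j) (1, s) = seg u j 1 * cap (1, s)" if "0 \<le> s" "s \<le> 1" for j s
        using Suc.IH[of "seg u j", OF seg_0] that by blast
      have s1: "seg u (k - 1) 1 = u 1 - u (real (k - 1) / k)" unfolding seg_def last ..
      \<comment> \<open>Up to height 1/k the row supplies \<open>u 1 * cap (1, k * t)\<close> and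
        \<open>D\<close> the rest; above that height the row and \<open>cap1\<close> vanish and
        \<open>D\<close> supplies everything.\<close>
      show "S (Suc n) u (1, t) = u 1 * cap (1, t)"
      proof (cases "k * t \<le> 1")
        case True
        have "S (Suc n) u (1, t) = u (real (k - 1) / k) * cap (1, k * t) + S n (seg u (k - 1)) (1, k * t)
          + u 1 * (cap (1, t) - cap (1, k * t))"
          unfolding S.simps rowglue_right[OF adm t] D_edges(4)[OF t] cap1_def
            rowglue_right[OF cap_admissible t] if_P[OF True] ..
        also have "S n (seg u (k - 1)) (1, k * t) = seg u (k - 1) 1 * cap (1, k * t)"
          using t True by (intro right_edge) auto
        finally show ?thesis unfolding s1 by (simp add: ring_distribs)
      next
        case False
        then show ?thesis unfolding S.simps rowglue_right[OF adm t] D_edges(4)[OF t] cap1_def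
            rowglue_right[OF cap_admissible t] if_not_P[OF False] by simp
      qed
    qed
  qed
  note P = this
  show "S n u \<in> F" "0 \<le> t \<Longrightarrow> t \<le> 1 \<Longrightarrow> S n u (t, 1) = 0"
    "0 \<le> t \<Longrightarrow> t \<le> 1 \<Longrightarrow> S n u (0, t) = 0"
    "0 \<le> t \<Longrightarrow> t \<le> 1 \<Longrightarrow> S n u (1, t) = u 1 * cap (1, t)"
    using P[of u n, OF assms] by auto
  show "row_admissible (\<lambda>j p. u (j / k) * cap p + S n (seg u j) p)"
    by (rule *, rule P, rule seg_0)
qed

text \<open>\<open>D\<close> vanishes on the bottom side, so the value at a node is the base value
  of its block plus the increment interpolated one level lower.\<close>

lemma S_nodes: "u 0 = 0 \<Longrightarrow> (l :: nat) \<le> k ^ n \<Longrightarrow> S n u (l / real k ^ n, 0) = u (l / real k ^ n)"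
proof (induction n arbitrary: u l)
  case 0
  then have "l = 0 \<or> l = 1" by auto
  then show ?case using 0 S_properties(3)[of u 0 0] S_properties(4)[of u 0 0] cap_bottom[of 1] by auto
next
  case (Suc n)
  obtain j l' where jl: "j < k" "l' \<le> k ^ n" "l = j * k ^ n + l'" using node_split[OF Suc.prems(2)] .
  let ?x = "l / real k ^ Suc n"
  have x: "?x = (j + l' / real k ^ n) / k" using jl(3) by (simp add: field_simps)
  have t: "0 \<le> l' / real k ^ n" "l' / real k ^ n \<le> 1"
    using jl(2) by (auto simp: divide_le_eq simp flip: of_nat_power)
  have x01: "0 \<le> ?x" "?x \<le> 1" using Suc.prems(2) by (auto simp: divide_le_eq simp flip: of_nat_power of_nat_mult)
  have "rowglue (\<lambda>j p. u (j / k) * cap p + S n (seg u j) p) (?x, 0) = u (j / k) + seg u j (l' / real k ^ n)"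
    unfolding x using rowglue_bottom[OF S_admissible[where u = u and n = n, OF Suc.prems(1)] jl(1) t] Suc.IH[of "seg u j", OF seg_0 jl(2)] cap_bottom[OF t]
    by simp
  then show ?case using D_edges(1)[OF x01] x by (simp add: seg_def)
qed

end

context carpet_form
begin

text \<open>The summand of the squared Besov seminorm at level m, in the form its weight takes for
  \<open>sigma_r\<close>.\<close>

definition W :: "nat \<Rightarrow> (real \<Rightarrow> real) \<Rightarrow> real" where "W m u = V m u / r ^ m"

lemma W_nonneg: "0 \<le> W m u"
  using rpos by (simp add: W_def V_nonneg)

lemma W_0: "W 0 u = (u 0 - u 1)\<^sup>2"
  by (simp add: W_def V_0)

lemma W_Suc: "W (Suc m) u = (\<Sum>j<k. W m (\<lambda>t. u ((j + t) / k) - a j)) / r"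
  using V_Suc[of m u a] by (simp add: W_def sum_divide_distrib mult.commute)

lemma W_cmult: "W m (\<lambda>t. b * u t) = b\<^sup>2 * W m u"
  by (simp add: W_def V_cmult)

lemma W_diff_le: "W m (\<lambda>t. u t - v t) \<le> 2 * W m u + 2 * W m v"
  using V_diff_le[of m u v] rpos by (simp add: W_def field_simps)

lemma W_affine: "W m (\<lambda>t. a + b * t) = b\<^sup>2 * W m (\<lambda>t. t)"
  unfolding W_cmult[symmetric] by (simp add: W_def V_def)

lemma W_id: "W m (\<lambda>t. t) = (1 / (r * k)) ^ m"
proof -
  have "V m (\<lambda>t. t) = (\<Sum>l<k ^ m. (1 / real k ^ m)\<^sup>2)"
    unfolding V_def by (intro sum.cong refl) (simp add: power2_eq_iff diff_divide_distrib[symmetric])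
  also have "\<dots> = (1 / real k) ^ m" by (simp add: power2_eq_square power_divide)
  finally show ?thesis by (simp add: W_def power_divide power_mult_distrib)
qed

text \<open>The ratio 1 / (r k) <= 1/2 of this geometric series bounds the seminorm of linear data
  independently of the form.\<close>

lemma W_id_sums: "summable (\<lambda>m. W m (\<lambda>t. t))" "(\<Sum>m. W m (\<lambda>t. t)) \<le> 2"
proof -
  have q: "0 \<le> 1 / (r * k)" "1 / (r * k) \<le> 1 / 2" using rk_ge_2 rpos by (auto simp: field_simps)
  show "summable (\<lambda>m. W m (\<lambda>t. t))" unfolding W_id by (rule summable_geometric) (use q in simp)
  have "(\<Sum>m. W m (\<lambda>t. t)) = 1 / (1 - 1 / (r * k))" unfolding W_id by (rule suminf_geometric) (use q in simp)
  also have "\<dots> \<le> 1 / (1 / 2)" using q by (intro divide_left_mono) auto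
  finally show "(\<Sum>m. W m (\<lambda>t. t)) \<le> 2" by simp
qed

end

context carpet_crossing
begin

lemma W_seg: "W (Suc m) u = (\<Sum>j<k. W m (seg u j)) / r"
  unfolding seg_def[abs_def] by (rule W_Suc)

lemma sub_S:
  assumes "u 0 = 0"
  shows "j < k \<Longrightarrow> p \<in> K \<Longrightarrow> S (Suc n) u (\<Psi> (bt j) p) = u (j / k) * cap p + S n (seg u j) p + u 1 * D (\<Psi> (bt j) p)"
    and "i \<in> {1..N} \<Longrightarrow> i \<notin> bottom \<Longrightarrow> p \<in> K \<Longrightarrow> S (Suc n) u (\<Psi> i p) = u 1 * D (\<Psi> i p)"
  using rowglue_bt[OF S_admissible[where u = u and n = n, OF assms]]
    rowglue_other[OF S_admissible[where u = u and n = n, OF assms]] by auto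

lemma E_sub_cmult: "f \<in> F \<Longrightarrow> i \<in> {1..N} \<Longrightarrow> E (\<lambda>p. a * sub i f p) = a\<^sup>2 * E (sub i f)"
  by (rule E_scale) (rule sub_F)

text \<open>Off the bottom row only one corrector is visible, a multiple of \<open>D\<close>, or of
  \<open>e0\<close> when n = 0, so the bound does not grow with n.\<close>

lemma S_off_bottom:
  assumes "u 0 = 0"
  shows "(\<Sum>i\<in>{1..N} - bottom. E (sub i (S n u))) \<le> r * ((u 1)\<^sup>2 * (6 * real k ^ 4))"
proof (cases n)
  case 0
  have "(\<Sum>i\<in>{1..N} - bottom. E (sub i (S n u))) \<le> r * E (S n u)"
    by (rule E_sub_sum[OF S_properties(1)[where u = u, OF assms]]) auto
  also have "E (S n u) = (u 1)\<^sup>2 * E e0" using 0 E_scale[OF e0_F] by simp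
  finally show ?thesis using E_e0 rpos by (smt (verit) mult_left_mono zero_le_power2)
next
  case (Suc m)
  have "sub i (S n u) = (\<lambda>p. u 1 * sub i D p)" if "i \<in> {1..N} - bottom" for i
    by (rule F_eqI) (use that S_properties(1)[where u = u, OF assms] D_F sub_S(2)[where u = u and i = i and n = m, OF assms] Suc in \<open>auto intro!: F_scale sub_F simp del: S.simps\<close>)
  then have "(\<Sum>i\<in>{1..N} - bottom. E (sub i (S n u))) = (\<Sum>i\<in>{1..N} - bottom. (u 1)\<^sup>2 * E (sub i D))"
    by (intro sum.cong refl) (auto simp: E_sub_cmult[OF D_F])
  also have "\<dots> = (u 1)\<^sup>2 * (\<Sum>i\<in>{1..N} - bottom. E (sub i D))" by (simp add: sum_distrib_left)
  also have "\<dots> \<le> (u 1)\<^sup>2 * (r * E D)" by (intro mult_left_mono E_sub_sum D_F) auto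
  also have "\<dots> \<le> (u 1)\<^sup>2 * (r * (6 * real k ^ 4))" using E_D rpos by (intro mult_left_mono) auto
  finally show ?thesis by (simp add: algebra_simps)
qed

text \<open>The two summands overlap only off the bottom row, since the first one is constant on it.\<close>

lemma E_layer:
  assumes f: "f \<in> F" and v: "v \<in> F" and const: "\<And>j p. j < k \<Longrightarrow> p \<in> K \<Longrightarrow> f (\<Psi> (bt j) p) = a"
  shows "E (\<lambda>p. f p + v p) \<le> 2 * E f + E v + (\<Sum>i\<in>{1..N} - bottom. E (sub i v)) / r"
proof -
  let ?O = "{1..N} - bottom"
  have fv: "(\<lambda>p. f p + v p) \<in> F" using f v by (rule F_add)
  have s: "sub i (\<lambda>p. f p + v p) = (\<lambda>p. sub i f p + sub i v p)" if "i \<in> {1..N}" for i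
    by (rule F_eqI) (use that f v fv in \<open>auto intro!: F_add sub_F\<close>)
  have b: "E (sub (bt j) (\<lambda>p. f p + v p)) = E (sub (bt j) v)" if "j < k" for j
    by (rule E_cong_diff_const[of _ _ a]) (use that f v fv const in auto)
  have "(\<Sum>i\<in>?O. E (sub i (\<lambda>p. f p + v p))) \<le> (\<Sum>i\<in>?O. 2 * E (sub i f) + 2 * E (sub i v))"
  proof (rule sum_mono)
    fix i assume "i \<in> ?O"
    then show "E (sub i (\<lambda>p. f p + v p)) \<le> 2 * E (sub i f) + 2 * E (sub i v)"
      using E_add_le[OF sub_F[OF f] sub_F[OF v], of i i] s[of i] by auto
  qed
  also have "\<dots> = 2 * (\<Sum>i\<in>?O. E (sub i f)) + 2 * (\<Sum>i\<in>?O. E (sub i v))"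
    by (simp add: sum.distrib sum_distrib_left)
  also have "(\<Sum>i\<in>?O. E (sub i f)) \<le> r * E f" by (rule E_sub_sum[OF f]) auto
  finally have "(\<Sum>j<k. E (sub (bt j) (\<lambda>p. f p + v p))) + (\<Sum>i\<in>?O. E (sub i (\<lambda>p. f p + v p))) \<le>
    (\<Sum>j<k. E (sub (bt j) v)) + (2 * (r * E f) + 2 * (\<Sum>i\<in>?O. E (sub i v)))"
    using b by simp
  then have "E (\<lambda>p. f p + v p) \<le> ((\<Sum>j<k. E (sub (bt j) v)) + (2 * (r * E f) + 2 * (\<Sum>i\<in>?O. E (sub i v)))) / r"
    unfolding E_split_bottom[OF fv] using rpos by (intro divide_right_mono) auto
  also have "\<dots> = 2 * E f + E v + (\<Sum>i\<in>?O. E (sub i v)) / r"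
    unfolding E_split_bottom[OF v] using rpos by (simp add: field_simps)
  finally show ?thesis .
qed

text \<open>On cell j, \<open>P j\<close> collects what the current scale contributes. It is
  constant on the bottom row of that cell, so \<open>E_layer\<close> adds the finer extension with
  coefficient 1; a larger coefficient would compound over the scales.\<close>

lemma S_energy_step:
  assumes u0: "u 0 = 0"
  shows "E (S (Suc n) u) \<le> 24 * real k ^ 4 * W 0 u + 10 * real k ^ 4 * W 1 u + (\<Sum>j<k. E (S n (seg u j))) / r"
proof -
  let ?O = "{1..N} - bottom"
  define P where "P j p = u (j / k) * cap p + u 1 * sub (bt j) D p" for j p
  define v where "v j = S n (seg u j)" for j
  have PF: "P j \<in> F" if "j < k" for j
    unfolding P_def[abs_def] using that by (intro F_add F_scale cap_F sub_frame_F D_F)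
  have vF: "v j \<in> F" for j unfolding v_def by (rule S_properties(1)[where u = "seg u j", OF seg_0])
  have SF: "S (Suc n) u \<in> F" by (rule S_properties(1)[where u = u, OF u0])
  have c4: "0 \<le> real k ^ 4" by simp
  have EP: "E (P j) \<le> 2 * ((u (j / k))\<^sup>2 * (real k)\<^sup>2) + 2 * ((u 1)\<^sup>2 * E (sub (bt j) D))" if "j < k" for j
  proof -
    have "E (P j) \<le> 2 * E (\<lambda>p. u (j / k) * cap p) + 2 * E (\<lambda>p. u 1 * sub (bt j) D p)"
      unfolding P_def[abs_def] using that by (intro E_add_le F_scale cap_F sub_frame_F D_F)
    moreover have "E (\<lambda>p. u (j / k) * cap p) \<le> (u (j / k))\<^sup>2 * (real k)\<^sup>2"
      unfolding E_scale[OF cap_F] by (rule mult_left_mono[OF E_cap]) simp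
    ultimately show ?thesis using E_sub_cmult[OF D_F, of "bt j" "u 1"] that by simp
  qed
  have Es: "E (sub (bt j) (S (Suc n) u)) \<le> 4 * ((u (j / k))\<^sup>2 * (real k)\<^sup>2) + 4 * ((u 1)\<^sup>2 * E (sub (bt j) D))
      + E (v j) + (seg u j 1)\<^sup>2 * (6 * real k ^ 4)" if j: "j < k" for j
  proof -
    have e: "sub (bt j) (S (Suc n) u) = (\<lambda>p. P j p + v j p)"
      by (rule F_eqI[OF sub_frame_F(1)[OF SF j] F_add[OF PF[OF j] vF]])
        (use j sub_S(1)[where u = u and n = n, OF u0 j] in \<open>simp add: P_def v_def del: S.simps\<close>)
    have "E (sub (bt j) (S (Suc n) u)) \<le> 2 * E (P j) + E (v j) + (\<Sum>i\<in>?O. E (sub i (v j))) / r"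
      unfolding e by (rule E_layer[OF PF[OF j] vF, where a = "u (j / k)"]) (use j in \<open>simp add: P_def cap_bt D_deep Psi_in_K\<close>)
    also have "(\<Sum>i\<in>?O. E (sub i (v j))) / r \<le> (seg u j 1)\<^sup>2 * (6 * real k ^ 4)"
      using S_off_bottom[where u = "seg u j" and n = n, OF seg_0] rpos unfolding v_def by (simp add: field_simps)
    finally show ?thesis using EP[OF j] by linarith
  qed
  have Eo: "E (sub i (S (Suc n) u)) = (u 1)\<^sup>2 * E (sub i D)" if i: "i \<in> ?O" for i
  proof -
    have "sub i (S (Suc n) u) = (\<lambda>p. u 1 * sub i D p)"
      by (rule F_eqI) (use i SF D_F sub_S(2)[where u = u and i = i and n = n, OF u0] in \<open>auto intro!: F_scale sub_F simp del: S.simps\<close>)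
    then show ?thesis using E_sub_cmult[OF D_F] i by auto
  qed
  have W1: "(\<Sum>j<k. (seg u j 1)\<^sup>2) = r * W 1 u"
    using W_seg[of 0 u] rpos by (simp add: W_0 seg_0)
  \<comment> \<open>Since u(0) = 0, u(j/k) is the sum of the first j increments, and Cauchy-Schwarz
    bounds it by \<open>W 1 u\<close>.\<close>
  have u_sum: "u (j / k) = (\<Sum>i<j. seg u i 1)" if "j \<le> k" for j
    using that by (induction j) (auto simp: u0 seg_def add.commute)
  have u_le: "(u (j / k))\<^sup>2 \<le> k * (r * W 1 u)" if "j < k" for j
  proof -
    have "(u (j / k))\<^sup>2 \<le> j * (\<Sum>i<j. (seg u i 1)\<^sup>2)"
      using sum_squared_le_sum_of_squares[of "\<lambda>i. seg u i 1" "{..<j}"] that u_sum[of j] by (simp add: mult.commute)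
    also have "\<dots> \<le> k * (\<Sum>i<k. (seg u i 1)\<^sup>2)"
      using that by (intro mult_mono sum_mono2 sum_nonneg) auto
    finally show ?thesis using W1 by simp
  qed
  have sum_u: "(\<Sum>j<k. (u (j / k))\<^sup>2 * (real k)\<^sup>2) \<le> real k ^ 4 * (r * W 1 u)"
  proof -
    have "(\<Sum>j<k. (u (j / k))\<^sup>2 * (real k)\<^sup>2) \<le> (\<Sum>j<k. k * (r * W 1 u) * (real k)\<^sup>2)"
      using u_le by (intro sum_mono mult_right_mono) auto
    also have "\<dots> = real k ^ 4 * (r * W 1 u)" by (simp add: power4_eq_xxxx power2_eq_square)
    finally show ?thesis .
  qed
  have W0: "(u 1)\<^sup>2 = W 0 u" using u0 by (simp add: W_0)
  have D_sum: "(\<Sum>j<k. E (sub (bt j) D)) + (\<Sum>i\<in>?O. E (sub i D)) = r * E D"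
    using E_split_bottom[OF D_F] rpos by simp
  have D_nonneg: "0 \<le> (\<Sum>i\<in>?O. E (sub i D))"
    by (intro sum_nonneg E_nonneg sub_F D_F) auto
  have UD: "(u 1)\<^sup>2 * (r * E D) = (u 1)\<^sup>2 * (\<Sum>j<k. E (sub (bt j) D)) + (u 1)\<^sup>2 * (\<Sum>i\<in>?O. E (sub i D))"
    "0 \<le> (u 1)\<^sup>2 * (\<Sum>i\<in>?O. E (sub i D))"
    unfolding D_sum[symmetric] using D_nonneg by (auto simp: ring_distribs)
  have rE: "r * E (S (Suc n) u) = (\<Sum>j<k. E (sub (bt j) (S (Suc n) u))) + (\<Sum>i\<in>?O. E (sub i (S (Suc n) u)))"
    unfolding E_split_bottom[OF SF] using rpos by simp
  have O: "(\<Sum>i\<in>?O. E (sub i (S (Suc n) u))) = (u 1)\<^sup>2 * (\<Sum>i\<in>?O. E (sub i D))"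
    using Eo by (simp add: sum_distrib_left)
  have "(\<Sum>j<k. E (sub (bt j) (S (Suc n) u))) \<le> (\<Sum>j<k. 4 * ((u (j / k))\<^sup>2 * (real k)\<^sup>2) + 4 * ((u 1)\<^sup>2 * E (sub (bt j) D))
      + E (v j) + (seg u j 1)\<^sup>2 * (6 * real k ^ 4))"
    using Es by (intro sum_mono) auto
  also have "\<dots> = 4 * (\<Sum>j<k. (u (j / k))\<^sup>2 * (real k)\<^sup>2) + 4 * ((u 1)\<^sup>2 * (\<Sum>j<k. E (sub (bt j) D)))
      + (\<Sum>j<k. E (v j)) + (\<Sum>j<k. (seg u j 1)\<^sup>2) * (6 * real k ^ 4)"
    by (simp add: sum.distrib sum_distrib_left sum_distrib_right)
  finally have B: "(\<Sum>j<k. E (sub (bt j) (S (Suc n) u))) \<le> \<dots>" .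
  have U: "(u 1)\<^sup>2 * (r * E D) \<le> W 0 u * (r * (6 * real k ^ 4))"
    unfolding W0 using E_D rpos W_nonneg by (intro mult_left_mono) auto
  \<comment> \<open>The coefficients become 4 * 6 = 24 for \<open>W 0\<close> and 4 + 6 = 10 for
    \<open>W 1\<close>, where the last 6 is the overlap term of \<open>E_layer\<close>.\<close>
  have "r * E (S (Suc n) u) \<le> 4 * (real k ^ 4 * (r * W 1 u)) + 4 * (W 0 u * (r * (6 * real k ^ 4)))
      + (\<Sum>j<k. E (v j)) + r * W 1 u * (6 * real k ^ 4)"
    using rE O B[unfolded W1] sum_u UD U by linarith
  then have "r * E (S (Suc n) u) \<le> r * (24 * real k ^ 4 * W 0 u + 10 * real k ^ 4 * W 1 u) + (\<Sum>j<k. E (v j))"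
    by (simp only: algebra_simps)
  moreover have "x \<le> a + s / r" if "r * x \<le> r * a + s" for x a s
    using that rpos by (simp add: field_simps)
  ultimately show ?thesis unfolding v_def by blast
qed

text \<open>Each scale from 1 on is charged 10 as level 1 of one step and 24 as level 0 of the next,
  hence 34.\<close>

lemma S_energy:
  "u 0 = 0 \<Longrightarrow> E (S n u) \<le> 24 * real k ^ 4 * W 0 u + 34 * real k ^ 4 * (\<Sum>m<n. W (Suc m) u)"
proof (induction n arbitrary: u)
  case 0
  have "E (S 0 u) = W 0 u * E e0" using 0 E_scale[OF e0_F] by (simp add: W_0)
  also have "\<dots> \<le> W 0 u * (24 * real k ^ 4)"
    using E_e0 W_nonneg k_powers(2) by (intro mult_left_mono) linarith+
  finally show ?case by (simp add: mult.commute)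
next
  case (Suc n)
  have "(\<Sum>j<k. E (S n (seg u j))) \<le>
    (\<Sum>j<k. 24 * real k ^ 4 * W 0 (seg u j) + 34 * real k ^ 4 * (\<Sum>m<n. W (Suc m) (seg u j)))"
    by (intro sum_mono Suc.IH seg_0)
  also have "\<dots> = 24 * real k ^ 4 * (\<Sum>j<k. W 0 (seg u j)) + 34 * real k ^ 4 * (\<Sum>m<n. \<Sum>j<k. W (Suc m) (seg u j))"
    by (simp add: sum.distrib sum_distrib_left sum.swap[of _ "{..<n}" "{..<k}"])
  finally have "(\<Sum>j<k. E (S n (seg u j))) / r \<le> \<dots> / r" using rpos by (simp add: divide_right_mono)
  also have "\<dots> = 24 * real k ^ 4 * W 1 u + 34 * real k ^ 4 * (\<Sum>m<n. W (Suc (Suc m)) u)"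
    unfolding W_seg[of "Suc m" for m] One_nat_def W_seg[of 0]
    by (simp add: add_divide_distrib flip: sum_divide_distrib)
  finally show ?case using S_energy_step[where u = u and n = n, OF Suc.prems] sum.lessThan_Suc_shift[of "\<lambda>m. W (Suc m) u" n]
    by (simp add: algebra_simps)
qed

corollary S_energy': "u 0 = 0 \<Longrightarrow> E (S n u) \<le> 34 * real k ^ 4 * (\<Sum>m\<le>n. W m u)"
proof -
  assume "u 0 = 0"
  then have "E (S n u) \<le> 24 * real k ^ 4 * W 0 u + 34 * real k ^ 4 * (\<Sum>m<n. W (Suc m) u)" by (rule S_energy)
  also have "\<dots> \<le> 34 * real k ^ 4 * W 0 u + 34 * real k ^ 4 * (\<Sum>m<n. W (Suc m) u)"
    using W_nonneg[of 0 u] by (intro add_right_mono mult_right_mono) auto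
  also have "\<dots> = 34 * real k ^ 4 * (\<Sum>m\<le>n. W m u)"
    by (simp add: sum.atMost_shift ring_distribs)
  finally show ?thesis .
qed

text \<open>Coarse terms cancel in the difference, which therefore lives on the bottom row and is
  again such a difference one level down. At n = 0 the energy bounds give 2 * 34 + 2 * 34 =
  136.\<close>

lemma S_increment:
  "u 0 = 0 \<Longrightarrow> E (\<lambda>p. S (n + d) u p - S n u p) \<le> 136 * real k ^ 4 * (\<Sum>m=n..n+d. W m u)"
proof (induction n arbitrary: u)
  case 0
  have F: "S m u \<in> F" for m using S_properties(1)[where u = u, OF 0] .
  have "W 0 u \<le> (\<Sum>m\<le>d. W m u)" by (rule member_le_sum) (auto simp: W_nonneg)
  then have "34 * real k ^ 4 * W 0 u \<le> 34 * real k ^ 4 * (\<Sum>m\<le>d. W m u)" by (intro mult_left_mono) auto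
  moreover have "E (S 0 u) \<le> 34 * real k ^ 4 * W 0 u" using S_energy'[where u = u and n = 0, OF 0] by simp
  moreover have "E (\<lambda>p. S d u p - S 0 u p) \<le> 2 * E (S d u) + 2 * E (S 0 u)" by (rule E_diff_le[OF F F])
  ultimately have "E (\<lambda>p. S d u p - S 0 u p) \<le> 136 * real k ^ 4 * (\<Sum>m\<le>d. W m u)"
    using S_energy'[where u = u and n = d, OF 0] by linarith
  then show ?case by (simp add: atLeast0AtMost del: S.simps)
next
  case (Suc n)
  have F: "S m u \<in> F" for m using S_properties(1)[where u = u, OF Suc.prems] .
  let ?d = "\<lambda>p. S (Suc (n + d)) u p - S (Suc n) u p"
  have dF: "?d \<in> F" by (rule F_diff[OF F F])
  have b: "sub (bt j) ?d = (\<lambda>p. S (n + d) (seg u j) p - S n (seg u j) p)" if "j < k" for j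
    by (rule F_eqI)
      (use that dF sub_S(1)[where u = u, OF Suc.prems that] S_properties(1)[of "seg u j", OF seg_0] in \<open>auto intro!: F_diff simp del: S.simps\<close>)
  have o: "sub i ?d = (\<lambda>_. 0)" if "i \<in> {1..N} - bottom" for i
    by (rule F_eqI) (use that dF sub_S(2)[where u = u and i = i, OF Suc.prems] in \<open>auto intro!: sub_F simp: F_zero simp del: S.simps\<close>)
  have "E ?d = (\<Sum>j<k. E (\<lambda>p. S (n + d) (seg u j) p - S n (seg u j) p)) / r"
    unfolding E_split_bottom[OF dF] using b o by (simp add: E_zero)
  also have "\<dots> \<le> (\<Sum>j<k. 136 * real k ^ 4 * (\<Sum>m=n..n+d. W m (seg u j))) / r"
    using rpos by (intro divide_right_mono sum_mono Suc.IH seg_0) auto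
  also have "\<dots> = 136 * real k ^ 4 * (\<Sum>m=n..n+d. (\<Sum>j<k. W m (seg u j)) / r)"
    by (simp add: sum.swap[of _ "{n..n+d}" "{..<k}"] flip: sum_distrib_left sum_divide_distrib)
  also have "\<dots> = 136 * real k ^ 4 * (\<Sum>m=Suc n..Suc n+d. W m u)"
    unfolding W_seg[symmetric] using sum.shift_bounds_cl_Suc_ivl[of "\<lambda>m. W m u" n "n + d"] by simp
  finally show ?case by simp
qed

lemma edge_extension:
  assumes u0: "u 0 = 0" and cont: "continuous_on {0..1} u" and sm: "summable (\<lambda>m. W m u)"
  obtains s where "s \<in> F" "\<And>t. 0 \<le> t \<Longrightarrow> t \<le> 1 \<Longrightarrow> s (t, 0) = u t \<and> s (t, 1) = 0 \<and> s (0, t) = 0 \<and> s (1, t) = u 1 * cap (1, t)"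
    "E s \<le> 68 * real k ^ 4 * (\<Sum>m. W m u)"
proof -
  let ?C = "136 * real k ^ 4"
  have C: "?C > 0" by simp
  have SF: "S n u \<in> F" for n by (rule S_properties(1)[where u = u, OF u0])
  have tail: "\<exists>M. \<forall>m\<ge>M. \<forall>n\<ge>M. E (\<lambda>x. S m u x - S n u x) < e" if "e > 0" for e
  proof -
    have "e / ?C > 0" using that C by (simp del: times_divide_eq_left)
    then obtain M where M: "\<And>m n. m \<ge> M \<Longrightarrow> norm (\<Sum>i=m..<n. W i u) < e / ?C"
      using sm unfolding summable_Cauchy by blast
    have le: "E (\<lambda>x. S n u x - S m u x) < e" if mn: "M \<le> m" "m \<le> n" for m n
    proof -
      have "E (\<lambda>x. S n u x - S m u x) \<le> ?C * (\<Sum>i=m..n. W i u)"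
        using S_increment[where u = u, OF u0, of m "n - m"] mn(2) by simp
      also have "(\<Sum>i=m..n. W i u) < e / ?C"
        using M[OF mn(1), of "Suc n"] by (simp add: atLeastLessThanSuc_atLeastAtMost)
      finally show ?thesis using C by (simp add: field_simps)
    qed
    have "E (\<lambda>x. S m u x - S n u x) = E (\<lambda>x. S n u x - S m u x)" for m n
      using E_uminus[OF F_diff[OF SF[of n] SF[of m]]] by simp
    then show ?thesis using le by (intro exI[of _ M] allI impI) (metis nat_le_linear)
  qed
  obtain v where v: "v \<in> F" "(\<lambda>n. E (\<lambda>x. S n u x - v x)) \<longlonglongrightarrow> 0"
    using complete[of "\<lambda>n. S n u", OF SF tail] by blast
  \<comment> \<open>Completeness determines the limit only up to a constant; it is fixed at (0, 0),
    where all approximations vanish.\<close>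
  define s where "s = (\<lambda>p. v p + rst K (\<lambda>_. - v (0, 0)) p)"
  have sF: "s \<in> F" unfolding s_def by (rule F_add[OF v(1) F_const])
  have Es: "E (\<lambda>p. S n u p - s p) = E (\<lambda>p. S n u p - v p)" for n
    by (rule E_cong_diff_const[OF F_diff[OF SF sF] F_diff[OF SF v(1)], where a = "v (0, 0)"]) (simp add: s_def rst_def)
  have pw: "(\<lambda>n. S n u p) \<longlonglongrightarrow> s p" if p: "p \<in> K" for p
  proof -
    have "(\<lambda>n. sqrt (res_metric E F p (0, 0) * E (\<lambda>p. S n u p - v p))) \<longlonglongrightarrow> sqrt (res_metric E F p (0, 0) * 0)"
      by (intro tendsto_intros v(2))
    then have lim: "(\<lambda>n. sqrt (res_metric E F p (0, 0) * E (\<lambda>p. S n u p - v p))) \<longlonglongrightarrow> 0" by simp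
    have "(\<lambda>n. S n u p - s p) \<longlonglongrightarrow> 0"
    proof (rule Lim_null_comparison[OF _ lim], rule always_eventually, rule allI)
      fix n
      have "((S n u p - s p) - (S n u (0, 0) - s (0, 0)))\<^sup>2 \<le> res_metric E F p (0, 0) * E (\<lambda>p. S n u p - s p)"
        using point_estimate[OF F_diff[OF SF sF] p, of "(0, 0)"] by simp
      moreover have "S n u (0, 0) = 0" using S_properties(3)[where u = u and t = 0, OF u0] by simp
      moreover have "s (0, 0) = 0" by (simp add: s_def rst_def)
      ultimately show "norm (S n u p - s p) \<le> sqrt (res_metric E F p (0, 0) * E (\<lambda>p. S n u p - v p))"
        unfolding Es by (auto intro: real_le_rsqrt)
    qed
    then show ?thesis by (rule LIM_zero_cancel)
  qed
  have eqI: "s p = a" if "p \<in> K" "\<forall>\<^sub>F n in sequentially. S n u p = a" for p a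
    using LIMSEQ_unique[OF pw[OF that(1)] tendsto_eventually[OF that(2)]] .
  have node: "s (l / real k ^ m, 0) = u (l / real k ^ m)" if l: "l \<le> k ^ m" for l m :: nat
  proof (rule eqI)
    show "(real l / real k ^ m, 0) \<in> K" using l by (auto simp: divide_le_eq simp flip: of_nat_power)
    have "S n u (l / real k ^ m, 0) = u (l / real k ^ m)" if "n \<ge> m" for n
    proof -
      have eq: "real l / real k ^ m = real (l * k ^ (n - m)) / real k ^ n"
      proof -
        have "real k ^ n = real k ^ m * real k ^ (n - m)" using that by (simp flip: power_add)
        then show ?thesis by simp
      qed
      have "l * k ^ (n - m) \<le> k ^ m * k ^ (n - m)" using l by simp
      also have "\<dots> = k ^ n" using that by (simp flip: power_add)
      finally show ?thesis unfolding eq by (rule S_nodes[where u = u, OF u0])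
    qed
    then show "\<forall>\<^sub>F n in sequentially. S n u (l / real k ^ m, 0) = u (l / real k ^ m)"
      unfolding eventually_sequentially by blast
  qed
  have cs: "continuous_on {0..1} (\<lambda>t. s (t, 0))"
    by (rule continuous_on_compose2[OF F_continuous[OF sF]]) (auto intro!: continuous_intros)
  have E_le: "E s \<le> 68 * real k ^ 4 * (\<Sum>m. W m u)"
  proof (rule LIMSEQ_le_const[of "\<lambda>n. 2 * (34 * real k ^ 4 * (\<Sum>m. W m u)) + 2 * E (\<lambda>p. S n u p - v p)"])
    have "(\<lambda>n. 2 * (34 * real k ^ 4 * (\<Sum>m. W m u)) + 2 * E (\<lambda>p. S n u p - v p))
      \<longlonglongrightarrow> 2 * (34 * real k ^ 4 * (\<Sum>m. W m u)) + 2 * 0"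
      by (intro tendsto_intros v(2))
    then show "(\<lambda>n. 2 * (34 * real k ^ 4 * (\<Sum>m. W m u)) + 2 * E (\<lambda>p. S n u p - v p))
      \<longlonglongrightarrow> 68 * real k ^ 4 * (\<Sum>m. W m u)" by (simp add: mult.assoc)
    have "E s \<le> 2 * (34 * real k ^ 4 * (\<Sum>m. W m u)) + 2 * E (\<lambda>p. S n u p - v p)" for n
    proof -
      have "s = (\<lambda>p. S n u p - (S n u p - s p))" by simp
      then have "E s \<le> 2 * E (S n u) + 2 * E (\<lambda>p. S n u p - s p)"
        using E_diff_le[OF SF F_diff[OF SF sF], of n n] by metis
      also have "E (S n u) \<le> 34 * real k ^ 4 * (\<Sum>m\<le>n. W m u)" by (rule S_energy'[where u = u, OF u0])
      also have "\<dots> \<le> 34 * real k ^ 4 * (\<Sum>m. W m u)"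
        by (intro mult_left_mono sum_le_suminf sm) (auto simp: W_nonneg)
      finally show ?thesis unfolding Es by simp
    qed
    then show "\<exists>M. \<forall>n\<ge>M. E s \<le> 2 * (34 * real k ^ 4 * (\<Sum>m. W m u)) + 2 * E (\<lambda>p. S n u p - v p)" by blast
  qed
  show thesis
  proof (rule that[OF sF _ E_le], intro conjI)
    fix t :: real assume t: "0 \<le> t" "t \<le> 1"
    show "s (t, 0) = u t"
      using continuous_le_on_nodes[OF _ cs cont _ t, of k] continuous_le_on_nodes[OF _ cont cs _ t, of k] node k3
      by (auto intro: antisym)
    show "s (t, 1) = 0" "s (0, t) = 0" "s (1, t) = u 1 * cap (1, t)"
      by (rule eqI; use t S_properties[where u = u, OF u0] in simp)+
  qed
qed

end

section \<open>The renormalization factor and resistances between corners\<close>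

context carpet_crossing
begin

text \<open>The extension of t from the bottom side has right trace \<open>cap\<close>, known to be
  1 only on the lower half. The maximum with the reflected extension is 1 on the whole right side
  and also has the trace t on the top side; the energy is at most 2 * 68 * 2 = 272 times
  k^4.\<close>

lemma linear_trace_crossing:
  obtains X where "X \<in> F" "\<And>p. p \<in> bdry0 \<Longrightarrow> X p = fst p" "E X \<le> 272 * real k ^ 4"
proof -
  obtain e where e: "e \<in> F" "\<And>t. 0 \<le> t \<Longrightarrow> t \<le> 1 \<Longrightarrow>
      e (t, 0) = t \<and> e (t, 1) = 0 \<and> e (0, t) = 0 \<and> e (1, t) = 1 * cap (1, t)"
    "E e \<le> 68 * real k ^ 4 * (\<Sum>m. W m (\<lambda>t. t))"
    using edge_extension[OF _ _ W_id_sums(1)] continuous_on_id by blast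
  let ?e = "sym flipy e"
  have e': "?e \<in> F" "E ?e = E e" using e(1) by (simp_all add: sym_F E_sym)
  show thesis
  proof (rule that)
    show "(\<lambda>p. max (e p) (?e p)) \<in> F" by (rule max_in_F[OF e(1) e'(1)])
    have "68 * real k ^ 4 * (\<Sum>m. W m (\<lambda>t. t)) \<le> 68 * real k ^ 4 * 2" using W_id_sums(2) by (intro mult_left_mono) auto
    then show "E (\<lambda>p. max (e p) (?e p)) \<le> 272 * real k ^ 4" using E_max[OF e(1) e'(1)] e(3) e'(2) by linarith
    fix p assume p: "p \<in> bdry0"
    obtain x y where xy: "p = (x, y)" by (cases p)
    have b: "0 \<le> x" "x \<le> 1" "0 \<le> y" "y \<le> 1" "0 \<le> 1 - y" "1 - y \<le> 1" using p by (auto simp: xy bdry0_iff usq_iff)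
    have pK: "p \<in> K" using p bdry0_subset_K by blast
    consider "x = 0" | "x = 1" | "y = 0" | "y = 1" using p by (auto simp: xy bdry0_iff)
    then show "max (e p) (?e p) = fst p"
    proof cases
      case 2
      have "cap (1, y) = 1 \<or> cap (1, 1 - y) = 1" using cap_low[of 1 y] cap_low[of 1 "1 - y"] b by force
      moreover have "cap (1, y) \<le> 1" "cap (1, 1 - y) \<le> 1" using cap_bounds b by auto
      ultimately show ?thesis using e(2)[OF b(3,4)] e(2)[OF b(5,6)] 2 pK by (auto simp: xy)
    qed (use e(2)[OF b(1,2)] e(2)[OF b(3,4)] e(2)[OF b(5,6)] pK b in \<open>auto simp: xy\<close>)
  qed
qed

end

context carpet_form
begin

lemma last_index: "(real (k ^ m - 1) + 1) / real k ^ m = 1"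
proof -
  have "Suc (k ^ m - 1) = k ^ m" by simp
  then have "real (k ^ m - 1) + 1 = real k ^ m" by (metis of_nat_Suc of_nat_power add.commute)
  then show ?thesis by simp
qed

lemma crossing_exists:
  obtains h where "carpet_crossing k N c K E F r h"
proof -
  obtain h where h: "h \<in> crossings" "1 / 2 * E h < 1" "\<And>p. p \<in> K \<Longrightarrow> 0 \<le> h p \<and> h p \<le> 1"
    by (rule near_optimal_crossing[of "1 / 2"]) auto
  then have "carpet_crossing k N c K E F r h" by unfold_locales auto
  then show thesis by (rule that)
qed

lemma linear_trace:
  obtains X where "X \<in> F" "\<And>p. p \<in> bdry0 \<Longrightarrow> X p = fst p" "E X \<le> 272 * real k ^ 4"
proof -
  obtain h where "carpet_crossing k N c K E F r h" by (rule crossing_exists)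
  then interpret carpet_crossing k N c K E F r h .
  show thesis using linear_trace_crossing that by blast
qed

lemma edge_extension_zero:
  assumes "u 0 = 0" "u 1 = 0" "continuous_on {0..1} u" "summable (\<lambda>m. W m u)"
  obtains s where "s \<in> F" "\<And>t. 0 \<le> t \<Longrightarrow> t \<le> 1 \<Longrightarrow> s (t, 0) = u t \<and> s (t, 1) = 0 \<and> s (0, t) = 0 \<and> s (1, t) = 0"
    "E s \<le> 68 * real k ^ 4 * (\<Sum>m. W m u)"
proof -
  obtain h where "carpet_crossing k N c K E F r h" by (rule crossing_exists)
  then interpret carpet_crossing k N c K E F r h .
  obtain s where "s \<in> F" "\<And>t. 0 \<le> t \<Longrightarrow> t \<le> 1 \<Longrightarrow> s (t, 0) = u t \<and> s (t, 1) = 0 \<and> s (0, t) = 0 \<and> s (1, t) = u 1 * cap (1, t)"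
    "E s \<le> 68 * real k ^ 4 * (\<Sum>m. W m u)"
    using edge_extension[OF assms(1,3,4)] by blast
  then show thesis using that[of s] assms(2) by simp
qed

text \<open>A function with linear boundary trace can be iterated: gluing its affine copies gives
  functions with the same trace and energy \<open>(N / (r * k\<^sup>2)) ^ n\<close> times the original one.\<close>

lemma r_le: "r \<le> N / (real k)\<^sup>2"
proof -
  obtain X0 where X0: "X0 \<in> F" "\<And>p. p \<in> bdry0 \<Longrightarrow> X0 p = fst p" using linear_trace by blast
  define a where "a = N / (r * (real k)\<^sup>2)"
  have a0: "0 \<le> a" using rpos by (simp add: a_def)
  have ex: "\<exists>X\<in>F. (\<forall>p\<in>bdry0. X p = fst p) \<and> E X = a ^ n * E X0" for n
  proof (induction n)
    case 0
    have "\<forall>p\<in>bdry0. X0 p = fst p" using X0(2) by blast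
    then show ?case using X0(1) by auto
  next
    case (Suc n)
    then obtain X where X: "X \<in> F" "\<forall>p\<in>bdry0. X p = fst p" "E X = a ^ n * E X0" by blast
    define g where "g i = rst K (\<lambda>p. fst (c i) + (1 / k) * X p)" for i
    have gF: "g i \<in> F" for i unfolding g_def by (rule F_affine[OF X(1)])
    have gE: "E (g i) = (1 / k)\<^sup>2 * E X" for i unfolding g_def by (rule E_affine[OF X(1)])
    have g_bdry: "g i p = fst (\<Psi> i p)" if "p \<in> bdry0" for i p
      using that X(2) bdry0_subset_K by (auto simp: g_def rst_def Psi_def)
    have comp: "compatible g" unfolding compatible_def
    proof (intro ballI impI)
      fix i j p q assume h: "i \<in> {1..N}" "j \<in> {1..N}" "i \<noteq> j" "p \<in> K" "q \<in> K" "\<Psi> i p = \<Psi> j q"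
      then have "p \<in> bdry0" "q \<in> bdry0" using cells_contact_bdry0 K_subset_usq by blast+
      then show "g i p = g j q" using g_bdry h(6) by metis
    qed
    have "glue g p = fst p" if p: "p \<in> bdry0" for p
    proof -
      obtain i q where iq: "i \<in> {1..N}" "q \<in> bdry0" "p = \<Psi> i q" using bdry0_self_cover[OF p] by blast
      then have "q \<in> K" using bdry0_subset_K by blast
      then show ?thesis using glue_apply[OF comp iq(1)] g_bdry[OF iq(2)] iq(3) by metis
    qed
    moreover have "E (glue g) = a ^ Suc n * E X0"
      using E_glue[OF comp gF] by (simp add: gE X(3) a_def power_divide mult_ac)
    ultimately show ?case using glue_F[OF comp gF] by blast
  qed
  \<comment> \<open>All iterates are crossings, so their energies cannot tend to 0.\<close>
  have "1 \<le> a"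
  proof (rule ccontr)
    assume "\<not> 1 \<le> a"
    then have "(\<lambda>n. a ^ n * E X0) \<longlonglongrightarrow> 0 * E X0"
      using a0 by (intro tendsto_mult LIMSEQ_realpow_zero tendsto_const) auto
    moreover have "1 \<le> a ^ n * E X0" for n
    proof -
      obtain X where X: "X \<in> F" "\<forall>p\<in>bdry0. X p = fst p" "E X = a ^ n * E X0" using ex by blast
      then have "X \<in> crossings" by (auto simp: crossings_def bdry0_iff usq_iff)
      then show ?thesis using E_crossing_ge X(3) by metis
    qed
    ultimately have "1 \<le> 0 * E X0" by (intro LIMSEQ_le_const) auto
    then show False by simp
  qed
  then show ?thesis using rpos by (simp add: a_def field_simps)
qed

text \<open>The cells do not fill the square, and this keeps \<open>r\<close> away from 1 by an
  amount depending on \<open>k\<close> alone.\<close>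

lemma r_le': "r \<le> 1 - 1 / (real k)\<^sup>2"
proof -
  have "real N / (real k)\<^sup>2 \<le> ((real k)\<^sup>2 - 1) / (real k)\<^sup>2"
    using N_less by (intro divide_right_mono) auto
  then show ?thesis using r_le by (simp add: diff_divide_distrib)
qed

lemma r_less_1: "r < 1"
  using r_le' by (smt (verit) divide_pos_pos kpos zero_less_power)

lemma sqrt_r_le: "sqrt r \<le> 1 - 1 / (2 * (real k)\<^sup>2)"
proof (rule real_le_lsqrt)
  show "0 \<le> 1 - 1 / (2 * (real k)\<^sup>2)"
  proof -
    have "1 \<le> real k ^ 2" using k3 by (intro one_le_power) simp
    then show ?thesis by (simp add: field_simps)
  qed
  have "1 - 1 / (real k)\<^sup>2 \<le> (1 - 1 / (2 * (real k)\<^sup>2))\<^sup>2"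
    using zero_le_power2[of "1 / (2 * (real k)\<^sup>2)"] by (simp add: power2_diff field_simps)
  then show "r \<le> (1 - 1 / (2 * (real k)\<^sup>2))\<^sup>2" using r_le' by linarith
qed

section \<open>Resistance between adjacent corners\<close>

definition \<rho> :: real where "\<rho> = res_metric E F (0, 0) (1, 0)"

lemma \<rho>_nonneg: "0 \<le> \<rho>"
proof -
  obtain h where h: "h \<in> crossings" by (rule near_optimal_crossing[of 0]) auto
  then have hF: "h \<in> F" by (simp add: crossings_def)
  have "0 \<le> \<rho> * E h" using point_estimate[OF hF, of "(0, 0)" "(1, 0)"] unfolding \<rho>_def
    by (smt (verit) edge_in_K zero_le_power2)
  then show ?thesis using E_crossing_pos[OF h] by (simp add: zero_le_mult_iff)
qed

text \<open>The bound that the energy of \<open>f\<close> puts on its differences between adjacent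
  corners.\<close>

definition osc :: "(pt \<Rightarrow> real) \<Rightarrow> real" where "osc f = sqrt (\<rho> * E f)"

lemma osc_nonneg: "f \<in> F \<Longrightarrow> 0 \<le> osc f"
  by (simp add: osc_def \<rho>_nonneg E_nonneg)

lemma corner_osc: "f \<in> F \<Longrightarrow> \<bar>f (0, 0) - f (1, 0)\<bar> \<le> osc f"
  unfolding osc_def \<rho>_def using point_estimate[of f "(0, 0)" "(1, 0)"] by (auto intro!: real_le_rsqrt)

lemma osc_mono: "f \<in> F \<Longrightarrow> g \<in> F \<Longrightarrow> E g \<le> a * E f \<Longrightarrow> 0 \<le> a \<Longrightarrow> osc g \<le> sqrt a * osc f"
  unfolding osc_def by (simp flip: real_sqrt_mult) (metis \<rho>_nonneg mult.left_commute mult_left_mono)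

text \<open>Corner steps of the next level, fewer than k, lead to the left end of the cell
  containing the node, and the rest is a smaller copy of the problem. Each level brings a factor
  sqrt r, so the geometric series converges.\<close>

lemma node_osc: "f \<in> F \<Longrightarrow> (l::nat) \<le> k ^ m \<Longrightarrow> \<bar>f (l / real k ^ m, 0) - f (0, 0)\<bar> \<le> 2 * real k ^ 3 * osc f"
proof (induction m arbitrary: f l)
  case 0
  have "1 \<le> real k ^ 3" using k3 by (intro one_le_power) simp
  then have "1 * osc f \<le> 2 * real k ^ 3 * osc f" by (intro mult_right_mono osc_nonneg 0) simp
  moreover have "l = 0 \<or> l = 1" using 0 by auto
  ultimately show ?case using corner_osc[OF 0(1)] osc_nonneg[OF 0(1)] by (auto simp: abs_minus_commute)
next
  case (Suc m)
  obtain j l' where jl: "j < k" "l' \<le> k ^ m" "l = j * k ^ m + l'" using node_split[OF Suc.prems(2)] .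
  let ?q = "sqrt r * osc f"
  have q: "osc (sub (bt i) f) \<le> ?q" if "i < k" for i
    using that Suc.prems(1) E_sub_le[of f "bt i"] rpos by (intro osc_mono) auto
  have q0: "0 \<le> ?q" using osc_nonneg[OF Suc.prems(1)] rpos by simp
  have "\<bar>f (real i / k, 0) - f (0, 0)\<bar> \<le> i * ?q" if "i \<le> k" for i
    using that
  proof (induction i)
    case (Suc i)
    then have "\<bar>f (real i / k, 0) - f (real (Suc i) / k, 0)\<bar> \<le> ?q"
      using corner_osc[of "sub (bt i) f"] q[of i] Suc.prems \<open>f \<in> F\<close> by (simp add: Psi_frame add.commute)
    then show ?case using Suc by (simp add: algebra_simps)
  qed simp
  from this[of j] jl(1) have 1: "\<bar>f (real j / k, 0) - f (0, 0)\<bar> \<le> k * ?q"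
    using mult_right_mono[of "real j" "real k" ?q] q0 by simp
  have t: "0 \<le> l' / real k ^ m" "l' / real k ^ m \<le> 1"
    using jl(2) by (auto simp: divide_le_eq simp flip: of_nat_power)
  have x: "l / real k ^ Suc m = (j + l' / real k ^ m) / k" using jl(3) by (simp add: field_simps)
  have "\<bar>sub (bt j) f (l' / real k ^ m, 0) - sub (bt j) f (0, 0)\<bar> \<le> 2 * real k ^ 3 * osc (sub (bt j) f)"
    using Suc.prems(1) jl by (intro Suc.IH) auto
  also have "\<dots> \<le> 2 * real k ^ 3 * ?q" using q[OF jl(1)] by (intro mult_left_mono) auto
  finally have 2: "\<bar>f (l / real k ^ Suc m, 0) - f (real j / k, 0)\<bar> \<le> 2 * real k ^ 3 * ?q"
    using t jl(1) unfolding x by (simp add: Psi_frame)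
  have "\<bar>f (l / real k ^ Suc m, 0) - f (0, 0)\<bar> \<le> (2 * real k ^ 3 + k) * sqrt r * osc f"
    using 1 2 by (simp add: algebra_simps)
  also have "\<dots> \<le> (2 * real k ^ 3 + k) * (1 - 1 / (2 * (real k)\<^sup>2)) * osc f"
    using osc_nonneg[OF Suc.prems(1)] sqrt_r_le by (intro mult_right_mono mult_left_mono) auto
  also have "\<dots> \<le> 2 * real k ^ 3 * osc f"
  proof (rule mult_right_mono)
    \<comment> \<open>The constant has to satisfy (C + k)(1 - 1 / (2 k^2)) <= C; for C = 2 k^3 the
      terms of order k cancel and - 1 / (2 k) remains.\<close>
    show "(2 * real k ^ 3 + k) * (1 - 1 / (2 * (real k)\<^sup>2)) \<le> 2 * real k ^ 3"
      by (simp add: field_simps power2_eq_square power3_eq_cube)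
  qed (rule osc_nonneg[OF Suc.prems(1)])
  finally show ?case .
qed

lemma side_osc:
  assumes f: "f \<in> F" and t: "0 \<le> t" "t \<le> 1"
  shows "\<bar>f (t, 0) - f (0, 0)\<bar> \<le> 2 * real k ^ 3 * osc f"
    and "\<bar>f (0, t) - f (0, 0)\<bar> \<le> 2 * real k ^ 3 * osc f"
    and "\<bar>f (1, t) - f (1, 0)\<bar> \<le> 2 * real k ^ 3 * osc f"
proof -
  have *: "\<bar>f (t, 0) - f (0, 0)\<bar> \<le> 2 * real k ^ 3 * osc f" if f: "f \<in> F" for f
  proof (rule continuous_le_on_nodes[OF _ _ _ _ t])
    show "continuous_on {0..1} (\<lambda>t. \<bar>f (t, 0) - f (0, 0)\<bar>)"
      by (intro continuous_intros continuous_on_compose2[OF F_continuous[OF f]]) (auto intro!: continuous_intros)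
    show "2 \<le> k" using k3 by simp
  qed (auto intro: node_osc[OF f])
  show "\<bar>f (t, 0) - f (0, 0)\<bar> \<le> 2 * real k ^ 3 * osc f" by (rule *[OF f])
  show "\<bar>f (0, t) - f (0, 0)\<bar> \<le> 2 * real k ^ 3 * osc f"
    using *[OF sym_F[OF _ f], of "\<lambda>(x, y). (y, x)"] t f by (simp add: osc_def E_sym)
  show "\<bar>f (1, t) - f (1, 0)\<bar> \<le> 2 * real k ^ 3 * osc f"
    using *[OF sym_F[OF _ f], of "\<lambda>(x, y). (1 - y, x)"] t f by (simp add: osc_def E_sym)
qed

text \<open>For l < k^m this is the m-fold iterate of maps \<open>sub (bt j)\<close>, addressed by
  the position l along the bottom side instead of by a word.\<close>

definition piece :: "nat \<Rightarrow> nat \<Rightarrow> (pt \<Rightarrow> real) \<Rightarrow> pt \<Rightarrow> real" where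
  "piece m l f = rst K (\<lambda>p. f ((l + fst p) / real k ^ m, snd p / real k ^ m))"

lemma piece_in_K: "(x, y) \<in> K \<Longrightarrow> l < k ^ m \<Longrightarrow> ((l + x) / real k ^ m, y / real k ^ m) \<in> K"
proof (induction m arbitrary: l)
  case (Suc m)
  define j where "j = l div k ^ m"
  define l' where "l' = l mod k ^ m"
  have jl: "j < k" "l' < k ^ m" "l = j * k ^ m + l'"
    unfolding j_def l'_def div_mult_mod_eq using Suc.prems(2) by (simp_all add: less_mult_imp_div_less)
  have "\<Psi> (bt j) ((l' + x) / real k ^ m, y / real k ^ m) \<in> K"
    using jl Suc by (intro Psi_in_K) auto
  then show ?case using jl by (simp add: Psi_frame field_simps)
qed simp

lemma piece_Suc:
  assumes "j < k" "l < k ^ m"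
  shows "piece (Suc m) (j * k ^ m + l) f = piece m l (sub (bt j) f)"
proof
  fix p :: pt
  obtain x y where p: "p = (x, y)" by (cases p)
  have "(real (j * k ^ m + l) + x) / real k ^ Suc m = (real j + (real l + x) / real k ^ m) / k"
    by (simp add: field_simps)
  then show "piece (Suc m) (j * k ^ m + l) f p = piece m l (sub (bt j) f) p"
    using piece_in_K[of x y l m] assms by (simp add: piece_def rst_def p Psi_frame mult.commute)
qed

lemma piece_F: "f \<in> F \<Longrightarrow> l < k ^ m \<Longrightarrow> piece m l f \<in> F"
  and E_piece_sum: "f \<in> F \<Longrightarrow> (\<Sum>l<k ^ m. E (piece m l f)) \<le> r ^ m * E f"
proof -
  have "(\<forall>l<k ^ m. piece m l f \<in> F) \<and> (\<Sum>l<k ^ m. E (piece m l f)) \<le> r ^ m * E f" if "f \<in> F"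
    using that
  proof (induction m arbitrary: f)
    case 0
    have "piece 0 0 f = f" using F_outside[OF 0] by (auto simp: piece_def rst_def fun_eq_iff)
    then show ?case using 0 by simp
  next
    case (Suc m)
    have "piece (Suc m) l f \<in> F" if l: "l < k ^ Suc m" for l
    proof -
      have jl: "l div k ^ m < k" "l mod k ^ m < k ^ m" using l by (auto simp: less_mult_imp_div_less)
      show ?thesis using piece_Suc[OF jl, of f, unfolded div_mult_mod_eq] Suc.IH[of "sub (bt (l div k ^ m)) f"] jl Suc.prems by simp
    qed
    moreover have "(\<Sum>l<k ^ Suc m. E (piece (Suc m) l f)) = (\<Sum>j<k. \<Sum>l<k ^ m. E (piece m l (sub (bt j) f)))"
      using sum_blocks[of "\<lambda>l. E (piece (Suc m) l f)" k "k ^ m"] by (simp add: piece_Suc)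
    moreover have "\<dots> \<le> (\<Sum>j<k. r ^ m * E (sub (bt j) f))"
      using Suc by (intro sum_mono) auto
    moreover have "\<dots> = r ^ m * (\<Sum>i\<in>bottom. E (sub i f))" by (simp add: sum_distrib_left sum_bottom)
    moreover have "\<dots> \<le> r ^ m * (r * E f)"
      using rpos by (intro mult_left_mono E_sub_sum Suc.prems bottom_subset) auto
    ultimately show ?case by (auto simp: algebra_simps)
  qed
  then show "f \<in> F \<Longrightarrow> l < k ^ m \<Longrightarrow> piece m l f \<in> F" "f \<in> F \<Longrightarrow> (\<Sum>l<k ^ m. E (piece m l f)) \<le> r ^ m * E f"
    by blast+
qed

text \<open>If all values at the right end exceeded all values at the left end by at least d,
  truncating \<open>f\<close> between these levels would give a crossing of the row of k^m small
  cells that is too cheap for \<open>row_energy\<close>.\<close>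

lemma crossing_pair:
  assumes f: "f \<in> F" and d: "real k ^ m * (r ^ m * E f) < d\<^sup>2" "d > 0"
  shows "\<exists>s\<in>{0..1}. \<exists>t\<in>{0..1}. f (1, t / real k ^ m) - f (0, s / real k ^ m) < d"
proof (rule ccontr)
  assume no: "\<not> ?thesis"
  then have far: "d \<le> f (1, t / real k ^ m) - f (0, s / real k ^ m)" if "0 \<le> s" "s \<le> 1" "0 \<le> t" "t \<le> 1" for s t
    using that by (meson atLeastAtMost_iff not_less)
  define a where "a = (SUP s\<in>{0..1}. f (0, s / real k ^ m))"
  have bdd: "bdd_above ((\<lambda>s. f (0, s / real k ^ m)) ` {0..1})"
    using far[of _ 0] by (intro bdd_aboveI2[of _ _ "f (1, 0) - d"]) fastforce
  have a1: "f (0, s / real k ^ m) \<le> a" if "0 \<le> s" "s \<le> 1" for s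
    unfolding a_def using that by (intro cSUP_upper bdd) auto
  have a2: "a + d \<le> f (1, t / real k ^ m)" if "0 \<le> t" "t \<le> 1" for t
  proof -
    have "a \<le> f (1, t / real k ^ m) - d"
      unfolding a_def by (rule cSUP_least) (use far[OF _ _ that] in fastforce)+
    then show ?thesis by simp
  qed
  define g where "g = rst K (\<lambda>x. min 1 (max 0 ((f x - a) / d)))"
  have g: "g \<in> F" "E g \<le> E f / d\<^sup>2" unfolding g_def using clamp[OF f d(2)] by auto
  have km: "0 < k ^ m" "1 \<le> real k ^ m" using k3 by auto
  note last = last_index[of m]
  have edge: "0 \<le> y / real k ^ m" "y / real k ^ m \<le> 1" if "0 \<le> y" "y \<le> 1" for y
    using that km(2) by (auto simp: divide_le_eq)
  have "1 \<le> real (k ^ m) * (\<Sum>l<k ^ m. E (piece m l g))"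
  proof (rule row_energy[OF km(1) piece_F[OF g(1)]])
    fix y :: real assume y: "0 \<le> y" "y \<le> 1"
    show "piece m l g (1, y) = piece m (Suc l) g (0, y)" for l
      using y by (simp add: piece_def rst_def add.commute)
    show "piece m 0 g (0, y) = 0"
      using y edge[OF y] a1[OF y] d(2) by (simp add: piece_def g_def rst_def divide_le_0_iff)
    show "piece m (k ^ m - 1) g (1, y) = 1"
      using y edge[OF y] a2[OF y] d(2) last by (simp add: piece_def g_def rst_def)
  qed
  also have "\<dots> \<le> real (k ^ m) * (r ^ m * E g)" by (intro mult_left_mono E_piece_sum g) auto
  also have "\<dots> \<le> real (k ^ m) * (r ^ m * (E f / d\<^sup>2))" using g rpos by (intro mult_left_mono) auto
  also have "\<dots> < 1" using d by (simp add: field_simps)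
  finally show False by simp
qed

lemma corner_osc_deep:
  assumes m: "8 * real k ^ 3 * (1 - 1 / (2 * (real k)\<^sup>2)) ^ m \<le> 1" and f: "f \<in> F"
  shows "f (1, 0) - f (0, 0) \<le> osc f / 2 + sqrt (real k ^ m * E f)"
proof (rule field_le_epsilon)
  fix e :: real assume e: "e > 0"
  let ?d = "sqrt (real k ^ m * E f) + e"
  have E0: "0 \<le> E f" by (rule E_nonneg[OF f])
  have rm: "0 \<le> r ^ m" "r ^ m \<le> 1" using rpos r_less_1 by (auto intro: power_le_one)
  \<comment> \<open>Discarding r^m keeps the bound in terms of \<open>k\<close>, \<open>m\<close>
    and the energy.\<close>
  have "real k ^ m * (r ^ m * E f) \<le> real k ^ m * (1 * E f)" using rm E0 by (intro mult_left_mono mult_right_mono) auto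
  also have "\<dots> = (sqrt (real k ^ m * E f))\<^sup>2" using E0 by simp
  also have "\<dots> < ?d\<^sup>2" using e E0 by (intro power_strict_mono) auto
  finally have "real k ^ m * (r ^ m * E f) < ?d\<^sup>2" .
  moreover have "?d > 0" using e E0 by (intro add_nonneg_pos) auto
  ultimately obtain s t where st: "0 \<le> s" "s \<le> 1" "0 \<le> t" "t \<le> 1" "f (1, t / real k ^ m) - f (0, s / real k ^ m) < ?d"
    using crossing_pair[OF f] by (metis atLeastAtMost_iff)
  have km: "0 < k ^ m" by simp
  note last = last_index[of m]
  \<comment> \<open>The end points of the crossing are moved to the corners at a cost of osc/4 each;
    the choice of m makes this possible.\<close>
  have small: "2 * real k ^ 3 * osc (piece m l f) \<le> osc f / 4" if l: "l < k ^ m" for l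
  proof -
    have "E (piece m l f) \<le> (\<Sum>l<k ^ m. E (piece m l f))"
      using l by (intro member_le_sum) (auto intro: E_nonneg piece_F[OF f])
    then have "osc (piece m l f) \<le> sqrt (r ^ m) * osc f"
      using E_piece_sum[OF f, of m] l rm by (intro osc_mono f piece_F) auto
    also have "\<dots> \<le> (1 - 1 / (2 * (real k)\<^sup>2)) ^ m * osc f"
      using sqrt_r_le rpos by (intro mult_right_mono osc_nonneg f) (auto simp: real_sqrt_power intro: power_mono)
    finally have "8 * real k ^ 3 * osc (piece m l f) \<le> 8 * real k ^ 3 * ((1 - 1 / (2 * (real k)\<^sup>2)) ^ m * osc f)"
      by (intro mult_left_mono) auto
    also have "\<dots> \<le> 1 * osc f"
      unfolding mult.assoc[symmetric] using m by (intro mult_right_mono osc_nonneg f) auto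
    finally show ?thesis by simp
  qed
  have "\<bar>f (0, s / real k ^ m) - f (0, 0)\<bar> \<le> osc f / 4"
    using side_osc(2)[OF piece_F[OF f km] st(1,2)] small[OF km] st by (simp add: piece_def rst_def)
  moreover have "\<bar>f (1, t / real k ^ m) - f (1, 0)\<bar> \<le> osc f / 4"
    using side_osc(3)[OF piece_F[OF f, of "k ^ m - 1" m] st(3,4)] small[of "k ^ m - 1"] st km last
    by (simp add: piece_def rst_def)
  ultimately show "f (1, 0) - f (0, 0) \<le> osc f / 2 + sqrt (real k ^ m * E f) + e" using st(5) by linarith
qed

text \<open>The supremum over \<open>f\<close> turns the previous estimate into one for
  \<open>\<rho>\<close> itself, and half of sqrt \<open>\<rho>\<close> can be absorbed because RF4
  makes \<open>\<rho>\<close> a genuine, finite supremum.\<close>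

lemma corner_resistance:
  assumes m: "8 * real k ^ 3 * (1 - 1 / (2 * (real k)\<^sup>2)) ^ m \<le> 1" and f: "f \<in> F"
  shows "(f (0, 0) - f (1, 0))\<^sup>2 \<le> 4 * real k ^ m * E f"
proof -
  let ?b = "sqrt \<rho> / 2 + sqrt (real k ^ m)"
  have bound: "(f (0, 0) - f (1, 0))\<^sup>2 \<le> ?b\<^sup>2 * E f" if f: "f \<in> F" for f
  proof -
    have "\<bar>f (0, 0) - f (1, 0)\<bar> \<le> osc f / 2 + sqrt (real k ^ m * E f)"
      using corner_osc_deep[OF m f] corner_osc_deep[OF m F_uminus[OF f]] E_uminus[OF f] by (auto simp: osc_def abs_le_iff)
    also have "\<dots> = ?b * sqrt (E f)" by (simp add: osc_def real_sqrt_mult algebra_simps)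
    finally have "\<bar>f (0, 0) - f (1, 0)\<bar>\<^sup>2 \<le> (?b * sqrt (E f))\<^sup>2" by (intro power_mono) auto
    then show ?thesis using E_nonneg[OF f] by (simp add: power_mult_distrib)
  qed
  have "\<rho> \<le> ?b\<^sup>2"
    unfolding \<rho>_def res_metric_def
  proof (rule cSup_least)
    obtain h where h: "h \<in> crossings" by (rule near_optimal_crossing[of 0]) auto
    then show "{(u (0, 0) - u (1, 0))\<^sup>2 / E u | u. u \<in> F \<and> E u > 0} \<noteq> {}"
      using E_crossing_pos[OF h] by (auto simp: crossings_def)
  next
    fix z assume "z \<in> {(u (0, 0) - u (1, 0))\<^sup>2 / E u | u. u \<in> F \<and> E u > 0}"
    then show "z \<le> (sqrt (Sup {(u (0, 0) - u (1, 0))\<^sup>2 / E u | u. u \<in> F \<and> E u > 0}) / 2 + sqrt (real k ^ m))\<^sup>2"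
      using bound unfolding \<rho>_def res_metric_def by (auto simp: pos_divide_le_eq)
  qed
  then have "sqrt \<rho> \<le> ?b" using \<rho>_nonneg by (intro real_le_lsqrt) auto
  then have "sqrt \<rho> \<le> sqrt (4 * real k ^ m)" by (simp add: real_sqrt_mult)
  then have "\<rho> \<le> 4 * real k ^ m" by simp
  then have "\<rho> * E f \<le> 4 * real k ^ m * E f" using E_nonneg[OF f] by (intro mult_right_mono)
  then show ?thesis using point_estimate[OF f, of "(0, 0)" "(1, 0)"] unfolding \<rho>_def by simp
qed

end

section \<open>The trace inequality\<close>

lemma telescope_square_le:
  fixes \<phi> :: "nat \<Rightarrow> real"
  assumes "a \<le> n"
  shows "(\<phi> a - \<phi> n)\<^sup>2 \<le> n * (\<Sum>j=a..<n. (\<phi> j - \<phi> (Suc j))\<^sup>2)"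
proof -
  have "\<phi> n - \<phi> a = (\<Sum>j=a..<n. \<phi> (Suc j) - \<phi> j)" using sum_Suc_diff'[OF assms, of \<phi>] by simp
  then have "(\<phi> a - \<phi> n)\<^sup>2 = (\<Sum>j=a..<n. \<phi> (Suc j) - \<phi> j)\<^sup>2" by (metis power2_commute)
  also have "\<dots> \<le> (\<Sum>j=a..<n. (\<phi> (Suc j) - \<phi> j)\<^sup>2) * card {a..<n}"
    by (rule sum_squared_le_sum_of_squares)
  also have "\<dots> = (\<Sum>j=a..<n. (\<phi> j - \<phi> (Suc j))\<^sup>2) * real (n - a)"
    by (simp add: power2_commute)
  also have "\<dots> \<le> (\<Sum>j=a..<n. (\<phi> j - \<phi> (Suc j))\<^sup>2) * n"
    by (intro mult_left_mono sum_nonneg) auto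
  finally show ?thesis by (simp add: mult.commute)
qed

lemma square_add_weighted: "e > 0 \<Longrightarrow> (a + b)\<^sup>2 \<le> (1 + e) * a\<^sup>2 + (1 + 1 / e) * (b :: real)\<^sup>2"
proof -
  assume e: "e > 0"
  have "0 \<le> (e * a - b)\<^sup>2 / e" using e by simp
  also have "\<dots> = e * a\<^sup>2 - 2 * a * b + b\<^sup>2 / e" using e by (simp add: power2_diff field_simps power2_eq_square)
  finally show ?thesis by (simp add: power2_sum algebra_simps)
qed

lemma (in carpet) V_cong:
  assumes "\<And>t. 0 \<le> t \<Longrightarrow> t \<le> 1 \<Longrightarrow> u t = v t"
  shows "V m u = V m v"
  unfolding V_def
proof (intro sum.cong refl)
  fix l assume "l \<in> {..<k ^ m}"
  then have "l \<le> k ^ m" "real (l + 1) \<le> real k ^ m" by (auto simp flip: of_nat_power of_nat_Suc)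
  then show "(u (real l / real k ^ m) - u (real (l + 1) / real k ^ m))\<^sup>2 =
    (v (real l / real k ^ m) - v (real (l + 1) / real k ^ m))\<^sup>2"
    by (subst (1 2) assms) (auto simp: divide_le_eq)
qed

context carpet_form
begin

lemma W_cong: "(\<And>t. 0 \<le> t \<Longrightarrow> t \<le> 1 \<Longrightarrow> u t = v t) \<Longrightarrow> W m u = W m v"
  unfolding W_def using V_cong by metis

lemma W_sub: "W (Suc m) (\<lambda>t. f (t, 0)) = (\<Sum>j<k. W m (\<lambda>t. sub (bt j) f (t, 0))) / r"
proof -
  have "W m (\<lambda>t. f ((j + t) / k, 0) - 0) = W m (\<lambda>t. sub (bt j) f (t, 0))" if "j < k" for j
    by (rule W_cong) (use that in \<open>simp add: Psi_frame\<close>)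
  then show ?thesis unfolding W_Suc[where a = "\<lambda>_. 0"] by simp
qed

definition upper :: "(pt \<Rightarrow> real) \<Rightarrow> real" where
  "upper f = (\<Sum>i\<in>{1..N} - bottom. E (sub i f))"

lemma E_split_upper: "f \<in> F \<Longrightarrow> E f = ((\<Sum>j<k. E (sub (bt j) f)) + upper f) / r"
  unfolding upper_def by (rule E_split_bottom)

lemma upper_nonneg: "f \<in> F \<Longrightarrow> 0 \<le> upper f"
  unfolding upper_def by (intro sum_nonneg E_nonneg sub_F) auto

lemma sum_le_upper:
  assumes "f \<in> F" "inj_on g A" "g ` A \<subseteq> {1..N} - bottom"
  shows "(\<Sum>j\<in>A. E (sub (g j) f)) \<le> upper f"
proof -
  have "(\<Sum>j\<in>A. E (sub (g j) f)) = (\<Sum>i\<in>g ` A. E (sub i f))" by (simp add: sum.reindex[OF assms(2)])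
  also have "\<dots> \<le> upper f" unfolding upper_def
    using assms(3) by (intro sum_mono2 E_nonneg sub_F[OF assms(1)]) auto
  finally show ?thesis .
qed

end

text \<open>The resistance bound is abstracted to a number \<open>R\<^sub>0\<close>, later
  instantiated by a function of \<open>k\<close>.\<close>

locale carpet_corner_bound = carpet_form +
  fixes R\<^sub>0 :: real
  assumes corner_bound: "f \<in> F \<Longrightarrow> (f (0, 0) - f (1, 0))\<^sup>2 \<le> R\<^sub>0 * E f"
begin

lemma corner_bounds:
  assumes "f \<in> F"
  shows "(f (0, 0) - f (0, 1))\<^sup>2 \<le> R\<^sub>0 * E f" "(f (1, 0) - f (1, 1))\<^sup>2 \<le> R\<^sub>0 * E f" "(f (0, 1) - f (1, 1))\<^sup>2 \<le> R\<^sub>0 * E f"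
  using corner_bound[OF sym_F[OF _ assms], of "\<lambda>(x, y). (y, x)"] corner_bound[OF sym_F[OF _ assms], of "\<lambda>(x, y). (1 - y, x)"]
    corner_bound[OF sym_F[OF _ assms], of "flipy"] assms
  by (simp_all add: E_sym)

lemma R0_nonneg: "0 \<le> R\<^sub>0"
proof -
  obtain h where h: "h \<in> crossings" by (rule near_optimal_crossing[of 0]) auto
  then have "h \<in> F" by (simp add: crossings_def)
  from corner_bound[OF this] have "0 \<le> R\<^sub>0 * E h" by (smt (verit) zero_le_power2)
  then show ?thesis using E_crossing_pos[OF h] by (simp add: zero_le_mult_iff)
qed

lemma chain_upper:
  assumes f: "f \<in> F" and a: "a \<le> k" and g: "inj_on g {a..<k}" "g ` {a..<k} \<subseteq> {1..N} - bottom"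
    and step: "\<And>j. a \<le> j \<Longrightarrow> j < k \<Longrightarrow> (\<phi> j - \<phi> (Suc j))\<^sup>2 \<le> R\<^sub>0 * E (sub (g j) f)"
  shows "(\<phi> a - \<phi> k)\<^sup>2 \<le> k * R\<^sub>0 * upper f"
proof -
  have "(\<phi> a - \<phi> k)\<^sup>2 \<le> k * (\<Sum>j=a..<k. (\<phi> j - \<phi> (Suc j))\<^sup>2)" by (rule telescope_square_le[OF a])
  also have "\<dots> \<le> k * (\<Sum>j=a..<k. R\<^sub>0 * E (sub (g j) f))" using step by (intro mult_left_mono sum_mono) auto
  also have "\<dots> = k * R\<^sub>0 * (\<Sum>j=a..<k. E (sub (g j) f))" by (simp add: sum_distrib_left mult.assoc)
  also have "\<dots> \<le> k * R\<^sub>0 * upper f" using R0_nonneg by (intro mult_left_mono sum_le_upper f g) auto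
  finally show ?thesis .
qed

text \<open>The paths run through frame cells outside the bottom row; the lateral ones start at
  height 1/k because the first cell of each column belongs to that row. They are paid for by energy
  that the bottom trace at finer scales does not use.\<close>

lemma upper_chains:
  assumes f: "f \<in> F"
  shows "(f (0, 1 / k) - f (0, 1))\<^sup>2 \<le> k * R\<^sub>0 * upper f"
    and "(f (1, 1 / k) - f (1, 1))\<^sup>2 \<le> k * R\<^sub>0 * upper f"
    and "(f (0, 1) - f (1, 1))\<^sup>2 \<le> k * R\<^sub>0 * upper f"
proof -
  have k1: "Suc 0 \<le> k" using k3 by simp
  have "(f (0, real 1 / k) - f (0, real k / k))\<^sup>2 \<le> k * R\<^sub>0 * upper f"
  proof (rule chain_upper[OF f, of 1 lf])
    show "inj_on lf {1..<k}" using inj_lf by (rule inj_on_subset) auto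
    fix j assume j: "1 \<le> j" "j < k"
    show "(f (0, real j / k) - f (0, real (Suc j) / k))\<^sup>2 \<le> R\<^sub>0 * E (sub (lf j) f)"
      using corner_bounds(1)[OF sub_frame_F(3)[OF f j(2)]] j by (simp add: Psi_frame add.commute)
  qed (use lf_not_bottom k1 in auto)
  then show "(f (0, 1 / k) - f (0, 1))\<^sup>2 \<le> k * R\<^sub>0 * upper f" by simp
  have "(f (1, real 1 / k) - f (1, real k / k))\<^sup>2 \<le> k * R\<^sub>0 * upper f"
  proof (rule chain_upper[OF f, of 1 rt])
    show "inj_on rt {1..<k}" using inj_rt by (rule inj_on_subset) auto
    fix j assume j: "1 \<le> j" "j < k"
    show "(f (1, real j / k) - f (1, real (Suc j) / k))\<^sup>2 \<le> R\<^sub>0 * E (sub (rt j) f)"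
      using corner_bounds(2)[OF sub_frame_F(4)[OF f j(2)]] j by (simp add: Psi_frame add.commute)
  qed (use rt_not_bottom k1 in auto)
  then show "(f (1, 1 / k) - f (1, 1))\<^sup>2 \<le> k * R\<^sub>0 * upper f" by simp
  have "(f (real 0 / k, 1) - f (real k / k, 1))\<^sup>2 \<le> k * R\<^sub>0 * upper f"
  proof (rule chain_upper[OF f, of 0 tp])
    show "inj_on tp {0..<k}" using inj_tp by (simp add: lessThan_atLeast0)
    fix j assume j: "0 \<le> j" "j < k"
    show "(f (real j / k, 1) - f (real (Suc j) / k, 1))\<^sup>2 \<le> R\<^sub>0 * E (sub (tp j) f)"
      using corner_bounds(3)[OF sub_frame_F(2)[OF f j(2)]] j by (simp add: Psi_frame add.commute)
  qed (use tp_not_bottom in auto)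
  then show "(f (0, 1) - f (1, 1))\<^sup>2 \<le> k * R\<^sub>0 * upper f" by simp
qed

definition lateral :: "(pt \<Rightarrow> real) \<Rightarrow> real" where
  "lateral f = (f (0, 0) - f (0, 1))\<^sup>2 + (f (1, 0) - f (1, 1))\<^sup>2"

text \<open>A lateral side splits at height 1/k into a side of a corner cell and a chain above it.
  The former gets a weight close enough to 1 to be compensated by the factor r gained per
  level.\<close>

lemma lateral_le:
  assumes f: "f \<in> F"
  shows "lateral f \<le> (1 + 1 / (2 * (real k)\<^sup>2)) * (\<Sum>j<k. lateral (sub (bt j) f)) + (1 + 2 * (real k)\<^sup>2) * (2 * (k * R\<^sub>0 * upper f))"
proof -
  let ?e = "1 / (2 * (real k)\<^sup>2)"
  let ?l = "\<lambda>f :: pt \<Rightarrow> real. (f (0, 0) - f (0, 1))\<^sup>2" and ?r = "\<lambda>f :: pt \<Rightarrow> real. (f (1, 0) - f (1, 1))\<^sup>2"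
  have e: "?e > 0" "1 + 1 / ?e = 1 + 2 * (real k)\<^sup>2" by auto
  have k1: "k - 1 < k" using k3 by simp
  have b0: "sub (bt 0) f (0, 0) = f (0, 0)" "sub (bt 0) f (0, 1) = f (0, 1 / k)" by (simp_all add: Psi_frame)
  have "\<Psi> (bt (k - 1)) (1, y) = (1, y / k)" for y
    unfolding Psi_frame(1)[OF k1] last_index[of 1, unfolded power_one_right] ..
  then have b1: "sub (bt (k - 1)) f (1, 0) = f (1, 0)" "sub (bt (k - 1)) f (1, 1) = f (1, 1 / k)"
    by simp_all
  have "?l f \<le> (1 + ?e) * ?l (sub (bt 0) f) + (1 + 2 * (real k)\<^sup>2) * (f (0, 1 / k) - f (0, 1))\<^sup>2"
    using square_add_weighted[OF e(1), of "f (0, 0) - f (0, 1 / k)" "f (0, 1 / k) - f (0, 1)"] unfolding e(2) b0 by simp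
  moreover have "?r f \<le> (1 + ?e) * ?r (sub (bt (k - 1)) f) + (1 + 2 * (real k)\<^sup>2) * (f (1, 1 / k) - f (1, 1))\<^sup>2"
    using square_add_weighted[OF e(1), of "f (1, 0) - f (1, 1 / k)" "f (1, 1 / k) - f (1, 1)"] unfolding e(2) b1 by simp
  moreover have "(1 + 2 * (real k)\<^sup>2) * (f (0, 1 / k) - f (0, 1))\<^sup>2 \<le> (1 + 2 * (real k)\<^sup>2) * (k * R\<^sub>0 * upper f)"
    "(1 + 2 * (real k)\<^sup>2) * (f (1, 1 / k) - f (1, 1))\<^sup>2 \<le> (1 + 2 * (real k)\<^sup>2) * (k * R\<^sub>0 * upper f)"
    using upper_chains[OF f] by (auto intro!: mult_left_mono)
  moreover have "(1 + ?e) * (?l (sub (bt 0) f) + ?r (sub (bt (k - 1)) f)) \<le> (1 + ?e) * (\<Sum>j<k. lateral (sub (bt j) f))"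
  proof (rule mult_left_mono)
    have "?l (sub (bt 0) f) \<le> (\<Sum>j<k. ?l (sub (bt j) f))" "?r (sub (bt (k - 1)) f) \<le> (\<Sum>j<k. ?r (sub (bt j) f))"
      using k1 by (auto intro!: member_le_sum)
    then show "?l (sub (bt 0) f) + ?r (sub (bt (k - 1)) f) \<le> (\<Sum>j<k. lateral (sub (bt j) f))"
      unfolding lateral_def sum.distrib by linarith
  qed simp
  ultimately show ?thesis unfolding lateral_def by (simp only: ring_distribs)
qed

text \<open>Adding a multiple of \<open>lateral f\<close> makes the estimate inductive: \<open>lateral\<close> dominates the
  increment at level 0 up to energy off the bottom row, and it contracts because \<open>r < 1\<close>.\<close>

lemma trace_partial_sums:
  assumes "f \<in> F"
  shows "(\<Sum>m<M. W m (\<lambda>t. f (t, 0))) + 6 * (real k)\<^sup>2 * lateral f \<le> 60 * real k ^ 5 * R\<^sub>0 * E f"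
  using assms
proof (induction M arbitrary: f)
  case 0
  have "6 * (real k)\<^sup>2 * lateral f \<le> 6 * (real k)\<^sup>2 * (2 * (R\<^sub>0 * E f))"
    unfolding lateral_def using corner_bounds(1,2)[OF 0] by (intro mult_left_mono) auto
  also have "\<dots> = 12 * (real k)\<^sup>2 * (R\<^sub>0 * E f)" by simp
  also have "\<dots> \<le> 60 * real k ^ 5 * (R\<^sub>0 * E f)"
  proof (rule mult_right_mono)
    have "(real k)\<^sup>2 \<le> real k ^ 5" using k3 by (intro power_increasing) auto
    moreover have "0 \<le> real k ^ 5" by simp
    ultimately show "12 * (real k)\<^sup>2 \<le> 60 * real k ^ 5" by linarith
  qed (use R0_nonneg E_nonneg[OF 0] in simp)
  finally show ?case by (simp add: mult.assoc)
next
  case (Suc M)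
  note f = \<open>f \<in> F\<close>
  let ?A = "\<lambda>M f. \<Sum>m<M. W m (\<lambda>t. f (t, 0))"
  let ?C = "60 * real k ^ 5 * R\<^sub>0" and ?k2 = "(real k)\<^sup>2"
  let ?L = "\<Sum>j<k. lateral (sub (bt j) f)" and ?Eb = "\<Sum>j<k. E (sub (bt j) f)"
  define T where "T = k * R\<^sub>0 * upper f"
  have T0: "0 \<le> T" unfolding T_def using R0_nonneg upper_nonneg[OF f] by simp
  have L0: "0 \<le> ?L" unfolding lateral_def by (intro sum_nonneg) auto
  have k2: "1 \<le> ?k2" using k3 by (intro one_le_power) simp
  have "?A (Suc M) f = W 0 (\<lambda>t. f (t, 0)) + (\<Sum>m<M. W (Suc m) (\<lambda>t. f (t, 0)))"
    by (rule sum.lessThan_Suc_shift)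
  also have "(\<Sum>m<M. W (Suc m) (\<lambda>t. f (t, 0))) = (\<Sum>j<k. ?A M (sub (bt j) f)) / r"
    unfolding W_sub by (simp add: sum.swap[of _ "{..<M}" "{..<k}"] flip: sum_divide_distrib)
  also have "W 0 (\<lambda>t. f (t, 0)) \<le> 3 * lateral f + 3 * T"
  proof -
    have "(f (0, 0) - f (1, 0))\<^sup>2 \<le> 3 * ((f (0, 0) - f (0, 1))\<^sup>2 + (f (1, 0) - f (1, 1))\<^sup>2) + 3 * (f (0, 1) - f (1, 1))\<^sup>2"
    proof -
      have "(x + y + z)\<^sup>2 \<le> 3 * (x\<^sup>2 + y\<^sup>2) + 3 * z\<^sup>2" for x y z :: real
        using zero_le_power2[of "x - y"] zero_le_power2[of "y - z"] zero_le_power2[of "x - z"]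
        by (simp add: power2_eq_square algebra_simps)
      from this[of "f (0, 0) - f (0, 1)" "f (1, 1) - f (1, 0)" "f (0, 1) - f (1, 1)"] show ?thesis
        by (simp add: power2_commute[of "f (1, 1)"])
    qed
    then show ?thesis using upper_chains(3)[OF f] unfolding W_0 lateral_def T_def by linarith
  qed
  also have "(\<Sum>j<k. ?A M (sub (bt j) f)) / r \<le> (?C * ?Eb - 6 * ?k2 * ?L) / r"
  proof (rule divide_right_mono)
    have "(\<Sum>j<k. ?A M (sub (bt j) f)) \<le> (\<Sum>j<k. ?C * E (sub (bt j) f) - 6 * ?k2 * lateral (sub (bt j) f))"
    proof (rule sum_mono)
      fix j assume "j \<in> {..<k}"
      then have "sub (bt j) f \<in> F" using f by simp
      from Suc.IH[OF this] show "?A M (sub (bt j) f) \<le> ?C * E (sub (bt j) f) - 6 * ?k2 * lateral (sub (bt j) f)"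
        by linarith
    qed
    then show "(\<Sum>j<k. ?A M (sub (bt j) f)) \<le> ?C * ?Eb - 6 * ?k2 * ?L"
      by (simp add: sum_subtractf sum_distrib_left)
  qed (use rpos in simp)
  finally have 1: "?A (Suc M) f \<le> 3 * lateral f + 3 * T + (?C * ?Eb - 6 * ?k2 * ?L) / r" by simp
  have "(3 + 6 * ?k2) * lateral f \<le> (3 + 6 * ?k2) * ((1 + 1 / (2 * ?k2)) * ?L + (1 + 2 * ?k2) * (2 * T))"
    unfolding T_def by (intro mult_left_mono lateral_le f) simp
  also have "\<dots> = (3 + 6 * ?k2) * (1 + 1 / (2 * ?k2)) * ?L + (3 + 6 * ?k2) * (1 + 2 * ?k2) * 2 * T"
  proof -
    have "x * (y * l + z * (2 * t)) = x * y * l + x * z * 2 * t" for x y z l t :: real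
      by (simp add: algebra_simps)
    then show ?thesis .
  qed
  finally have 2: "(3 + 6 * ?k2) * lateral f \<le> \<dots>" .
  \<comment> \<open>This dictates the coefficient of \<open>lateral\<close>: with c for it, (3 +
    c)(1 + 1 / (2 k^2))(1 - 1 / k^2) <= c is needed, and for c = 6 k^2 the terms of order 1 just
    cancel.\<close>
  have 3: "(3 + 6 * ?k2) * (1 + 1 / (2 * ?k2)) * ?L \<le> 6 * ?k2 / r * ?L"
  proof (rule mult_right_mono[OF _ L0])
    have "r * ((3 + 6 * ?k2) * (1 + 1 / (2 * ?k2))) \<le> (1 - 1 / ?k2) * ((3 + 6 * ?k2) * (1 + 1 / (2 * ?k2)))"
      using r_le' by (intro mult_right_mono) auto
    also have "\<dots> \<le> 6 * ?k2"
    proof -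
      have "(1 - 1 / s) * ((3 + 6 * s) * (1 + 1 / (2 * s))) \<le> 6 * s" if "1 \<le> s" for s :: real
      proof -
        have "(1 - 1 / s) * ((3 + 6 * s) * (1 + 1 / (2 * s))) = 6 * s - 9 / 2 / s - 3 / 2 / s\<^sup>2"
          using that by (simp add: field_simps power2_eq_square)
        also have "\<dots> \<le> 6 * s"
        proof -
          have "0 \<le> 9 / 2 / s" "0 \<le> 3 / 2 / s\<^sup>2" using that by auto
          then show ?thesis by linarith
        qed
        finally show ?thesis .
      qed
      then show ?thesis using k2 by blast
    qed
    finally show "(3 + 6 * ?k2) * (1 + 1 / (2 * ?k2)) \<le> 6 * ?k2 / r"
      using rpos by (simp add: pos_le_divide_eq mult.commute)
  qed
  \<comment> \<open>Here 9 * 3 * 2 + 3 = 57 is rounded up to 60; the fifth power of \<open>k\<close>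
    arises from the factor \<open>k\<close> in \<open>T\<close>.\<close>
  have 4: "(3 + 6 * ?k2) * (1 + 2 * ?k2) * 2 * T + 3 * T \<le> ?C * upper f / r"
  proof -
    have "(3 + 6 * ?k2) * (1 + 2 * ?k2) * 2 + 3 \<le> (9 * ?k2) * (3 * ?k2) * 2 + 3 * (?k2 * ?k2)"
      using k2 mult_mono[OF k2 k2] by (intro add_mono mult_mono) auto
    also have "\<dots> \<le> 60 * real k ^ 4" by (simp add: power4_eq_xxxx power2_eq_square)
    finally have "((3 + 6 * ?k2) * (1 + 2 * ?k2) * 2 + 3) * T \<le> 60 * real k ^ 4 * T"
      using T0 by (rule mult_right_mono)
    also have "\<dots> = ?C * upper f / 1" unfolding T_def by (simp add: power_eq_if)
    also have "\<dots> \<le> ?C * upper f / r"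
      using R0_nonneg upper_nonneg[OF f] r_less_1 rpos by (intro divide_left_mono) auto
    finally show ?thesis by (simp add: algebra_simps)
  qed
  have 5: "?C * E f = ?C * ?Eb / r + ?C * upper f / r"
    unfolding E_split_upper[OF f] by (simp add: add_divide_distrib ring_distribs)
  have 6: "(?C * ?Eb - 6 * ?k2 * ?L) / r = ?C * ?Eb / r - 6 * ?k2 / r * ?L"
    by (simp add: diff_divide_distrib)
  have 7: "(3 + 6 * ?k2) * lateral f = 3 * lateral f + 6 * ?k2 * lateral f" by (simp add: ring_distribs)
  show ?case using 1 2 3 4 5 6 7 by linarith
qed

corollary trace_bound:
  assumes "f \<in> F"
  shows "(\<Sum>m<M. W m (\<lambda>t. f (t, 0))) \<le> 60 * real k ^ 5 * R\<^sub>0 * E f"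
proof -
  have "0 \<le> 6 * (real k)\<^sup>2 * lateral f" by (simp add: lateral_def)
  then show ?thesis using trace_partial_sums[OF assms, of M] by linarith
qed

end

section \<open>Trace spaces of the cell boundaries\<close>

definition edge :: "nat \<Rightarrow> real \<Rightarrow> pt" where
  "edge i t = (1 - t) *\<^sub>R side_start i + t *\<^sub>R side_end i"

lemma edge_eqs: "edge 1 t = (t, 0)" "edge 2 t = (1, t)" "edge 3 t = (1 - t, 1)" "edge 4 t = (0, 1 - t)"
  by (simp_all add: edge_def side_start_def side_end_def qq1_def qq2_def qq3_def qq4_def)

context carpet
begin

lemma bdryn_0: "bdryn k N c 0 = bdry0"
  by (auto simp: bdryn_def words_def Psiw_def)

lemma words_Suc: "words N (Suc n) = (\<lambda>(i, w). i # w) ` ({1..N} \<times> words N n)"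
  by (force simp: words_def length_Suc_conv)

lemma Psiw_Cons: "Psiw k c (i # w) = \<Psi> i \<circ> Psiw k c w"
  by (simp add: Psiw_def)

lemma bdryn_Suc: "bdryn k N c (Suc n) = (\<Union>i\<in>{1..N}. \<Psi> i ` bdryn k N c n)"
proof -
  have "bdryn k N c (Suc n) = (\<Union>i\<in>{1..N}. \<Union>w\<in>words N n. Psiw k c (i # w) ` bdry0)"
    unfolding bdryn_def words_Suc by auto
  then show ?thesis unfolding Psiw_Cons bdryn_def by (simp only: image_comp[symmetric] image_UN)
qed

lemma bdry0_subset_bdryn: "bdry0 \<subseteq> bdryn k N c n"
proof (induction n)
  case (Suc n)
  then show ?case using bdry0_self_cover unfolding bdryn_Suc by blast
qed (simp add: bdryn_0)

lemma bdryn_subset_K: "bdryn k N c n \<subseteq> K"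
  by (induction n) (use bdry0_subset_K Psi_in_K in \<open>auto simp: bdryn_0 bdryn_Suc\<close>)

lemma edge_bdry0: "i \<in> {1..4} \<Longrightarrow> 0 \<le> t \<Longrightarrow> t \<le> 1 \<Longrightarrow> edge i t \<in> bdry0"
proof -
  assume i: "i \<in> {1..4}" and t: "0 \<le> t" "t \<le> 1"
  from i consider "i = 1" | "i = 2" | "i = 3" | "i = 4" by fastforce
  then show ?thesis using t by cases (auto simp: edge_eqs[unfolded One_nat_def] bdry0_iff usq_iff)
qed

lemma bdry0_edge: "p \<in> bdry0 \<Longrightarrow> \<exists>i\<in>{1..4}. \<exists>t\<in>{0..1}. p = edge i t"
proof -
  assume p: "p \<in> bdry0"
  obtain x y where xy: "p = (x, y)" by (cases p)
  have b: "0 \<le> x" "x \<le> 1" "0 \<le> y" "y \<le> 1" using p by (auto simp: xy bdry0_iff usq_iff)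
  consider "p = edge 1 x" | "p = edge 2 y" | "p = edge 3 (1 - x)" | "p = edge 4 (1 - y)"
    using p unfolding edge_eqs by (auto simp: xy bdry0_iff)
  then show ?thesis
  proof cases
    case 1 then show ?thesis using b by (intro bexI[of _ 1] bexI[of _ x]) auto
  next
    case 2 then show ?thesis using b by (intro bexI[of _ 2] bexI[of _ y]) auto
  next
    case 3 then show ?thesis using b by (intro bexI[of _ 3] bexI[of _ "1 - x"]) auto
  next
    case 4 then show ?thesis using b by (intro bexI[of _ 4] bexI[of _ "1 - y"]) auto
  qed
qed

end

context carpet_form
begin

lemma ln_k_pos: "0 < ln (real k)"
  using k3 by simp

lemma k_powr_ln: "real k powr (ln r / ln (real k) * a) = r powr a"
  using ln_k_pos rpos by (simp add: powr_def)

definition besov :: "nat \<Rightarrow> (pt \<Rightarrow> real) \<Rightarrow> ennreal" where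
  "besov n u = besov_bdry_sq k N c (sigma_r k r) n u"

lemma besov01_eq: "besov01_sq k (sigma_r k r) u = (\<Sum>m. ennreal (W m u))"
proof -
  have "real k powr ((2 * sigma_r k r - 1) * real m) = 1 / r ^ m" for m
  proof -
    have "(2 * sigma_r k r - 1) * real m = ln r / ln (real k) * (- real m)"
      by (simp add: sigma_r_def field_simps)
    then have "real k powr ((2 * sigma_r k r - 1) * real m) = r powr (- real m)"
      using k_powr_ln by metis
    then show ?thesis by (simp add: powr_minus_divide powr_realpow rpos)
  qed
  then show ?thesis unfolding besov01_sq_def W_def V_def by (simp add: lessThan_atLeast0)
qed

text \<open>For sigma = \<open>sigma_r k r\<close> one has k^(1 - 2 sigma) = r, so shrinking a
  segment by the factor k multiplies the length weight by exactly 1/r, as in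
  \<open>E_split\<close>.\<close>

lemma besov_seg_Psi:
  "besov_seg_sq k (sigma_r k r) (\<Psi> i x) (\<Psi> i y) u = ennreal (1 / r) * besov_seg_sq k (sigma_r k r) x y (u \<circ> \<Psi> i)"
proof -
  let ?a = "1 / 2 - sigma_r k r"
  have a: "?a = ln r / ln (real k) * (1 / 2)" by (simp add: sigma_r_def)
  have "dist (\<Psi> i x) (\<Psi> i y) = dist x y / k"
    by (simp add: Psi_def dist_norm flip: scaleR_diff_right)
  then have "(dist (\<Psi> i x) (\<Psi> i y) powr ?a)\<^sup>2 = (dist x y powr ?a)\<^sup>2 / (real k powr ?a)\<^sup>2"
    by (simp add: powr_divide power_divide)
  also have "(real k powr ?a)\<^sup>2 = r"
    unfolding a k_powr_ln using rpos by (simp add: powr_half_sqrt)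
  finally have d: "(dist (\<Psi> i x) (\<Psi> i y) powr ?a)\<^sup>2 = (1 / r) * (dist x y powr ?a)\<^sup>2" by simp
  have c: "u \<circ> (\<lambda>t. (1 - t) *\<^sub>R \<Psi> i x + t *\<^sub>R \<Psi> i y) = (u \<circ> \<Psi> i) \<circ> (\<lambda>t. (1 - t) *\<^sub>R x + t *\<^sub>R y)"
  proof
    fix t
    have "(1 - t) *\<^sub>R \<Psi> i x + t *\<^sub>R \<Psi> i y = \<Psi> i ((1 - t) *\<^sub>R x + t *\<^sub>R y)"
      by (simp add: Psi_def prod_eq_iff field_simps)
    then show "(u \<circ> (\<lambda>t. (1 - t) *\<^sub>R \<Psi> i x + t *\<^sub>R \<Psi> i y)) t = ((u \<circ> \<Psi> i) \<circ> (\<lambda>t. (1 - t) *\<^sub>R x + t *\<^sub>R y)) t"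
      by simp
  qed
  have r: "0 \<le> 1 / r" using rpos by simp
  show ?thesis unfolding besov_seg_sq_def c d ennreal_mult'[OF r] mult.assoc ..
qed

lemma ennreal_divide_r: "ennreal (1 / r) * ennreal x = ennreal (x / r)"
  using ennreal_mult'[of "1 / r" x] rpos by simp

lemma besov_0: "besov 0 u = (\<Sum>i\<in>{1..4}. \<Sum>m. ennreal (W m (\<lambda>t. u (edge i t))))"
proof -
  have w: "words N 0 = {[]}" by (auto simp: words_def)
  have "besov_seg_sq k (sigma_r k r) (side_start i) (side_end i) u = (\<Sum>m. ennreal (W m (\<lambda>t. u (edge i t))))" for i
  proof -
    have "dist (side_start i) (side_end i) = 1"
      by (simp add: side_start_def side_end_def qq1_def qq2_def qq3_def qq4_def dist_prod_def)
    then show ?thesis unfolding besov_seg_sq_def besov01_eq edge_def by (simp add: comp_def)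
  qed
  then show ?thesis by (simp add: besov_def besov_bdry_sq_def w Psiw_def)
qed

lemma besov_Suc: "besov (Suc n) u = ennreal (1 / r) * (\<Sum>i\<in>{1..N}. besov n (u \<circ> \<Psi> i))"
proof -
  let ?s = "\<lambda>w u. \<Sum>i\<in>{1..4}. besov_seg_sq k (sigma_r k r) (Psiw k c w (side_start i)) (Psiw k c w (side_end i)) u"
  have inj: "inj_on (\<lambda>(i, w). i # w) ({1..N} \<times> words N n)" by (auto simp: inj_on_def)
  have "besov (Suc n) u = (\<Sum>(i, w)\<in>{1..N} \<times> words N n. ?s (i # w) u)"
    unfolding besov_def besov_bdry_sq_def words_Suc sum.reindex[OF inj] by (simp add: case_prod_beta)
  also have "\<dots> = (\<Sum>i\<in>{1..N}. \<Sum>w\<in>words N n. ?s (i # w) u)"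
    by (rule sum.cartesian_product[symmetric])
  also have "\<dots> = (\<Sum>i\<in>{1..N}. \<Sum>w\<in>words N n. ennreal (1 / r) * ?s w (u \<circ> \<Psi> i))"
    by (simp only: Psiw_Cons comp_apply besov_seg_Psi sum_distrib_left)
  finally show ?thesis unfolding besov_def besov_bdry_sq_def sum_distrib_left .
qed

lemma besov_cong: "(\<And>p. p \<in> bdryn k N c n \<Longrightarrow> u p = v p) \<Longrightarrow> besov n u = besov n v"
proof (induction n arbitrary: u v)
  case 0
  have "W m (\<lambda>t. u (edge i t)) = W m (\<lambda>t. v (edge i t))" if "i \<in> {1..4}" for i m
    by (rule W_cong) (use 0 that edge_bdry0 in \<open>auto simp: bdryn_0\<close>)
  then show ?case unfolding besov_0 by (intro sum.cong refl) simp
next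
  case (Suc n)
  have "besov n (u \<circ> \<Psi> i) = besov n (v \<circ> \<Psi> i)" if "i \<in> {1..N}" for i
    by (rule Suc.IH, unfold comp_apply, rule Suc.prems) (use that in \<open>unfold bdryn_Suc, blast\<close>)
  then show ?case unfolding besov_Suc by simp
qed

text \<open>The rotation taking the bottom side to side \<open>i\<close> with its orientation, and its inverse.\<close>

definition rotate :: "nat \<Rightarrow> pt \<Rightarrow> pt" where
  "rotate i = (if i = 2 then (\<lambda>(x, y). (1 - y, x)) else if i = 3 then (\<lambda>(x, y). (1 - x, 1 - y))
    else if i = 4 then (\<lambda>(x, y). (y, 1 - x)) else (\<lambda>(x, y). (x, y)))"

definition turn :: "nat \<Rightarrow> pt \<Rightarrow> pt" where
  "turn i = (if i = 2 then (\<lambda>(x, y). (y, 1 - x)) else if i = 3 then (\<lambda>(x, y). (1 - x, 1 - y))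
    else if i = 4 then (\<lambda>(x, y). (1 - y, x)) else (\<lambda>(x, y). (x, y)))"

lemma identity_D4: "(\<lambda>(x, y). (x, y)) \<in> D4"
  by (simp add: D4_def)

lemma rotate_D4: "rotate i \<in> D4" and turn_D4: "turn i \<in> D4"
  by (simp_all only: rotate_def turn_def D4_members identity_D4 simp_thms split: if_split)

lemma rotate_edge: "i \<in> {1..4} \<Longrightarrow> rotate i (t, 0) = edge i t"
proof -
  assume "i \<in> {1..4}"
  then consider "i = 1" | "i = 2" | "i = 3" | "i = 4" by fastforce
  then show ?thesis by cases (simp_all add: rotate_def edge_eqs[unfolded One_nat_def])
qed

text \<open>\<open>turn i\<close> carries side i to the bottom and the others to the sides where
  \<open>s\<close> vanishes, so extensions from the four sides can be added without
  interference.\<close>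

lemma vanish_turn:
  assumes "\<And>t. 0 \<le> t \<Longrightarrow> t \<le> 1 \<Longrightarrow> s (t, 0) = w t \<and> s (t, 1) = 0 \<and> s (0, t) = 0 \<and> s (1, t) = (0 :: real)"
    and "i \<in> {1..4}" "j \<in> {1..4}" "0 \<le> t" "t \<le> 1"
  shows "sym (turn i) s (edge j t) = (if i = j then w t else 0)"
proof -
  have K: "edge j t \<in> K" using edge_bdry0[OF assms(3-5)] bdry0_subset_K by blast
  have t: "0 \<le> 1 - t" "1 - t \<le> 1" using assms by auto
  note s = assms(1)[OF assms(4,5)] assms(1)[OF t]
  have i: "i = 1 \<or> i = 2 \<or> i = 3 \<or> i = 4" and j: "j = 1 \<or> j = 2 \<or> j = 3 \<or> j = 4" using assms(2,3) by fastforce+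
  show ?thesis unfolding sym_apply[OF K]
    using i j s by (elim disjE) (simp_all add: turn_def edge_eqs[unfolded One_nat_def])
qed

end

context carpet_corner_bound
begin

lemma besov_le_energy: "f \<in> F \<Longrightarrow> besov n f \<le> ennreal (240 * real k ^ 5 * R\<^sub>0 * E f)"
proof (induction n arbitrary: f)
  case 0
  define b where "b = 60 * real k ^ 5 * R\<^sub>0 * E f"
  have b: "0 \<le> b" using R0_nonneg E_nonneg[OF 0] by (simp add: b_def)
  have "(\<Sum>m. ennreal (W m (\<lambda>t. f (edge i t)))) \<le> ennreal b" if i: "i \<in> {1..4}" for i
  proof -
    let ?g = "sym (rotate i) f"
    have g: "?g \<in> F" "E ?g = E f" using 0 by (simp_all add: sym_F E_sym rotate_D4)
    have W: "W m (\<lambda>t. f (edge i t)) = W m (\<lambda>t. ?g (t, 0))" for m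
      by (rule W_cong) (simp add: rotate_edge[OF i])
    have "(\<Sum>m<M. ennreal (W m (\<lambda>t. ?g (t, 0)))) \<le> ennreal b" for M
      using trace_bound[OF g(1), of M] g(2) by (simp add: sum_ennreal W_nonneg ennreal_leI b_def)
    then show ?thesis unfolding W suminf_eq_SUP by (intro SUP_least)
  qed
  then have "besov 0 f \<le> (\<Sum>i\<in>{1..4::nat}. ennreal b)" unfolding besov_0 by (rule sum_mono)
  also have "\<dots> = ennreal (4 * b)" using b ennreal_mult'[of 4 b] by simp
  finally show ?case by (simp add: b_def mult.assoc)
next
  case (Suc n)
  let ?C = "240 * real k ^ 5 * R\<^sub>0"
  have C: "0 \<le> ?C" using R0_nonneg by simp
  have "besov (Suc n) f = ennreal (1 / r) * (\<Sum>i\<in>{1..N}. besov n (sub i f))"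
    unfolding besov_Suc
    by (intro arg_cong2[where f = "(*)"] sum.cong refl besov_cong) (simp add: subsetD[OF bdryn_subset_K])
  also have "\<dots> \<le> ennreal (1 / r) * (\<Sum>i\<in>{1..N}. ennreal (?C * E (sub i f)))"
    using Suc by (intro mult_left_mono sum_mono Suc.IH sub_F) auto
  also have "\<dots> = ennreal ((\<Sum>i\<in>{1..N}. ?C * E (sub i f)) / r)"
    using C Suc.prems by (subst sum_ennreal) (auto simp: ennreal_divide_r sub_F E_nonneg)
  also have "(\<Sum>i\<in>{1..N}. ?C * E (sub i f)) / r = ?C * E f"
    unfolding E_split[OF Suc.prems] by (simp flip: sum_distrib_left)
  finally show ?case .
qed

end

context carpet_form
begin

lemma summable_of_finite:
  assumes "(\<Sum>m. ennreal (W m u)) < top"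
  shows "summable (\<lambda>m. W m u)" and "(\<Sum>m. ennreal (W m u)) = ennreal (\<Sum>m. W m u)"
proof -
  show "summable (\<lambda>m. W m u)"
    by (rule summable_suminf_not_top) (use assms W_nonneg in auto)
  then show "(\<Sum>m. ennreal (W m u)) = ennreal (\<Sum>m. W m u)"
    by (intro suminf_ennreal2 W_nonneg)
qed

text \<open>Level 0 alone controls the slope of the chord, and the levels of linear data sum to at
  most 2, so subtracting the chord costs a factor 2 + 2 * 2 = 6.\<close>

lemma remove_affine:
  assumes sm: "summable (\<lambda>m. W m u)"
  defines "w \<equiv> \<lambda>t. u t - (u 0 + (u 1 - u 0) * t)"
  shows "summable (\<lambda>m. W m w)" "(\<Sum>m. W m w) \<le> 6 * (\<Sum>m. W m u)" "(u 1 - u 0)\<^sup>2 \<le> (\<Sum>m. W m u)"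
proof -
  let ?d = "(u 1 - u 0)\<^sup>2"
  have le: "W m w \<le> 2 * W m u + 2 * (?d * W m (\<lambda>t. t))" for m
    using W_diff_le[of m u "\<lambda>t. u 0 + (u 1 - u 0) * t"] unfolding w_def W_affine .
  have sm': "summable (\<lambda>m. 2 * W m u + 2 * (?d * W m (\<lambda>t. t)))"
    using sm W_id_sums(1) by (intro summable_add summable_mult)
  show sw: "summable (\<lambda>m. W m w)"
    by (rule summable_comparison_test[OF _ sm']) (use le W_nonneg in \<open>auto intro!: exI[of _ 0]\<close>)
  have "?d = W 0 u" by (simp add: W_0 power2_commute)
  also have "\<dots> \<le> (\<Sum>m. W m u)" using sum_le_suminf[OF sm, of "{0}"] W_nonneg by simp
  finally show d: "?d \<le> (\<Sum>m. W m u)" .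
  have "(\<Sum>m. W m w) \<le> (\<Sum>m. 2 * W m u + 2 * (?d * W m (\<lambda>t. t)))" by (rule suminf_le[OF le sw sm'])
  also have "\<dots> = 2 * (\<Sum>m. W m u) + 2 * (?d * (\<Sum>m. W m (\<lambda>t. t)))"
    using sm W_id_sums(1) by (simp add: suminf_add[symmetric] suminf_mult summable_mult)
  also have "?d * (\<Sum>m. W m (\<lambda>t. t)) \<le> (\<Sum>m. W m u) * 2"
    using d W_id_sums by (intro mult_mono suminf_nonneg W_nonneg) (auto simp: sm W_nonneg suminf_nonneg)
  finally show "(\<Sum>m. W m w) \<le> 6 * (\<Sum>m. W m u)" by simp
qed

text \<open>One-sided extensions with zero lateral traces need data vanishing at the corners. The
  corner values are first interpolated by a function that is affine along each side, built from
  \<open>linear_trace\<close>.\<close>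

lemma extension_0:
  assumes cont: "continuous_on bdry0 u" and fin: "besov 0 u < top"
  shows "\<exists>f\<in>F. (\<forall>p\<in>bdry0. f p = u p) \<and> ennreal (E f) \<le> ennreal (15000 * real k ^ 4) * besov 0 u"
proof -
  define v where "v i t = u (edge i t)" for i t
  define A where "A i = (\<Sum>m. W m (v i))" for i
  have fin': "(\<Sum>m. ennreal (W m (v i))) < top" if "i \<in> {1..4}" for i
  proof -
    have "(\<Sum>m. ennreal (W m (v i))) \<le> besov 0 u"
      unfolding besov_0 v_def by (rule member_le_sum[OF that]) auto
    then show ?thesis using fin by (rule le_less_trans)
  qed
  have sm: "summable (\<lambda>m. W m (v i))" and A: "(\<Sum>m. ennreal (W m (v i))) = ennreal (A i)" if "i \<in> {1..4}" for i
    unfolding A_def using summable_of_finite[OF fin'[OF that]] by auto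
  have A0: "0 \<le> A i" if "i \<in> {1..4}" for i
    unfolding A_def by (intro suminf_nonneg sm[OF that] W_nonneg)
  have I: "1 \<in> {1..4::nat}" "2 \<in> {1..4::nat}" "3 \<in> {1..4::nat}" "4 \<in> {1..4::nat}" by auto
  have besov_A: "besov 0 u = ennreal (A 1 + A 2 + A 3 + A 4)"
  proof -
    have "besov 0 u = (\<Sum>i\<in>{1..4}. ennreal (A i))"
      unfolding besov_0 by (rule sum.cong) (use A in \<open>auto simp: v_def[abs_def]\<close>)
    also have "\<dots> = ennreal (\<Sum>i\<in>{1..4}. A i)" using A0 by (intro sum_ennreal) auto
    finally show ?thesis by (simp add: numeral_eq_Suc add_ac)
  qed
  define w where "w i = (\<lambda>t. v i t - (v i 0 + (v i 1 - v i 0) * t))" for i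
  have "\<exists>s\<in>F. (\<forall>t. 0 \<le> t \<longrightarrow> t \<le> 1 \<longrightarrow> s (t, 0) = w i t \<and> s (t, 1) = 0 \<and> s (0, t) = 0 \<and> s (1, t) = 0) \<and>
      E s \<le> 408 * real k ^ 4 * A i" if i: "i \<in> {1..4}" for i
  proof -
    have "continuous_on {0..1} (v i)" unfolding v_def
      by (rule continuous_on_compose2[OF cont]) (use edge_bdry0[OF i] in \<open>auto simp: edge_def intro!: continuous_intros\<close>)
    then have "continuous_on {0..1} (w i)" unfolding w_def by (intro continuous_intros)
    moreover note ra = remove_affine[OF sm[OF i], folded w_def A_def]
    moreover have "w i 0 = 0" "w i 1 = 0" by (simp_all add: w_def)
    ultimately obtain s where s: "s \<in> F" "\<And>t. 0 \<le> t \<Longrightarrow> t \<le> 1 \<Longrightarrow> s (t, 0) = w i t \<and> s (t, 1) = 0 \<and> s (0, t) = 0 \<and> s (1, t) = 0"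
      "E s \<le> 68 * real k ^ 4 * (\<Sum>m. W m (w i))"
      using edge_extension_zero by metis
    have "68 * real k ^ 4 * (\<Sum>m. W m (w i)) \<le> 68 * real k ^ 4 * (6 * A i)"
      using ra(2) by (intro mult_left_mono) auto
    then have "E s \<le> 408 * real k ^ 4 * A i" using s(3) by linarith
    then show ?thesis using s(1,2) by blast
  qed
  then obtain s where s: "\<And>i. i \<in> {1..4} \<Longrightarrow> s i \<in> F"
    "\<And>i t. i \<in> {1..4} \<Longrightarrow> 0 \<le> t \<Longrightarrow> t \<le> 1 \<Longrightarrow> s i (t, 0) = w i t \<and> s i (t, 1) = 0 \<and> s i (0, t) = 0 \<and> s i (1, t) = 0"
    "\<And>i. i \<in> {1..4} \<Longrightarrow> E (s i) \<le> 408 * real k ^ 4 * A i"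
    by metis
  define g where "g i = sym (turn i) (s i)" for i
  have gF: "g i \<in> F" and gE: "E (g i) \<le> 408 * real k ^ 4 * A i" if "i \<in> {1..4}" for i
    unfolding g_def using s[OF that] turn_D4 by (auto simp: sym_F E_sym)
  have g_edge: "g i (edge j t) = (if i = j then w i t else 0)" if "i \<in> {1..4}" "j \<in> {1..4}" "0 \<le> t" "t \<le> 1" for i j t
    unfolding g_def by (rule vanish_turn[of "s i" "w i", OF s(2)[OF that(1)] that])
  obtain X where X: "X \<in> F" "\<And>p. p \<in> bdry0 \<Longrightarrow> X p = fst p" "E X \<le> 272 * real k ^ 4"
    using linear_trace by blast
  define Y where "Y = sym (\<lambda>(x, y). (y, x)) X"
  have Y: "Y \<in> F" "E Y \<le> 272 * real k ^ 4" unfolding Y_def using X by (auto simp: sym_F E_sym)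
  have Y_bdry: "Y (x, y) = y" if "(x, y) \<in> bdry0" for x y
  proof -
    have "(y, x) \<in> bdry0" using that by (auto simp: bdry0_iff usq_iff)
    then show ?thesis using X(2)[of "(y, x)"] that bdry0_subset_K by (auto simp: Y_def)
  qed
  \<comment> \<open>On \<open>bdry0\<close> the minimum of x and y equals the product x y, so
    \<open>Z\<close> serves as the bilinear term while \<open>E_min\<close> controls its
    energy.\<close>
  define Z where "Z p = min (X p) (Y p)" for p
  have Z: "Z \<in> F" "E Z \<le> 544 * real k ^ 4"
    unfolding Z_def[abs_def] using min_in_F[OF X(1) Y(1)] E_min[OF X(1) Y(1)] X(3) Y(2) by auto
  define a where "a i = v i 0" for i
  have a: "a 1 = u (0, 0)" "a 2 = u (1, 0)" "a 3 = u (1, 1)" "a 4 = u (0, 1)"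
    "v 1 1 = a 2" "v 2 1 = a 3" "v 3 1 = a 4" "v 4 1 = a 1"
    by (simp_all add: a_def v_def edge_eqs edge_eqs[unfolded One_nat_def])
  define b where "b = a 3 - a 2 - a 4 + a 1"
  define P where "P p = (a 2 - a 1) * X p + ((a 4 - a 1) * Y p + b * Z p)" for p
  define Q where "Q p = P p + rst K (\<lambda>_. a 1) p" for p
  have PF: "P \<in> F" unfolding P_def[abs_def] by (intro F_add F_scale X Y Z)
  have QF: "Q \<in> F" unfolding Q_def[abs_def] by (intro F_add PF F_const)
  have EQ: "E Q = E P" unfolding Q_def[abs_def] by (rule E_add_const[OF PF])
  have Q_edge: "Q (edge j t) = v j 0 + (v j 1 - v j 0) * t" if j: "j \<in> {1..4}" and t: "0 \<le> t" "t \<le> 1" for j t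
  proof -
    have e: "edge j t \<in> bdry0" by (rule edge_bdry0[OF that])
    then have K: "edge j t \<in> K" using bdry0_subset_K by blast
    have XY: "X (edge j t) = fst (edge j t)" "Y (edge j t) = snd (edge j t)"
      using X(2)[OF e] Y_bdry[of "fst (edge j t)" "snd (edge j t)"] e by auto
    have Qe: "Q (edge j t) = a 1 + (a 2 - a 1) * fst (edge j t) + (a 4 - a 1) * snd (edge j t)
      + b * min (fst (edge j t)) (snd (edge j t))"
      using K by (simp add: Q_def P_def Z_def XY rst_def)
    from j consider "j = 1" | "j = 2" | "j = 3" | "j = 4" by fastforce
    then have "a 1 + (a 2 - a 1) * fst (edge j t) + (a 4 - a 1) * snd (edge j t)
      + b * min (fst (edge j t)) (snd (edge j t)) = a j + (v j 1 - a j) * t" (is ?eq)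
    proof cases
      case 1
      then show ?eq unfolding \<open>j = 1\<close> edge_eqs a(5) using t by simp
    next
      case 2
      then show ?eq unfolding \<open>j = 2\<close> edge_eqs a(6) using t by (simp add: b_def algebra_simps)
    next
      case 3
      then show ?eq unfolding \<open>j = 3\<close> edge_eqs a(7) using t by (simp add: b_def algebra_simps)
    next
      case 4
      then show ?eq unfolding \<open>j = 4\<close> edge_eqs a(8) using t by (simp add: b_def algebra_simps)
    qed
    then show ?thesis unfolding Qe a_def[symmetric] .
  qed
  define f where "f p = Q p + ((g 1 p + g 2 p) + (g 3 p + g 4 p))" for p
  have fF: "f \<in> F" unfolding f_def[abs_def] using QF gF I by (intro F_add) auto
  have f_bdry: "f p = u p" if p: "p \<in> bdry0" for p
  proof -
    obtain j t where jt: "j \<in> {1..4}" "t \<in> {0..1}" "p = edge j t" using bdry0_edge[OF p] by blast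
    from jt(1) have "g 1 p + g 2 p + (g 3 p + g 4 p) = w j t"
      using g_edge[OF I(1) jt(1), of t] g_edge[OF I(2) jt(1), of t] g_edge[OF I(3) jt(1), of t] g_edge[OF I(4) jt(1), of t] jt
      by (elim atLeastAtMost_iff[THEN iffD1, elim_format]) (auto split: if_splits simp: numeral_eq_Suc le_Suc_eq)
    then show ?thesis using Q_edge[OF jt(1), of t] jt by (simp add: f_def w_def v_def)
  qed
  let ?k = "real k ^ 4"
  have k0: "0 \<le> ?k" by simp
  have d: "(a 2 - a 1)\<^sup>2 \<le> A 1" "(a 3 - a 2)\<^sup>2 \<le> A 2" "(a 4 - a 1)\<^sup>2 \<le> A 4"
    using remove_affine(3)[OF sm[OF I(1)], folded A_def] remove_affine(3)[OF sm[OF I(2)], folded A_def]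
      remove_affine(3)[OF sm[OF I(4)], folded A_def] unfolding a a_def[symmetric] by (auto simp: power2_commute)
  have "b\<^sup>2 \<le> 2 * (a 3 - a 2)\<^sup>2 + 2 * (a 4 - a 1)\<^sup>2"
    using zero_le_power2[of "(a 3 - a 2) + (a 4 - a 1)"] unfolding b_def
    by (simp add: power2_eq_square algebra_simps)
  then have b2: "b\<^sup>2 \<le> 2 * A 2 + 2 * A 4" using d by linarith
  have "E (\<lambda>p. (a 2 - a 1) * X p) \<le> A 1 * (272 * ?k)" "E (\<lambda>p. (a 4 - a 1) * Y p) \<le> A 4 * (272 * ?k)"
    "E (\<lambda>p. b * Z p) \<le> (2 * A 2 + 2 * A 4) * (544 * ?k)"
    unfolding E_scale[OF X(1)] E_scale[OF Y(1)] E_scale[OF Z(1)]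
    using d X Y Z b2 E_nonneg A0 I by (auto intro!: mult_mono)
  then have "E P \<le> 2 * (A 1 * (272 * ?k)) + 2 * (2 * (A 4 * (272 * ?k)) + 2 * ((2 * A 2 + 2 * A 4) * (544 * ?k)))"
    unfolding P_def[abs_def] by (intro E_add_bound F_add F_scale X(1) Y(1) Z(1))
  then have EP: "E P \<le> 544 * (?k * A 1) + 5440 * (?k * A 4) + 4352 * (?k * A 2)" by (simp add: algebra_simps)
  have "E f \<le> 2 * E P + 2 * (2 * (2 * (408 * ?k * A 1) + 2 * (408 * ?k * A 2))
      + 2 * (2 * (408 * ?k * A 3) + 2 * (408 * ?k * A 4)))"
    unfolding f_def[abs_def] by (intro E_add_bound F_add QF gF gE I) (simp add: EQ)
  then have "E f \<le> 2 * E P + 3264 * (?k * A 1) + 3264 * (?k * A 2) + 3264 * (?k * A 3) + 3264 * (?k * A 4)"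
    by (simp add: algebra_simps)
  moreover have "0 \<le> ?k * A 1" "0 \<le> ?k * A 2" "0 \<le> ?k * A 3" "0 \<le> ?k * A 4" using A0 I by auto
  moreover have "15000 * ?k * (A 1 + A 2 + A 3 + A 4) = 15000 * (?k * A 1) + 15000 * (?k * A 2) + 15000 * (?k * A 3) + 15000 * (?k * A 4)"
    by (simp add: algebra_simps)
  \<comment> \<open>The largest coefficient is that of \<open>A 4\<close>, namely 2 * 5440 + 3264 =
    14144.\<close>
  ultimately have "E f \<le> 15000 * ?k * (A 1 + A 2 + A 3 + A 4)" using EP by linarith
  then have "ennreal (E f) \<le> ennreal (15000 * ?k) * besov 0 u"
    unfolding besov_A by (subst ennreal_mult'[symmetric], simp, rule ennreal_leI)
  then show ?thesis using fF f_bdry by blast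
qed

text \<open>Pieces on different cells meet only in images of \<open>bdry0\<close>, which lies in
  every \<open>bdryn\<close>; there they are values of the same \<open>u\<close> and hence
  compatible.\<close>

lemma extension:
  assumes "continuous_on (bdryn k N c n) u" "besov n u < top"
  shows "\<exists>f\<in>F. (\<forall>p\<in>bdryn k N c n. f p = u p) \<and> ennreal (E f) \<le> ennreal (15000 * real k ^ 4) * besov n u"
  using assms
proof (induction n arbitrary: u)
  case 0
  then show ?case using extension_0 by (simp add: bdryn_0)
next
  case (Suc n)
  let ?C = "ennreal (15000 * real k ^ 4)"
  have ri: "0 < ennreal (1 / r)" using rpos by simp
  have "\<exists>f\<in>F. (\<forall>p\<in>bdryn k N c n. f p = (u \<circ> \<Psi> i) p) \<and> ennreal (E f) \<le> ?C * besov n (u \<circ> \<Psi> i)" if i: "i \<in> {1..N}" for i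
  proof (rule Suc.IH)
    show "continuous_on (bdryn k N c n) (u \<circ> \<Psi> i)"
      unfolding comp_def by (rule continuous_on_compose2[OF Suc.prems(1)])
        (use i in \<open>auto simp: Psi_def bdryn_Suc intro!: continuous_intros\<close>)
    have "ennreal (1 / r) * besov n (u \<circ> \<Psi> i) \<le> besov (Suc n) u"
      unfolding besov_Suc using i by (intro mult_left_mono member_le_sum) auto
    also note Suc.prems(2)
    finally show "besov n (u \<circ> \<Psi> i) < top" using ri by (auto simp: ennreal_mult_less_top)
  qed
  then obtain g where g: "\<And>i. i \<in> {1..N} \<Longrightarrow> g i \<in> F"
    "\<And>i p. i \<in> {1..N} \<Longrightarrow> p \<in> bdryn k N c n \<Longrightarrow> g i p = u (\<Psi> i p)"
    "\<And>i. i \<in> {1..N} \<Longrightarrow> ennreal (E (g i)) \<le> ?C * besov n (u \<circ> \<Psi> i)"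
    by (metis comp_apply)
  have comp: "compatible g" unfolding compatible_def
  proof (intro ballI impI)
    fix i j p q assume h: "i \<in> {1..N}" "j \<in> {1..N}" "i \<noteq> j" "p \<in> K" "q \<in> K" "\<Psi> i p = \<Psi> j q"
    then have "p \<in> bdry0" "q \<in> bdry0" using cells_contact_bdry0 K_subset_usq by blast+
    then have "p \<in> bdryn k N c n" "q \<in> bdryn k N c n" using bdry0_subset_bdryn by blast+
    then show "g i p = g j q" using g(2) h by metis
  qed
  have "glue g p = u p" if p: "p \<in> bdryn k N c (Suc n)" for p
  proof -
    obtain i q where iq: "i \<in> {1..N}" "q \<in> bdryn k N c n" "p = \<Psi> i q" using p unfolding bdryn_Suc by blast
    then show ?thesis using glue_apply[OF comp iq(1)] g(2) bdryn_subset_K by (metis subsetD)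
  qed
  moreover have "ennreal (E (glue g)) \<le> ?C * besov (Suc n) u"
  proof -
    have "ennreal (E (glue g)) = ennreal ((\<Sum>i\<in>{1..N}. E (g i)) / r)" using E_glue[OF comp g(1)] by simp
    also have "\<dots> = ennreal (1 / r) * (\<Sum>i\<in>{1..N}. ennreal (E (g i)))"
      using g(1) by (subst sum_ennreal) (auto simp: ennreal_divide_r E_nonneg)
    also have "\<dots> \<le> ennreal (1 / r) * (\<Sum>i\<in>{1..N}. ?C * besov n (u \<circ> \<Psi> i))"
      using g(3) by (intro mult_left_mono sum_mono) auto
    also have "\<dots> = ?C * besov (Suc n) u" unfolding besov_Suc by (simp add: mult.left_commute flip: sum_distrib_left)
    finally show ?thesis .
  qed
  ultimately show ?case using glue_F[OF comp g(1)] by blast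
qed

end

context carpet_corner_bound
begin

lemma trace_space: "(\<lambda>f. rst (bdryn k N c n) f) ` F = besov_space k N c (sigma_r k r) n"
proof (intro subset_antisym subsetI)
  fix v assume "v \<in> (\<lambda>f. rst (bdryn k N c n) f) ` F"
  then obtain f where f: "f \<in> F" "v = rst (bdryn k N c n) f" by blast
  have eq: "v p = f p" if "p \<in> bdryn k N c n" for p using that f by (simp add: rst_def)
  have "continuous_on (bdryn k N c n) v"
    using continuous_on_subset[OF F_continuous[OF f(1)] bdryn_subset_K] eq by (simp cong: continuous_on_cong)
  moreover have "besov n v = besov n f" using eq by (rule besov_cong)
  then have "besov n v < top" using besov_le_energy[OF f(1), of n] by (metis ennreal_less_top le_less_trans)
  ultimately show "v \<in> besov_space k N c (sigma_r k r) n"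
    using f(2) unfolding besov_space_def besov_def funs_on_def by (simp add: rst_def)
next
  fix u assume "u \<in> besov_space k N c (sigma_r k r) n"
  then have u: "\<And>p. p \<notin> bdryn k N c n \<Longrightarrow> u p = 0" "continuous_on (bdryn k N c n) u" "besov n u < top"
    by (auto simp: besov_space_def funs_on_def besov_def)
  obtain f where f: "f \<in> F" "\<forall>p\<in>bdryn k N c n. f p = u p" using extension[OF u(2,3)] by blast
  then have "u = rst (bdryn k N c n) f" using u(1) by (auto simp: rst_def fun_eq_iff)
  then show "u \<in> (\<lambda>f. rst (bdryn k N c n) f) ` F" using f(1) by blast
qed

lemma harmonic_energy_le:
  assumes "h \<in> harmonic_n E F (bdryn k N c n)"
  shows "ennreal (E h) \<le> ennreal (15000 * real k ^ 4) * besov n h"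
proof -
  have h: "h \<in> F" "E h = Inf {E f | f. f \<in> F \<and> (\<forall>x\<in>bdryn k N c n. f x = h x)}"
    using assms by (auto simp: harmonic_n_def)
  have "continuous_on (bdryn k N c n) h"
    by (rule continuous_on_subset[OF F_continuous[OF h(1)] bdryn_subset_K])
  moreover have "besov n h < top" using besov_le_energy[OF h(1), of n] by (metis ennreal_less_top le_less_trans)
  ultimately obtain f where f: "f \<in> F" "\<forall>p\<in>bdryn k N c n. f p = h p"
    "ennreal (E f) \<le> ennreal (15000 * real k ^ 4) * besov n h" using extension by blast
  have "E h \<le> E f" unfolding h(2)
    by (rule cInf_lower) (use f E_nonneg in \<open>auto intro!: bdd_belowI[of _ 0]\<close>)
  then show ?thesis using f(3) by (meson ennreal_leI order_trans)
qed

end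

theorem theorem4p3:
  fixes k :: nat
  assumes "k \<ge> 3"
  shows "\<exists>C1 C2. C1 > 0 \<and> C2 > 0 \<and>
    (\<forall>N c K E F r. USC k N c \<and> is_attractor k N c K \<and>
       resistance_form K E F \<and> r > 0 \<and> self_similar_form k N c K E F r \<and>
       D4_symmetric K E F \<and> jointly_continuous K E F \<and>
       eff_res E F (side 2) (side 4) = 1 \<longrightarrow>
       (\<forall>n. (\<lambda>f. rst (bdryn k N c n) f) ` F = besov_space k N c (sigma_r k r) n \<and>
            (\<forall>h\<in>harmonic_n E F (bdryn k N c n).
               ennreal C1 * besov_bdry_sq k N c (sigma_r k r) n h \<le> ennreal (E h) \<and>
               ennreal (E h) \<le> ennreal C2 * besov_bdry_sq k N c (sigma_r k r) n h)))"
proof -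
  \<comment> \<open>\<open>?q\<close> bounds sqrt r and involves only \<open>k\<close>. So the depth
    m, and with it the corner resistance bound 4 k^m, is chosen before the carpet and the form are
    fixed.\<close>
  let ?q = "1 - 1 / (2 * (real k)\<^sup>2)"
  have k: "real k > 0" "1 \<le> (real k)\<^sup>2" using assms by (auto intro: one_le_power)
  have "0 \<le> 1 - 1 / (2 * s) \<and> 1 - 1 / (2 * s) < 1" if "1 \<le> s" for s :: real
    using that by (simp add: field_simps)
  from this[OF k(2)] have "0 \<le> ?q" "?q < 1" by auto
  then have "(\<lambda>m. 8 * real k ^ 3 * ?q ^ m) \<longlonglongrightarrow> 8 * real k ^ 3 * 0"
    by (intro tendsto_mult tendsto_const LIMSEQ_realpow_zero)
  then have "eventually (\<lambda>m. 8 * real k ^ 3 * ?q ^ m < 1) sequentially"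
    by (rule order_tendstoD(2)) simp
  then obtain m where m: "8 * real k ^ 3 * ?q ^ m \<le> 1"
    by (metis eventually_sequentially less_imp_le order_refl)
  define C where "C = 240 * real k ^ 5 * (4 * real k ^ m)"
  have C: "C > 0" unfolding C_def using k by simp
  show ?thesis
  proof (rule exI[of _ "1 / C"], rule exI[of _ "15000 * real k ^ 4"], intro conjI allI impI ballI)
    show "1 / C > 0" "15000 * real k ^ 4 > 0" using C k by auto
    fix N c K E F r n
    assume "USC k N c \<and> is_attractor k N c K \<and>
       resistance_form K E F \<and> r > 0 \<and> self_similar_form k N c K E F r \<and>
       D4_symmetric K E F \<and> jointly_continuous K E F \<and>
       eff_res E F (side 2) (side 4) = 1"
    then interpret carpet_form k N c K E F r by unfold_locales auto
    interpret carpet_corner_bound k N c K E F r "4 * real k ^ m"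
      by unfold_locales (rule corner_resistance[OF m])
    show "(\<lambda>f. rst (bdryn k N c n) f) ` F = besov_space k N c (sigma_r k r) n" by (rule trace_space)
    fix h assume h: "h \<in> harmonic_n E F (bdryn k N c n)"
    then have hF: "h \<in> F" by (simp add: harmonic_n_def)
    show "ennreal (E h) \<le> ennreal (15000 * real k ^ 4) * besov_bdry_sq k N c (sigma_r k r) n h"
      using harmonic_energy_le[OF h] unfolding besov_def .
    have "ennreal (1 / C) * besov n h \<le> ennreal (1 / C) * ennreal (C * E h)"
      using besov_le_energy[OF hF, of n] by (intro mult_left_mono) (auto simp: C_def)
    also have "\<dots> = ennreal (1 / C * (C * E h))" using C by (subst ennreal_mult') (auto simp: E_nonneg hF)
    also have "1 / C * (C * E h) = E h" using C by simp
    finally show "ennreal (1 / C) * besov_bdry_sq k N c (sigma_r k r) n h \<le> ennreal (E h)" unfolding besov_def .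
  qed
qed

end
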